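(* Assume that for all $i\in\mathcal I$, $H(i,\cdot)$ is (strictly) increasing with respect to each coordinate. Let $q_\infty=\lim_{t\to+\infty}\sup_{i\in\mathcal I}(U_i(t)-\gamma t-\xi_i)$ (which exists in $\mathbb R$). Then the undiscounted ($r=0$) value functions satisfy, for all $i\in\mathcal I$ and all $t\in\mathbb R_+$, $$u^{T,0}_i(t)=\gamma(T-t)+\xi_i+q_\infty+o(1)\qquad\text{as }T\to+\infty.$$ Moreover, for each $T>0$ let $\lambda^{*,T}\in\mathcal A^T_0$ be an optimal feedback control satisfying, for all $i\in\mathcal I$ and $t\in[0,T]$, $$\big(\lambda^{*,T}_t(i,j)\big)_{j\in\mathcal V(i)}\in\underset{(\lambda_{ij})_{j}\in\mathbb R_+^{|\mathcal V(i)|}}{\operatorname{argmax}}\Big(\sum_{j\in\mathcal V(i)}\lambda_{ij}\big(u^{T,0}_j(t)-u^{T,0}_i(t)\big)-L\big(i,(\lambda_{ij})_{j\in\mathcal V(i)}\big)\Big).$$ Then for every $t\in\mathbb R_+$, every limit point $(\lambda(i,j))_{i\in\mathcal I,j\in\mathcal V(i)}$ of $(\lambda^{*,T}_t(i,j))_{i\in\mathcal I,j\in\mathcal V(i)}$ as $T\to+\infty$ (i.e. every limit along some sequence $T_n\to+\infty$) satisfies, for all $i\in\mathcal I$, $$\big(\lambda(i,j)\big)_{j\in\mathcal V(i)}\in\underset{(\lambda_{ij})_{j}\in\mathbb R_+^{|\mathcal V(i)|}}{\operatorname{argmax}}\Big(\sum_{j\in\mathcal V(i)}\lambda_{ij}(\xi_j-\xi_i)-L\big(i,(\lambda_{ij})_{j\in\mathcal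 V(i)}\big)\Big).$$
   Context: $\mathcal I=\{1,\dots,N\}$ is the set of nodes of a finite strongly connected directed graph $\mathcal G$ (for any two nodes $i,j$ there is a directed path from $i$ to $j$). For $i\in\mathcal I$, $\mathcal V(i)\subset\mathcal I\setminus\{i\}$ is the set of nodes $j$ for which there is a directed edge from $i$ to $j$. $\mathbb R_+=[0,\infty)$, $\mathbb R_+^*=(0,\infty)$. For each $i\in\mathcal I$ a cost function $L(i,\cdot):\mathbb R_+^{|\mathcal V(i)|}\to\mathbb R\cup\{+\infty\}$ is given, with: (A1) for every $i$ there is a tuple $(\lambda_{ij})_{j\in\mathcal V(i)}$ with all entries in $\mathbb R_+^*$ such that $L(i,(\lambda_{ij})_j)<+\infty$; (A2) each $L(i,\cdot)$ is lower semi-continuous; (A3) there is $\underline C\in\mathbb R$ with $L(i,\lambda)\ge\underline C$ for all $i$ and all $\lambda\in\mathbb R_+^{|\mathcal V(i)|}$; (A4) for every $i$, $L(i,\lambda)/\|\lambda\|_\infty\to+\infty$ as $\|\lambda\|_\infty\to+\infty$. The Hamiltonian functions are $H(i,p)=\sup_{\lambda\in\mathbb R_+^{|\mathcal V(i)|}}\big(\sum_{j\in\mathcal V(i)}\lambda_{j}p_j-L(i,\lambda)\big)$ for $p\in\mathbb R^{|\mathcal V(i)|}$; they are real-valued. A terminal payoff $g:\mathcal I\to\mathbb R$ is fixed. All processes are defined on a filtered probability space satisfying the usual conditions and are adapted. For $0\le t\le T$, $\mathcal A^T_t$ is the set of families $(\lambda_s(i,j))_{s\in[t,T],i\in\mathcal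 I,j\in\mathcal V(i)}$ of non-negative deterministic functions with $s\mapsto\lambda_s(i,j)\in L^1(t,T)$ for all $i,j$. For $\lambda\in\mathcal A^T_t$, $(X^{t,i,\lambda}_s)_{s\in[t,T]}$ is the continuous-time Markov chain on $\mathcal I$ starting from node $i$ at time $t$ whose instantaneous transition rate at time $s$ from $k$ to $j\in\mathcal V(k)$ is $\lambda_s(k,j)$. For $r\ge0$, $$u^{T,r}_i(t)=\sup_{\lambda\in\mathcal A^T_t}\mathbb E\left[-\int_t^Te^{-r(s-t)}L\Big(X^{t,i,\lambda}_s,\big(\lambda_s(X^{t,i,\lambda}_s,j)\big)_{j\in\mathcal V(X^{t,i,\lambda}_s)}\Big)ds+e^{-r(T-t)}g\big(X^{t,i,\lambda}_T\big)\right].$$ Optimal controls for horizon $T$ are those attaining the supremum at $t=0$. For $r>0$ and $i\in\mathcal I$, $u^r_i=\lim_{T\to+\infty}u^{T,r}_i(t)\in\mathbb R$; this limit exists and does not depend on $t\in\mathbb R_+$. The limit $\gamma=\lim_{r\to0}ru^r_i$ exists in $\mathbb R$ and does not depend on $i$. A sequence $r_n>0$, $r_n\to0$, is fixed such that $\xi_i=\lim_{n\to\infty}(u^{r_n}_i-u^{r_n}_1)$ exists for all $i\in\mathcal I$ (such a sequence exists); then $-\gamma+H(i,(\xi_j-\xi_i)_{j\in\mathcal V(i)})=0$ for all $i\in\mathcal I$. $(U_i)_{i\in\mathcal I}$ denotes the unique continuously differentiable solution on $[0,+\infty)$ of $-\frac{d}{dt}U_i(t)+H(i,(U_j(t)-U_i(t))_{j\in\mathcal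 V(i)})=0$ with $U_i(0)=g(i)$, $i\in\mathcal I$; equivalently $U_i(t)=u^{T,0}_i(T-t)$ for $0\le t\le T$. *)

theory Defs
  imports "HOL-Probability.Probability" "HOL-Library.Landau_Symbols"
begin

text \<open>
  The nodes of the graph are \<open>{1..N}\<close> and \<open>V i\<close> is the set of successors of \<open>i\<close>.
  A tuple indexed by \<open>J = V i\<close> is a function that is extensional on \<open>J\<close>, so that the product
  topology on \<open>nat \<Rightarrow> real\<close> induces the Euclidean topology on tuples.
\<close>

definition nonneg_tuples :: "nat set \<Rightarrow> (nat \<Rightarrow> real) set" where
  "nonneg_tuples J = J \<rightarrow>\<^sub>E {0..}"

text \<open>The inserted 0 only matters for \<open>J = {}\<close>, i.e. for the graph with a single node.\<close>

definition sup_norm :: "nat set \<Rightarrow> (nat \<Rightarrow> real) \<Rightarrow> real" where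
  "sup_norm J x = Max (insert 0 ((\<lambda>j. \<bar>x j\<bar>) ` J))"

definition strongly_connected_digraph :: "nat \<Rightarrow> (nat \<Rightarrow> nat set) \<Rightarrow> bool" where
  "strongly_connected_digraph N V \<longleftrightarrow>
     N \<ge> 1 \<and>
     (\<forall>i\<in>{1..N}. V i \<subseteq> {1..N} - {i}) \<and>
     (\<forall>i\<in>{1..N}. \<forall>j\<in>{1..N}. (i, j) \<in> {(k, l). k \<in> {1..N} \<and> l \<in> V k}\<^sup>*)"

definition lower_semicontinuous_on ::
    "'a::topological_space set \<Rightarrow> ('a \<Rightarrow> ereal) \<Rightarrow> bool" where
  "lower_semicontinuous_on S f \<longleftrightarrow> (\<forall>x\<in>S. f x \<le> Liminf (at x within S) f)"

definition admissible_cost ::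
    "nat \<Rightarrow> (nat \<Rightarrow> nat set) \<Rightarrow> (nat \<Rightarrow> (nat \<Rightarrow> real) \<Rightarrow> ereal) \<Rightarrow> bool" where
  "admissible_cost N V L \<longleftrightarrow>
     (\<forall>i\<in>{1..N}. \<exists>x \<in> V i \<rightarrow>\<^sub>E {0<..}. L i x < \<infinity>) \<and>
     (\<forall>i\<in>{1..N}. lower_semicontinuous_on (nonneg_tuples (V i)) (L i)) \<and>
     (\<exists>C::real. \<forall>i\<in>{1..N}. \<forall>x\<in>nonneg_tuples (V i). ereal C \<le> L i x) \<and>
     (\<forall>i\<in>{1..N}. ((\<lambda>x. L i x / ereal (sup_norm (V i) x)) \<longlongrightarrow> \<infinity>)
        (inf (filtercomap (sup_norm (V i)) at_top) (principal (nonneg_tuples (V i)))))"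

definition pre_Hamiltonian ::
    "(nat \<Rightarrow> nat set) \<Rightarrow> (nat \<Rightarrow> (nat \<Rightarrow> real) \<Rightarrow> ereal) \<Rightarrow> nat \<Rightarrow> (nat \<Rightarrow> real) \<Rightarrow>
     (nat \<Rightarrow> real) \<Rightarrow> ereal" where
  "pre_Hamiltonian V L i p x = ereal (\<Sum>j\<in>V i. x j * p j) - L i x"

text \<open>The supremum is finite under \<open>admissible_cost\<close>; only \<open>p j\<close> for \<open>j \<in> V i\<close> matters.\<close>

definition Hamiltonian ::
    "(nat \<Rightarrow> nat set) \<Rightarrow> (nat \<Rightarrow> (nat \<Rightarrow> real) \<Rightarrow> ereal) \<Rightarrow> nat \<Rightarrow> (nat \<Rightarrow> real) \<Rightarrow> real" where
  "Hamiltonian V L i p = real_of_ereal (SUP x\<in>nonneg_tuples (V i). pre_Hamiltonian V L i p x)"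

definition Hamiltonian_argmax ::
    "(nat \<Rightarrow> nat set) \<Rightarrow> (nat \<Rightarrow> (nat \<Rightarrow> real) \<Rightarrow> ereal) \<Rightarrow> nat \<Rightarrow> (nat \<Rightarrow> real) \<Rightarrow>
     (nat \<Rightarrow> real) set" where
  "Hamiltonian_argmax V L i p =
     {x. is_arg_max (pre_Hamiltonian V L i p) (\<lambda>x. x \<in> nonneg_tuples (V i)) x}"

text \<open>
  Controls are written \<open>\<lambda> s i j\<close>; their values outside \<open>{t..T}\<close> and for \<open>j \<notin> V i\<close> are irrelevant.
\<close>

definition controls ::
    "nat \<Rightarrow> (nat \<Rightarrow> nat set) \<Rightarrow> real \<Rightarrow> real \<Rightarrow> (real \<Rightarrow> nat \<Rightarrow> nat \<Rightarrow> real) set" where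
  "controls N V t T =
     {lam. \<forall>i\<in>{1..N}. \<forall>j\<in>V i.
        (\<forall>s\<in>{t..T}. 0 \<le> lam s i j) \<and> (\<lambda>s. lam s i j) absolutely_integrable_on {t..T}}"

definition usual_conditions :: "'a measure \<Rightarrow> (real \<Rightarrow> 'a measure) \<Rightarrow> bool" where
  "usual_conditions M F \<longleftrightarrow>
     (\<forall>s\<ge>0. subalgebra M (F s)) \<and>
     (\<forall>s\<ge>0. \<forall>s'\<ge>s. sets (F s) \<subseteq> sets (F s')) \<and>
     (\<forall>s\<ge>0. sets (F s) = (\<Inter>s'\<in>{s<..}. sets (F s'))) \<and>
     (\<forall>A\<in>null_sets M. \<forall>B\<subseteq>A. B \<in> sets (F 0))"

definition rate_matrix ::
    "(nat \<Rightarrow> nat set) \<Rightarrow> (nat \<Rightarrow> nat \<Rightarrow> real) \<Rightarrow> nat \<Rightarrow> nat \<Rightarrow> real" where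
  "rate_matrix V q k j =
     (if j = k then - (\<Sum>l\<in>V k. q k l) else if j \<in> V k then q k j else 0)"

text \<open>
  \<open>P s s' k j\<close> is the probability of being in \<open>j\<close> at time \<open>s'\<close> when in \<open>k\<close> at time \<open>s\<close>.
  Since the rates are merely integrable in time, the statement that \<open>lam s k j\<close> is the rate of
  transition at time \<open>s\<close> is Kolmogorov's forward equation in integrated form.
\<close>

definition transition_function ::
    "nat \<Rightarrow> (nat \<Rightarrow> nat set) \<Rightarrow> (real \<Rightarrow> nat \<Rightarrow> nat \<Rightarrow> real) \<Rightarrow> real \<Rightarrow> real \<Rightarrow>
     (real \<Rightarrow> real \<Rightarrow> nat \<Rightarrow> nat \<Rightarrow> real) \<Rightarrow> bool" where
  "transition_function N V lam t T P \<longleftrightarrow>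
     (\<forall>s s'. t \<le> s \<and> s \<le> s' \<and> s' \<le> T \<longrightarrow>
        (\<forall>k\<in>{1..N}. \<forall>j\<in>{1..N}.
           ((\<lambda>\<tau>. \<Sum>l\<in>{1..N}. P s \<tau> k l * rate_matrix V (lam \<tau>) l j)
              has_integral (P s s' k j - (if j = k then 1 else 0))) {s..s'}))"

definition markov_chain_with_rates ::
    "nat \<Rightarrow> (nat \<Rightarrow> nat set) \<Rightarrow> 'a measure \<Rightarrow> (real \<Rightarrow> 'a measure) \<Rightarrow>
     (real \<Rightarrow> nat \<Rightarrow> nat \<Rightarrow> real) \<Rightarrow> real \<Rightarrow> real \<Rightarrow> nat \<Rightarrow> (real \<Rightarrow> 'a \<Rightarrow> nat) \<Rightarrow> bool" where
  "markov_chain_with_rates N V M F lam t T i Y \<longleftrightarrow>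
     (\<forall>s\<in>{t..T}. Y s \<in> F s \<rightarrow>\<^sub>M count_space {1..N}) \<and>
     (\<forall>\<omega>\<in>space M.
        (\<forall>s\<in>{t..<T}. continuous (at_right s) (\<lambda>s. Y s \<omega>)) \<and>
        (\<forall>s\<in>{t<..T}. \<exists>l. ((\<lambda>s. Y s \<omega>) \<longlongrightarrow> l) (at_left s))) \<and>
     (AE \<omega> in M. Y t \<omega> = i) \<and>
     (\<exists>P. transition_function N V lam t T P \<and>
        (\<forall>s s'. t \<le> s \<and> s \<le> s' \<and> s' \<le> T \<longrightarrow>
           (\<forall>j\<in>{1..N}. AE \<omega> in M.
              real_cond_exp M (F s) (indicator {\<omega>\<in>space M. Y s' \<omega> = j}) \<omega> = P s s' (Y s \<omega>) j)))"

text \<open>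
  The integral of an extended real function as the difference of the integrals of its positive and
  negative parts. Below, one of the two parts always has a finite integral.
\<close>

definition ereal_integral :: "'a measure \<Rightarrow> ('a \<Rightarrow> ereal) \<Rightarrow> ereal" where
  "ereal_integral M f =
     enn2ereal (\<integral>\<^sup>+ x. e2ennreal (f x) \<partial>M) - enn2ereal (\<integral>\<^sup>+ x. e2ennreal (- f x) \<partial>M)"

text \<open>
  \<open>X T t i lam s \<omega>\<close> is the state at time \<open>s\<close> of the chain started from node \<open>i\<close> at time \<open>t\<close> and
  controlled by \<open>lam\<close> up to time \<open>T\<close>.
\<close>

definition expected_payoff ::
    "(nat \<Rightarrow> nat set) \<Rightarrow> (nat \<Rightarrow> (nat \<Rightarrow> real) \<Rightarrow> ereal) \<Rightarrow> (nat \<Rightarrow> real) \<Rightarrow> 'a measure \<Rightarrow>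
     (real \<Rightarrow> real \<Rightarrow> nat \<Rightarrow> (real \<Rightarrow> nat \<Rightarrow> nat \<Rightarrow> real) \<Rightarrow> real \<Rightarrow> 'a \<Rightarrow> nat) \<Rightarrow>
     real \<Rightarrow> real \<Rightarrow> nat \<Rightarrow> real \<Rightarrow> (real \<Rightarrow> nat \<Rightarrow> nat \<Rightarrow> real) \<Rightarrow> ereal" where
  "expected_payoff V L g M X T r i t lam =
     ereal_integral M (\<lambda>\<omega>.
       - ereal_integral (lebesgue_on {t..T})
           (\<lambda>s. ereal (exp (- r * (s - t))) *
                L (X T t i lam s \<omega>) (restrict (lam s (X T t i lam s \<omega>)) (V (X T t i lam s \<omega>))))
       + ereal (exp (- r * (T - t)) * g (X T t i lam T \<omega>)))"

definition value_function ::
    "nat \<Rightarrow> (nat \<Rightarrow> nat set) \<Rightarrow> (nat \<Rightarrow> (nat \<Rightarrow> real) \<Rightarrow> ereal) \<Rightarrow> (nat \<Rightarrow> real) \<Rightarrow> 'a measure \<Rightarrow>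
     (real \<Rightarrow> real \<Rightarrow> nat \<Rightarrow> (real \<Rightarrow> nat \<Rightarrow> nat \<Rightarrow> real) \<Rightarrow> real \<Rightarrow> 'a \<Rightarrow> nat) \<Rightarrow>
     real \<Rightarrow> real \<Rightarrow> nat \<Rightarrow> real \<Rightarrow> real" where
  "value_function N V L g M X T r i t =
     real_of_ereal (SUP lam\<in>controls N V t T. expected_payoff V L g M X T r i t lam)"

definition optimal_control ::
    "nat \<Rightarrow> (nat \<Rightarrow> nat set) \<Rightarrow> (nat \<Rightarrow> (nat \<Rightarrow> real) \<Rightarrow> ereal) \<Rightarrow> (nat \<Rightarrow> real) \<Rightarrow> 'a measure \<Rightarrow>
     (real \<Rightarrow> real \<Rightarrow> nat \<Rightarrow> (real \<Rightarrow> nat \<Rightarrow> nat \<Rightarrow> real) \<Rightarrow> real \<Rightarrow> 'a \<Rightarrow> nat) \<Rightarrow>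
     real \<Rightarrow> real \<Rightarrow> (real \<Rightarrow> nat \<Rightarrow> nat \<Rightarrow> real) \<Rightarrow> bool" where
  "optimal_control N V L g M X T r lam \<longleftrightarrow>
     (\<forall>i\<in>{1..N}. is_arg_max (expected_payoff V L g M X T r i 0) (\<lambda>l. l \<in> controls N V 0 T) lam)"

definition C1_HJ_solution ::
    "nat \<Rightarrow> (nat \<Rightarrow> nat set) \<Rightarrow> (nat \<Rightarrow> (nat \<Rightarrow> real) \<Rightarrow> ereal) \<Rightarrow> (nat \<Rightarrow> real) \<Rightarrow>
     (nat \<Rightarrow> real \<Rightarrow> real) \<Rightarrow> bool" where
  "C1_HJ_solution N V L g U \<longleftrightarrow>
     (\<forall>i\<in>{1..N}. U i 0 = g i \<and>
        (\<exists>U'. continuous_on {0..} U' \<and>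
           (\<forall>t\<ge>0. (U i has_real_derivative U' t) (at t within {0..}) \<and>
                   - U' t + Hamiltonian V L i (\<lambda>j. U j t - U i t) = 0)))"

end

theory Submission
  imports Defs
begin

text \<open>
  The chain enters the payoff only through its law at each time, which solves the integrated forward
  equation. Pairing this law with a \<open>C\<^sup>1\<close> solution of the Hamilton-Jacobi equation and comparing
  the running reward with the Hamiltonian bounds every payoff from above; freezing near-maximisers on
  a fine time grid shows that the bound is sharp. Hence the undiscounted value function is \<open>U\<close> with
  time reversed, and for a positive discount rate the limit values solve the stationary equation,
  whose limit along \<open>r n\<close> is the ergodic equation for \<open>\<gamma>\<close> and \<open>\<xi>\<close>.

  Put \<open>w i t = U i t - \<gamma> t - \<xi> i\<close>. By comparison the maximum of \<open>w\<close> over the nodes is nonincreasing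
  and the minimum is nondecreasing. A node below the maximum stays below it, up to an exponential factor, and
  by strict monotonicity of the Hamiltonians it drags down its predecessors; by strong connectivity a
  gap between maximum and minimum therefore lowers the maximum by a fixed amount in a fixed time, so
  the gap tends to 0. Optimal rates converge to maximisers since the argmax has closed graph.
\<close>

section \<open>Hamiltonians\<close>

text \<open>The cost may be infinite and need be neither continuous nor convex, so maximisers can
  jump with the momentum and payoffs can equal -infinity. Two devices deal with this. And a lower
  bound \<open>C\<close> is subtracted from the cost, so that integrals of nonnegative functions can
  be exchanged before anything is known to be finite. The Lipschitz bound is one-sided: momenta
  \<open>p \<le> q + D\<close> change the Hamiltonian by at most \<open>K * D\<close>. With
  \<open>D = 0\<close> this is monotonicity; with \<open>D\<close> the gap between a node and the
  upper bound it becomes a linear differential inequality for that gap. Discounted and undiscounted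
  problems share one verification estimate, whose error is the discounted mismatch at the terminal
  time: zero for \<open>U\<close>, vanishing with the horizon for the stationary solution.\<close>

locale controlled_graph =
  fixes N :: nat and V :: "nat \<Rightarrow> nat set" and L :: "nat \<Rightarrow> (nat \<Rightarrow> real) \<Rightarrow> ereal"
  assumes graph: "strongly_connected_digraph N V"
    and cost: "admissible_cost N V L"
begin

lemma V_subset: "i \<in> {1..N} \<Longrightarrow> V i \<subseteq> {1..N} - {i}"
  using graph by (auto simp: strongly_connected_digraph_def)

lemma N_pos: "1 \<le> N"
  using graph by (simp add: strongly_connected_digraph_def)

lemma finite_V: "i \<in> {1..N} \<Longrightarrow> finite (V i)"
  by (meson V_subset finite_Diff finite_atLeastAtMost finite_subset)

lemma card_V: "i \<in> {1..N} \<Longrightarrow> real (card (V i)) \<le> real N"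
  using card_mono[OF _ V_subset, of i] card_Diff_subset[of "{i}" "{1..N}"] by auto

section \<open>Growth of the cost and bounded near-maximisers\<close>

lemma cost_bounded_below:
  obtains C where "\<And>i x. i \<in> {1..N} \<Longrightarrow> x \<in> nonneg_tuples (V i) \<Longrightarrow> ereal C \<le> L i x"
  using cost unfolding admissible_cost_def by blast

lemma sup_norm_ge: "finite J \<Longrightarrow> j \<in> J \<Longrightarrow> \<bar>x j\<bar> \<le> sup_norm J x"
  unfolding sup_norm_def by (intro Max_ge) auto

lemma sup_norm_nonneg: "finite J \<Longrightarrow> 0 \<le> sup_norm J x"
  unfolding sup_norm_def by (intro Max_ge) auto

lemma cost_superlinear:
  assumes i: "i \<in> {1..N}"
  obtains B where "B > 0"
    "\<And>x. x \<in> nonneg_tuples (V i) \<Longrightarrow> sup_norm (V i) x \<ge> B \<Longrightarrow>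
       ereal (K * sup_norm (V i) x) \<le> L i x"
proof -
  have "((\<lambda>x. L i x / ereal (sup_norm (V i) x)) \<longlongrightarrow> \<infinity>)
        (inf (filtercomap (sup_norm (V i)) at_top) (principal (nonneg_tuples (V i))))"
    using cost i unfolding admissible_cost_def by blast
  then have "eventually (\<lambda>x. ereal K < L i x / ereal (sup_norm (V i) x))
        (inf (filtercomap (sup_norm (V i)) at_top) (principal (nonneg_tuples (V i))))"
    unfolding tendsto_PInfty by blast
  then obtain B0 where B0: "\<And>x. x \<in> nonneg_tuples (V i) \<Longrightarrow> sup_norm (V i) x \<ge> B0 \<Longrightarrow>
       ereal K < L i x / ereal (sup_norm (V i) x)"
    unfolding eventually_inf_principal eventually_filtercomap_at_top_linorder by blast
  show ?thesis
  \<comment> \<open>The 1 keeps the norm positive, so that the quotient by it can be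
    cleared.\<close>
  proof (rule that[of "max 1 B0"])
    fix x assume x: "x \<in> nonneg_tuples (V i)" "max 1 B0 \<le> sup_norm (V i) x"
    then have "ereal K < L i x / ereal (sup_norm (V i) x)" and pos: "sup_norm (V i) x > 0"
      using B0 by auto
    then show "ereal (K * sup_norm (V i) x) \<le> L i x"
      by (cases "L i x") (auto simp: field_simps)
  qed auto
qed

text \<open>Rates are nonnegative, so a one-sided bound on the momenta is enough; \<open>N\<close>
  bounds the number of successors. Changes of momentum are paid for with this estimate.\<close>

lemma tuple_sum_le:
  fixes x p q :: "nat \<Rightarrow> real" and B R :: real
  assumes i: "i \<in> {1..N}" and x: "x \<in> nonneg_tuples (V i)"
    and B: "\<And>j. j \<in> V i \<Longrightarrow> x j \<le> B" and B0: "B \<ge> 0"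
    and R: "\<And>j. j \<in> V i \<Longrightarrow> p j \<le> q j + R" and R0: "R \<ge> 0"
  shows "(\<Sum>j\<in>V i. x j * p j) \<le> (\<Sum>j\<in>V i. x j * q j) + N * B * R"
proof -
  have "(\<Sum>j\<in>V i. x j * p j) \<le> (\<Sum>j\<in>V i. x j * q j + B * R)"
  proof (rule sum_mono)
    fix j assume j: "j \<in> V i"
    have xj: "0 \<le> x j" using x j by (auto simp: nonneg_tuples_def)
    have "x j * p j \<le> x j * (q j + R)" using R[OF j] xj by (rule mult_left_mono)
    also have "\<dots> \<le> x j * q j + B * R"
      using mult_right_mono[OF B[OF j] R0] by (simp add: algebra_simps)
    finally show "x j * p j \<le> x j * q j + B * R" .
  qed
  also have "\<dots> = (\<Sum>j\<in>V i. x j * q j) + card (V i) * (B * R)" by (simp add: sum.distrib)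
  also have "\<dots> \<le> (\<Sum>j\<in>V i. x j * q j) + N * (B * R)"
    using mult_right_mono[OF card_V[OF i], of "B * R"] B0 R0 by simp
  finally show ?thesis by (simp add: mult.assoc)
qed

text \<open>By superlinear growth, tuples that are large compared with \<open>R\<close> and \<open>k\<close> are worse than
  a cheap fixed tuple, uniformly for momenta bounded by \<open>R\<close>.\<close>

lemma pre_Hamiltonian_far:
  assumes i: "i \<in> {1..N}"
  obtains B where "B > 0"
    "\<And>x p. x \<in> nonneg_tuples (V i) \<Longrightarrow> (\<And>j. j \<in> V i \<Longrightarrow> \<bar>p j\<bar> \<le> R) \<Longrightarrow>
       sup_norm (V i) x \<ge> B \<Longrightarrow> pre_Hamiltonian V L i p x \<le> ereal (- k)"
proof -
  \<comment> \<open>The part \<open>N * \<bar>R\<bar>\<close> of the slope absorbs the linear term;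
    the surplus 1 leaves minus the norm, which is below \<open>- k\<close> as soon as the norm
    exceeds \<open>k\<close>.\<close>
  obtain B where B: "B > 0" "\<And>x. x \<in> nonneg_tuples (V i) \<Longrightarrow> sup_norm (V i) x \<ge> B \<Longrightarrow>
       ereal ((N * \<bar>R\<bar> + 1) * sup_norm (V i) x) \<le> L i x"
    using cost_superlinear[OF i, of "N * \<bar>R\<bar> + 1"] by blast
  show ?thesis
  proof (rule that[of "max B k"])
    fix x p assume x: "x \<in> nonneg_tuples (V i)" and p: "\<And>j. j \<in> V i \<Longrightarrow> \<bar>p j\<bar> \<le> R"
      and big: "max B k \<le> sup_norm (V i) x"
    define n where "n = sup_norm (V i) x"
    have xn: "x j \<le> n" if "j \<in> V i" for j
      using sup_norm_ge[OF finite_V[OF i] that, of x] by (simp add: n_def)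
    have "(\<Sum>j\<in>V i. x j * p j) \<le> (\<Sum>j\<in>V i. x j * 0) + N * n * \<bar>R\<bar>"
    proof (rule tuple_sum_le[OF i x xn])
      fix j assume j: "j \<in> V i"
      show "p j \<le> 0 + \<bar>R\<bar>" using p[OF j] by linarith
    qed (simp_all add: n_def sup_norm_nonneg[OF finite_V[OF i]])
    moreover have "ereal ((N * \<bar>R\<bar> + 1) * n) \<le> L i x" using B(2)[OF x] big by (simp add: n_def)
    moreover have "n \<ge> k" using big by (simp add: n_def)
    ultimately show "pre_Hamiltonian V L i p x \<le> ereal (- k)"
      unfolding pre_Hamiltonian_def
      by (cases "L i x") (auto simp: algebra_simps)
  qed (use B in auto)
qed

lemma pre_Hamiltonian_bounded_above:
  assumes i: "i \<in> {1..N}"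
  shows "\<exists>b. \<forall>x\<in>nonneg_tuples (V i). pre_Hamiltonian V L i p x \<le> ereal b"
proof -
  define R where "R = (\<Sum>j\<in>V i. \<bar>p j\<bar>)"
  have R: "\<bar>p j\<bar> \<le> R" if "j \<in> V i" for j
    unfolding R_def using that finite_V[OF i] by (intro member_le_sum) auto
  obtain B where B: "B > 0" "\<And>x p. x \<in> nonneg_tuples (V i) \<Longrightarrow>
      (\<And>j. j \<in> V i \<Longrightarrow> \<bar>p j\<bar> \<le> R) \<Longrightarrow>
       sup_norm (V i) x \<ge> B \<Longrightarrow> pre_Hamiltonian V L i p x \<le> ereal (- 0)"
    using pre_Hamiltonian_far[OF i, of R 0] by blast
  obtain C where C: "\<And>i x. i \<in> {1..N} \<Longrightarrow> x \<in> nonneg_tuples (V i) \<Longrightarrow> ereal C \<le> L i x"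
    using cost_bounded_below by blast
  have R0: "R \<ge> 0" by (simp add: R_def sum_nonneg)
  show ?thesis
  proof (intro exI ballI)
    fix x assume x: "x \<in> nonneg_tuples (V i)"
    \<comment> \<open>The 0 serves the tuples of large norm, the other entry those of norm below
      \<open>B\<close>.\<close>
    show "pre_Hamiltonian V L i p x \<le> ereal (max 0 (N * B * R - C))"
    proof (cases "sup_norm (V i) x \<ge> B")
      case True
      then have "pre_Hamiltonian V L i p x \<le> ereal (- 0)" using x R by (intro B(2))
      also have "\<dots> \<le> ereal (max 0 (N * B * R - C))" by simp
      finally show ?thesis .
    next
      case False
      have "(\<Sum>j\<in>V i. x j * p j) \<le> (\<Sum>j\<in>V i. x j * 0) + N * B * R"
      proof (rule tuple_sum_le[OF i x])
        fix j assume j: "j \<in> V i"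
        show "x j \<le> B" using sup_norm_ge[OF finite_V[OF i] j, of x] False by simp
        show "p j \<le> 0 + R" using R[OF j] by simp
      qed (use B R0 in auto)
      then show ?thesis using C[OF i x] unfolding pre_Hamiltonian_def
        by (cases "L i x") (auto simp del: ereal_max)
    qed
  qed
qed

text \<open>Both infinite values are excluded: superlinear growth bounds the supremum from above,
  and a tuple of finite cost keeps it off -infinity. Hence \<open>real_of_ereal\<close> in the
  definition of \<open>Hamiltonian\<close> loses nothing.\<close>

lemma ereal_Hamiltonian:
  assumes i: "i \<in> {1..N}"
  shows "ereal (Hamiltonian V L i p) = (SUP x\<in>nonneg_tuples (V i). pre_Hamiltonian V L i p x)"
    (is "_ = ?S")
proof -
  obtain b where "?S \<le> ereal b"
    using pre_Hamiltonian_bounded_above[OF i, of p] by (auto intro!: SUP_least)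
  moreover have "?S > -\<infinity>"
  proof -
    obtain x where x: "x \<in> V i \<rightarrow>\<^sub>E {0<..}" "L i x < \<infinity>"
      using cost i unfolding admissible_cost_def by blast
    then have xx: "x \<in> nonneg_tuples (V i)" by (force simp: nonneg_tuples_def PiE_iff)
    have "pre_Hamiltonian V L i p x > -\<infinity>"
      using x(2) unfolding pre_Hamiltonian_def by (cases "L i x") auto
    then show ?thesis using SUP_upper[OF xx, of "pre_Hamiltonian V L i p"]
      by (metis less_le_trans)
  qed
  ultimately show ?thesis unfolding Hamiltonian_def by (cases ?S) auto
qed

lemma pre_Hamiltonian_le:
  "i \<in> {1..N} \<Longrightarrow> x \<in> nonneg_tuples (V i) \<Longrightarrow> pre_Hamiltonian V L i p x \<le> ereal (Hamiltonian V L i p)"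
  by (simp add: ereal_Hamiltonian SUP_upper)

text \<open>A fixed tuple of finite cost bounds the Hamiltonian from below on the whole box of
  momenta, while tuples of norm at least \<open>B\<close> fall short of that bound by more than 1. A
  near-maximiser therefore has norm below \<open>B\<close>, a threshold free of \<open>p\<close> and
  \<open>\<epsilon>\<close>.\<close>

lemma near_maximiser_at_node:
  assumes i: "i \<in> {1..N}"
  obtains B where "B > 0" "\<And>p \<epsilon>. 0 < \<epsilon> \<Longrightarrow> \<epsilon> \<le> 1 \<Longrightarrow> (\<And>j. j \<in> V i \<Longrightarrow> \<bar>p j\<bar> \<le> R) \<Longrightarrow>
    \<exists>x\<in>nonneg_tuples (V i). (\<forall>j\<in>V i. x j \<le> B) \<and>
      ereal (Hamiltonian V L i p - \<epsilon>) \<le> pre_Hamiltonian V L i p x"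
proof -
  obtain x0 where x0: "x0 \<in> V i \<rightarrow>\<^sub>E {0<..}" "L i x0 < \<infinity>"
    using cost i unfolding admissible_cost_def by blast
  then have xx: "x0 \<in> nonneg_tuples (V i)" by (force simp: nonneg_tuples_def PiE_iff)
  obtain C where C: "\<And>i x. i \<in> {1..N} \<Longrightarrow> x \<in> nonneg_tuples (V i) \<Longrightarrow> ereal C \<le> L i x"
    using cost_bounded_below by blast
  obtain l where l: "L i x0 = ereal l" using x0(2) C[OF i xx] by (cases "L i x0") auto
  \<comment> \<open>Testing with \<open>x0\<close> bounds the Hamiltonian below by
    \<open>- k + 2\<close>; the 2 leaves room for an error
    \<open>\<epsilon> \<le> 1\<close>.\<close>
  define k where "k = l + N * (sup_norm (V i) x0) * \<bar>R\<bar> + 2"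
  obtain B where B: "B > 0" "\<And>x p. x \<in> nonneg_tuples (V i) \<Longrightarrow>
      (\<And>j. j \<in> V i \<Longrightarrow> \<bar>p j\<bar> \<le> R) \<Longrightarrow>
       sup_norm (V i) x \<ge> B \<Longrightarrow> pre_Hamiltonian V L i p x \<le> ereal (- k)"
    using pre_Hamiltonian_far[OF i, of R k] by blast
  show ?thesis
  proof (rule that[OF B(1)])
    fix p :: "nat \<Rightarrow> real" and \<epsilon> :: real
    assume e: "0 < \<epsilon>" "\<epsilon> \<le> 1" and p: "\<And>j. j \<in> V i \<Longrightarrow> \<bar>p j\<bar> \<le> R"
    have "ereal (Hamiltonian V L i p - \<epsilon>) < (SUP x\<in>nonneg_tuples (V i). pre_Hamiltonian V L i p x)"
      using e by (simp flip: ereal_Hamiltonian[OF i])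
    then obtain x where x: "x \<in> nonneg_tuples (V i)"
        "ereal (Hamiltonian V L i p - \<epsilon>) < pre_Hamiltonian V L i p x"
      by (auto simp: less_SUP_iff)
    have "(\<Sum>j\<in>V i. x0 j * 0) \<le> (\<Sum>j\<in>V i. x0 j * p j) + N * sup_norm (V i) x0 * \<bar>R\<bar>"
    proof (rule tuple_sum_le[OF i xx])
      fix j assume j: "j \<in> V i"
      show "x0 j \<le> sup_norm (V i) x0" using sup_norm_ge[OF finite_V[OF i] j, of x0] by simp
      show "0 \<le> p j + \<bar>R\<bar>" using p[OF j] by linarith
    qed (simp_all add: sup_norm_nonneg[OF finite_V[OF i]])
    then have "- k + 2 \<le> Hamiltonian V L i p"
      using pre_Hamiltonian_le[OF i xx, of p] by (simp add: pre_Hamiltonian_def l k_def)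
    then have "\<not> pre_Hamiltonian V L i p x \<le> ereal (- k)"
      using x(2) e by (cases "pre_Hamiltonian V L i p x") auto
    then have "sup_norm (V i) x < B" using B(2)[OF x(1) p] by force
    then have "\<forall>j\<in>V i. x j \<le> B" using sup_norm_ge[OF finite_V[OF i], of _ x] by force
    then show "\<exists>x\<in>nonneg_tuples (V i). (\<forall>j\<in>V i. x j \<le> B) \<and>
      ereal (Hamiltonian V L i p - \<epsilon>) \<le> pre_Hamiltonian V L i p x"
      using x by (intro bexI[of _ x]) auto
  qed
qed

lemma near_maximiser:
  obtains B where "B > 0" "\<And>i p \<epsilon>. i \<in> {1..N} \<Longrightarrow> 0 < \<epsilon> \<Longrightarrow> \<epsilon> \<le> 1 \<Longrightarrow>
    (\<And>j. j \<in> V i \<Longrightarrow> \<bar>p j\<bar> \<le> R) \<Longrightarrow>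
    \<exists>x\<in>nonneg_tuples (V i). (\<forall>j\<in>V i. x j \<le> B) \<and>
      ereal (Hamiltonian V L i p - \<epsilon>) \<le> pre_Hamiltonian V L i p x"
proof -
  have "\<forall>i\<in>{1..N}. \<exists>B>0. \<forall>p \<epsilon>. 0 < \<epsilon> \<longrightarrow> \<epsilon> \<le> 1 \<longrightarrow> (\<forall>j\<in>V i. \<bar>p j\<bar> \<le> R) \<longrightarrow>
    (\<exists>x\<in>nonneg_tuples (V i). (\<forall>j\<in>V i. x j \<le> B) \<and>
      ereal (Hamiltonian V L i p - \<epsilon>) \<le> pre_Hamiltonian V L i p x)"
  proof
    fix i assume "i \<in> {1..N}"
    from near_maximiser_at_node[OF this, of R] obtain B where "B > 0" "\<And>p \<epsilon>. 0 < \<epsilon> \<Longrightarrow> \<epsilon> \<le> 1 \<Longrightarrow>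
      (\<And>j. j \<in> V i \<Longrightarrow> \<bar>p j\<bar> \<le> R) \<Longrightarrow> \<exists>x\<in>nonneg_tuples (V i). (\<forall>j\<in>V i. x j \<le> B) \<and>
      ereal (Hamiltonian V L i p - \<epsilon>) \<le> pre_Hamiltonian V L i p x" by blast
    then show "\<exists>B>0. \<forall>p \<epsilon>. 0 < \<epsilon> \<longrightarrow> \<epsilon> \<le> 1 \<longrightarrow> (\<forall>j\<in>V i. \<bar>p j\<bar> \<le> R) \<longrightarrow>
      (\<exists>x\<in>nonneg_tuples (V i). (\<forall>j\<in>V i. x j \<le> B) \<and>
      ereal (Hamiltonian V L i p - \<epsilon>) \<le> pre_Hamiltonian V L i p x)" by blast
  qed
  then obtain b where b: "\<And>i. i \<in> {1..N} \<Longrightarrow> b i > 0 \<and> (\<forall>p \<epsilon>. 0 < \<epsilon> \<longrightarrow> \<epsilon> \<le> 1 \<longrightarrow> (\<forall>j\<in>V i. \<bar>p j\<bar> \<le> R) \<longrightarrow>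
    (\<exists>x\<in>nonneg_tuples (V i). (\<forall>j\<in>V i. x j \<le> b i) \<and>
      ereal (Hamiltonian V L i p - \<epsilon>) \<le> pre_Hamiltonian V L i p x))" by metis
  have le: "b i \<le> (\<Sum>k\<in>{1..N}. b k)" if "i \<in> {1..N}" for i
    using that b by (intro member_le_sum) (auto intro: less_imp_le)
  show ?thesis
  proof (rule that[of "\<Sum>k\<in>{1..N}. b k"])
    show "(\<Sum>k\<in>{1..N}. b k) > 0" using b N_pos by (intro sum_pos) auto
    fix i p \<epsilon> assume i: "i \<in> {1..N}" and "0 < (\<epsilon>::real)" "\<epsilon> \<le> 1" "\<And>j. j \<in> V i \<Longrightarrow> \<bar>p j\<bar> \<le> R"
    then obtain x where "x\<in>nonneg_tuples (V i)" "(\<forall>j\<in>V i. x j \<le> b i)"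
      "ereal (Hamiltonian V L i p - \<epsilon>) \<le> pre_Hamiltonian V L i p x" using b[OF i] by metis
    then show "\<exists>x\<in>nonneg_tuples (V i). (\<forall>j\<in>V i. x j \<le> sum b {1..N}) \<and>
      ereal (Hamiltonian V L i p - \<epsilon>) \<le> pre_Hamiltonian V L i p x"
      using le[OF i] by (intro bexI[of _ x]) force+
  qed
qed

text \<open>A near-maximiser for \<open>p\<close> is tested at \<open>q\<close>. Its entries are at
  most \<open>B\<close>, so the linear term moves by at most \<open>N * B * D\<close>, which gives
  \<open>K = N * B\<close>. Only \<open>p\<close> is confined to the box.\<close>

lemma Hamiltonian_Lipschitz:
  obtains K where "K > 0" "\<And>i p q D. i \<in> {1..N} \<Longrightarrow> (\<And>j. j \<in> V i \<Longrightarrow> \<bar>p j\<bar> \<le> R) \<Longrightarrow>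
     (\<And>j. j \<in> V i \<Longrightarrow> p j \<le> q j + D) \<Longrightarrow> D \<ge> 0 \<Longrightarrow>
     Hamiltonian V L i p \<le> Hamiltonian V L i q + K * D"
proof -
  obtain B where B: "B > 0" "\<And>i p \<epsilon>. i \<in> {1..N} \<Longrightarrow> 0 < \<epsilon> \<Longrightarrow> \<epsilon> \<le> 1 \<Longrightarrow>
    (\<And>j. j \<in> V i \<Longrightarrow> \<bar>p j\<bar> \<le> R) \<Longrightarrow>
    \<exists>x\<in>nonneg_tuples (V i). (\<forall>j\<in>V i. x j \<le> B) \<and>
      ereal (Hamiltonian V L i p - \<epsilon>) \<le> pre_Hamiltonian V L i p x"
    using near_maximiser[of R] by blast
  show ?thesis
  proof (rule that[of "N * B"])
    show "N * B > 0" using B N_pos by simp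
    fix i p q D assume i: "i \<in> {1..N}" and p: "\<And>j. j \<in> V i \<Longrightarrow> \<bar>p j\<bar> \<le> R"
      and pq: "\<And>j. j \<in> V i \<Longrightarrow> p j \<le> q j + D" and D: "D \<ge> (0::real)"
    show "Hamiltonian V L i p \<le> Hamiltonian V L i q + N * B * D"
    proof (rule field_le_epsilon)
      fix e :: real assume "e > 0"
      then obtain x where x: "x\<in>nonneg_tuples (V i)" "\<And>j. j\<in>V i \<Longrightarrow> x j \<le> B"
         and near: "ereal (Hamiltonian V L i p - min e 1) \<le> pre_Hamiltonian V L i p x"
        using B(2)[of i "min e 1" p] i p by auto
      have "(\<Sum>j\<in>V i. x j * p j) \<le> (\<Sum>j\<in>V i. x j * q j) + N * B * D"
        using B pq D by (intro tuple_sum_le[OF i x]) auto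
      then show "Hamiltonian V L i p \<le> Hamiltonian V L i q + N * B * D + e"
        using near pre_Hamiltonian_le[OF i x(1), of q] unfolding pre_Hamiltonian_def
        by (cases "L i x") auto
    qed
  qed
qed

text \<open>The case \<open>D = 0\<close> of the Lipschitz bound; since that bound leaves
  \<open>q\<close> unrestricted, a suitable \<open>R\<close> can be read off from
  \<open>p\<close>.\<close>

lemma Hamiltonian_mono:
  assumes i: "i \<in> {1..N}" and pq: "\<And>j. j \<in> V i \<Longrightarrow> p j \<le> q j"
  shows "Hamiltonian V L i p \<le> Hamiltonian V L i q"
proof -
  define R where "R = (\<Sum>j\<in>V i. \<bar>p j\<bar>)"
  have R: "\<bar>p j\<bar> \<le> R" if "j \<in> V i" for j
    unfolding R_def using that finite_V[OF i] by (intro member_le_sum) auto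
  obtain K where "K > 0" and K: "\<And>i p q D. i \<in> {1..N} \<Longrightarrow> (\<And>j. j \<in> V i \<Longrightarrow> \<bar>p j\<bar> \<le> R) \<Longrightarrow>
     (\<And>j. j \<in> V i \<Longrightarrow> p j \<le> q j + D) \<Longrightarrow> D \<ge> 0 \<Longrightarrow>
     Hamiltonian V L i p \<le> Hamiltonian V L i q + K * D"
    using Hamiltonian_Lipschitz[of R] by blast
  have "Hamiltonian V L i p \<le> Hamiltonian V L i q + K * 0"
    by (rule K) (use R i pq in auto)
  then show ?thesis by simp
qed

lemma tendsto_Hamiltonian:
  assumes i: "i \<in> {1..N}" and lim: "\<And>j. j \<in> V i \<Longrightarrow> ((\<lambda>n. p n j) \<longlongrightarrow> q j) G"
  shows "((\<lambda>n. Hamiltonian V L i (p n)) \<longlongrightarrow> Hamiltonian V L i q) G"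
proof -
  \<comment> \<open>The extra 1 makes room for \<open>p n\<close> once it is within distance 1 of
    \<open>q\<close>: the Lipschitz bound is applied with either momentum in first place.\<close>
  define R where "R = (\<Sum>j\<in>V i. \<bar>q j\<bar>) + 1"
  have qR: "\<bar>q j\<bar> + 1 \<le> R" if "j \<in> V i" for j
    using that finite_V[OF i] member_le_sum[of j "V i" "\<lambda>j. \<bar>q j\<bar>"] by (simp add: R_def)
  obtain K where K: "K > 0" "\<And>i p q D. i \<in> {1..N} \<Longrightarrow> (\<And>j. j \<in> V i \<Longrightarrow> \<bar>p j\<bar> \<le> R) \<Longrightarrow>
     (\<And>j. j \<in> V i \<Longrightarrow> p j \<le> q j + D) \<Longrightarrow> D \<ge> 0 \<Longrightarrow>
     Hamiltonian V L i p \<le> Hamiltonian V L i q + K * D"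
    using Hamiltonian_Lipschitz[of R] by blast
  show ?thesis
  proof (rule tendstoI)
    fix e :: real assume e: "e > 0"
    define d where "d = min 1 (e / (2 * K))"
    have d: "d > 0" "d \<le> 1" using e K by (auto simp: d_def)
    have Kd: "K * d < e"
    proof -
      have "K * d \<le> K * (e / (2 * K))" unfolding d_def using K by (intro mult_left_mono) auto
      then show ?thesis using K e by simp
    qed
    have "\<forall>\<^sub>F n in G. \<forall>j\<in>V i. dist (p n j) (q j) < d"
      using finite_V[OF i] lim d by (auto simp: eventually_ball_finite_distrib tendsto_iff)
    then show "\<forall>\<^sub>F n in G. dist (Hamiltonian V L i (p n)) (Hamiltonian V L i q) < e"
    proof eventually_elim
      case (elim n)
      then have c: "\<bar>p n j - q j\<bar> < d" if "j \<in> V i" for j using that by (auto simp: dist_real_def)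
      have "Hamiltonian V L i (p n) \<le> Hamiltonian V L i q + K * d"
        using c qR d by (intro K(2)[OF i]) (fastforce simp: abs_if split: if_splits)+
      moreover have "Hamiltonian V L i q \<le> Hamiltonian V L i (p n) + K * d"
        using c qR d by (intro K(2)[OF i]) (fastforce simp: abs_if split: if_splits)+
      ultimately show ?case using Kd by (auto simp: dist_real_def abs_if)
    qed
  qed
qed

end

section \<open>Stationary equation and long time behaviour\<close>

text \<open>If some component exceeded \<open>A\<close>, a line rising with small slope from just
  above \<open>A\<close> would be reached at a first time. A component attaining the maximum there
  has nonpositive derivative, so relative to the line it is decreasing and was above the line
  slightly earlier, against minimality.\<close>

lemma max_comparison:
  fixes f D :: "'i \<Rightarrow> real \<Rightarrow> real"
  assumes I: "finite I"
    and cont: "\<And>i. i \<in> I \<Longrightarrow> continuous_on {s..} (f i)"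
    and der: "\<And>i t. i \<in> I \<Longrightarrow> t > s \<Longrightarrow> (f i has_real_derivative D i t) (at t)"
    and max: "\<And>i t. i \<in> I \<Longrightarrow> t > s \<Longrightarrow> (\<And>j. j \<in> I \<Longrightarrow> f j t \<le> f i t) \<Longrightarrow> D i t \<le> 0"
    and init: "\<And>i. i \<in> I \<Longrightarrow> f i s \<le> A"
    and i: "i \<in> I" and t: "s \<le> t"
  shows "f i t \<le> A"
proof (rule ccontr)
  assume "\<not> f i t \<le> A"
  \<comment> \<open>The slope for which the line \<open>A + \<epsilon> * (1 + \<tau> - s)\<close>
    meets \<open>f i\<close> at time \<open>t\<close>; the 1 puts the line strictly above the
    initial values.\<close>
  define \<epsilon> where "\<epsilon> = (f i t - A) / (1 + t - s)"
  have eps: "\<epsilon> > 0" "f i t = A + \<epsilon> * (1 + t - s)"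
    using \<open>\<not> f i t \<le> A\<close> t by (auto simp: \<epsilon>_def field_simps)
  define S where "S = (\<Union>k\<in>I. {\<tau>\<in>{s..t}. A + \<epsilon> * (1 + \<tau> - s) \<le> f k \<tau>})"
  have "compact S" unfolding S_def
  proof (intro compact_UN I)
    fix k assume k: "k \<in> I"
    have "continuous_on {s..t} (f k)" using continuous_on_subset[OF cont[OF k]] by force
    then have "closed {\<tau>\<in>{s..t}. A + \<epsilon> * (1 + \<tau> - s) \<le> f k \<tau>}"
      by (intro continuous_on_closed_Collect_le continuous_intros) auto
    then show "compact {\<tau>\<in>{s..t}. A + \<epsilon> * (1 + \<tau> - s) \<le> f k \<tau>}"
      using compact_Int_closed[of "{s..t}" "{\<tau>\<in>{s..t}. A + \<epsilon> * (1 + \<tau> - s) \<le> f k \<tau>}"]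
      by (simp add: Int_def cong: conj_cong)
  qed
  moreover have "t \<in> S" using i t eps(1) unfolding S_def eps(2)[symmetric]
    by (auto intro!: bexI[of _ i] simp flip: eps(2))
  ultimately obtain \<tau> where \<tau>: "\<tau> \<in> S" "\<And>\<tau>'. \<tau>' \<in> S \<Longrightarrow> \<tau> \<le> \<tau>'"
    using compact_attains_inf[of S] by blast
  then obtain k0 where k0: "k0 \<in> I" "A + \<epsilon> * (1 + \<tau> - s) \<le> f k0 \<tau>" and \<tau>': "s \<le> \<tau>" "\<tau> \<le> t"
    by (auto simp: S_def)
  \<comment> \<open>\<open>k0\<close> reaches the line, but the sign of the derivative is known only
    for a component attaining the maximum.\<close>
  obtain k where "k \<in> I" "f k \<tau> = Max ((\<lambda>k. f k \<tau>) ` I)"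
    using Max_in[of "(\<lambda>k. f k \<tau>) ` I"] I k0(1) by fastforce
  then have k: "k \<in> I" "\<And>j. j \<in> I \<Longrightarrow> f j \<tau> \<le> f k \<tau>"
    using I by simp_all
  have line: "A + \<epsilon> * (1 + \<tau> - s) \<le> f k \<tau>" using k0 k(2) by force
  have "s \<noteq> \<tau>" using line init[OF k(1)] eps by auto
  then have s\<tau>: "s < \<tau>" using \<tau>' by simp
  have "((\<lambda>t. f k t - \<epsilon> * t) has_real_derivative D k \<tau> - \<epsilon>) (at \<tau>)"
    using der[OF k(1) s\<tau>] by (auto intro!: derivative_eq_intros)
  moreover have "D k \<tau> - \<epsilon> < 0" using max[OF k(1) s\<tau> k(2)] eps by simp
  ultimately obtain d where d: "d > 0" "\<And>h. h > 0 \<Longrightarrow> h < d \<Longrightarrow> f k \<tau> - \<epsilon> * \<tau> < f k (\<tau> - h) - \<epsilon> * (\<tau> - h)"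
    using DERIV_neg_dec_left by blast
  define h where "h = min (d / 2) (\<tau> - s)"
  have h: "h > 0" "h < d" "s \<le> \<tau> - h" using d s\<tau> by (auto simp: h_def)
  have "A + \<epsilon> * (1 + (\<tau> - h) - s) \<le> f k (\<tau> - h)"
    using d(2)[OF h(1,2)] line by (simp add: algebra_simps)
  then have "\<tau> - h \<in> S" using k h \<tau>' by (auto simp: S_def)
  then show False using \<tau>(2) h by force
qed

text \<open>Integrating factor: the inequality makes \<open>(f t - \<eta> / K) * exp (K * t)\<close>
  nondecreasing, where \<open>\<eta> / K\<close> is the equilibrium of the equation obtained with
  equality.\<close>

lemma exp_weighted_mono:
  fixes f f' :: "real \<Rightarrow> real"
  assumes cont: "continuous_on {a..b} f" and K: "K > 0" and ab: "a \<le> b"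
    and der: "\<And>t. a < t \<Longrightarrow> t < b \<Longrightarrow> (f has_real_derivative f' t) (at t)"
    and ge: "\<And>t. a < t \<Longrightarrow> t < b \<Longrightarrow> \<eta> - K * f t \<le> f' t"
  shows "\<eta> / K + (f a - \<eta> / K) * exp (- K * (b - a)) \<le> f b"
proof -
  have "(f a - \<eta> / K) * exp (K * a) \<le> (f b - \<eta> / K) * exp (K * b)"
  proof (rule DERIV_nonneg_imp_increasing_open[OF ab])
    fix t assume t: "a < t" "t < b"
    have "((\<lambda>t. (f t - \<eta> / K) * exp (K * t)) has_real_derivative
        (f' t - (\<eta> - K * f t)) * exp (K * t)) (at t)"
      using der[OF t] K by (auto intro!: derivative_eq_intros simp: field_simps)
    then show "\<exists>y. ((\<lambda>t. (f t - \<eta> / K) * exp (K * t)) has_real_derivative y) (at t) \<and> 0 \<le> y"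
      using ge[OF t] by (intro exI conjI) auto
  qed (intro continuous_intros cont)
  from mult_right_mono[OF this, of "exp (- K * b)"]
  have "(f a - \<eta> / K) * (exp (K * a) * exp (- K * b)) \<le> (f b - \<eta> / K) * (exp (K * b) * exp (- K * b))"
    by (simp add: mult.assoc)
  then show ?thesis by (simp add: algebra_simps flip: exp_add)
qed

context controlled_graph
begin

section \<open>The stationary equation with discount\<close>

lemma finite_bound:
  fixes f :: "nat \<Rightarrow> real"
  obtains W where "\<And>i. i \<in> {1..N} \<Longrightarrow> \<bar>f i\<bar> \<le> W" "W \<ge> 0"
proof (rule that[of "\<Sum>i\<in>{1..N}. \<bar>f i\<bar>"])
  show "\<bar>f i\<bar> \<le> (\<Sum>i\<in>{1..N}. \<bar>f i\<bar>)" if "i \<in> {1..N}" for i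
    using that by (intro member_le_sum) auto
qed (simp add: sum_nonneg)

text \<open>Monotone iteration: for \<open>K\<close> a Lipschitz constant of the Hamiltonians on the relevant box,
  the map \<open>v \<mapsto> (K v + H (i, v - v i)) / (\<rho> + K)\<close> is order preserving there.\<close>

lemma discounted_stationary_solution:
  assumes \<rho>: "\<rho> > 0"
  obtains v where "\<And>i. i \<in> {1..N} \<Longrightarrow> \<rho> * v i = Hamiltonian V L i (\<lambda>j. v j - v i)"
proof -
  obtain W where W: "\<And>i. i \<in> {1..N} \<Longrightarrow> \<bar>Hamiltonian V L i (\<lambda>j. 0)\<bar> \<le> W" "W \<ge> 0"
    using finite_bound[of "\<lambda>i. Hamiltonian V L i (\<lambda>j. 0)"] by blast
  \<comment> \<open>On constant vectors all momenta vanish, so \<open>\<rho> * R = W\<close> makes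
    the constant \<open>R\<close> a supersolution and \<open>- R\<close> a subsolution; between them
    differences are at most \<open>2 * R\<close>.\<close>
  define R where "R = W / \<rho>"
  obtain K where K: "K > 0" "\<And>i p q D. i \<in> {1..N} \<Longrightarrow> (\<And>j. j \<in> V i \<Longrightarrow> \<bar>p j\<bar> \<le> 2 * R) \<Longrightarrow>
     (\<And>j. j \<in> V i \<Longrightarrow> p j \<le> q j + D) \<Longrightarrow> D \<ge> 0 \<Longrightarrow>
     Hamiltonian V L i p \<le> Hamiltonian V L i q + K * D"
    using Hamiltonian_Lipschitz[of "2 * R"] by blast
  define G where "G v i = (K * v i + Hamiltonian V L i (\<lambda>j. v j - v i)) / (\<rho> + K)" for v i
  have Gmono: "G u i \<le> G v i" if i: "i \<in> {1..N}"
    and u: "\<And>j. j \<in> {1..N} \<Longrightarrow> \<bar>u j\<bar> \<le> R" and uv: "\<And>j. j \<in> {1..N} \<Longrightarrow> u j \<le> v j" for u v i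
  proof -
    have Vi: "j \<in> {1..N}" if "j \<in> V i" for j using V_subset[OF i] that by auto
    have "Hamiltonian V L i (\<lambda>j. u j - u i) \<le> Hamiltonian V L i (\<lambda>j. v j - v i) + K * (v i - u i)"
    proof (rule K(2)[OF i])
      fix j assume "j \<in> V i"
      then show "\<bar>u j - u i\<bar> \<le> 2 * R" "u j - u i \<le> v j - v i + (v i - u i)"
        using u[OF Vi, of j] u[OF i] uv[OF Vi, of j] by linarith+
    qed (use uv[OF i] in simp)
    then show ?thesis using K \<rho> unfolding G_def by (intro divide_right_mono) (auto simp: algebra_simps)
  qed
  have Rrho: "\<rho> * R = W" using \<rho> by (simp add: R_def)
  have R0: "R \<ge> 0" using W \<rho> by (simp add: R_def)
  have GR: "G (\<lambda>_. R) i \<le> R" "- R \<le> G (\<lambda>_. - R) i" if i: "i \<in> {1..N}" for i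
    using W(1)[OF i] Rrho K \<rho> unfolding G_def by (simp_all add: field_simps abs_le_iff)
  define x where "x n = (G ^^ n) (\<lambda>_. R)" for n
  have x: "x 0 = (\<lambda>_. R)" "\<And>n. x (Suc n) = G (x n)" by (simp_all add: x_def)
  \<comment> \<open>Starting from the supersolution makes the iterates decrease. The box is carried
    along in the induction because \<open>Gmono\<close> needs its smaller argument inside
    it.\<close>
  have bd: "\<forall>i\<in>{1..N}. - R \<le> x (Suc n) i \<and> x (Suc n) i \<le> x n i \<and> x n i \<le> R" for n
  proof (induction n)
    case 0
    have "- R \<le> G (\<lambda>_. R) i" if i: "i \<in> {1..N}" for i
      using GR(2)[OF i] Gmono[OF i, of "\<lambda>_. - R" "\<lambda>_. R"] R0 by simp
    then show ?case using GR x by auto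
  next
    case (Suc n)
    have "- R \<le> x (Suc (Suc n)) i" if i: "i \<in> {1..N}" for i
      using GR(2)[OF i] Gmono[OF i, of "\<lambda>_. - R" "x (Suc n)"] R0 x(2)[of "Suc n"] Suc by auto
    moreover have "x (Suc (Suc n)) i \<le> x (Suc n) i" if i: "i \<in> {1..N}" for i
      unfolding x(2)[of "Suc n"] by (subst x(2)[of n], rule Gmono[OF i]) (use Suc in \<open>fastforce simp: abs_le_iff\<close>)+
    ultimately show ?case using Suc by (meson order_trans)
  qed
  have "\<exists>l. (\<lambda>n. x n i) \<longlonglongrightarrow> l" if i: "i \<in> {1..N}" for i
  proof -
    have "decseq (\<lambda>n. x n i)" using bd i by (intro decseq_SucI) blast
    then obtain l where "(\<lambda>n. x n i) \<longlonglongrightarrow> l"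
      using decseq_convergent[of "\<lambda>n. x n i" "- R"] bd i by (meson order_trans)
    then show ?thesis ..
  qed
  then obtain v where v: "\<And>i. i \<in> {1..N} \<Longrightarrow> (\<lambda>n. x n i) \<longlonglongrightarrow> v i" by metis
  show ?thesis
  proof (rule that)
    fix i assume i: "i \<in> {1..N}"
    have "(\<lambda>n. G (x n) i) \<longlonglongrightarrow> G v i"
      unfolding G_def using v i V_subset[OF i] K \<rho>
      by (intro tendsto_divide tendsto_add tendsto_mult tendsto_const tendsto_Hamiltonian tendsto_diff) auto
    moreover have "(\<lambda>n. G (x n) i) \<longlonglongrightarrow> v i"
      using LIMSEQ_Suc[OF v[OF i]] x by simp
    ultimately have "v i = G v i" using LIMSEQ_unique by blast
    then show "\<rho> * v i = Hamiltonian V L i (\<lambda>j. v j - v i)"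
      using K \<rho> unfolding G_def by (simp add: field_simps)
  qed
qed

text \<open>By \<open>ergodic\<close>, vectors with equal entries are the equilibria against which
  \<open>w\<close> is compared. This is why the spread between its largest and smallest entry is the
  quantity to drive to zero.\<close>

lemma long_time_convergence:
  fixes w :: "nat \<Rightarrow> real \<Rightarrow> real" and \<xi> :: "nat \<Rightarrow> real"
  assumes strict: "\<And>i j p. i \<in> {1..N} \<Longrightarrow> j \<in> V i \<Longrightarrow>
                  strict_mono (\<lambda>x. Hamiltonian V L i (p(j := x)))"
    and ergodic: "\<And>i. i \<in> {1..N} \<Longrightarrow> Hamiltonian V L i (\<lambda>j. \<xi> j - \<xi> i) = \<gamma>"
    and cont: "\<And>i. i \<in> {1..N} \<Longrightarrow> continuous_on {0..} (w i)"
    and der: "\<And>i t. i \<in> {1..N} \<Longrightarrow> t > 0 \<Longrightarrow> (w i has_real_derivative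
       Hamiltonian V L i (\<lambda>j. (\<xi> j - \<xi> i) + (w j t - w i t)) - \<gamma>) (at t)"
  obtains q where "\<And>i. i \<in> {1..N} \<Longrightarrow> (w i \<longlongrightarrow> q) at_top"
proof -
  have Vi: "j \<in> {1..N}" if "i \<in> {1..N}" "j \<in> V i" for i j using V_subset[OF that(1)] that by auto
  have upper: "w i t \<le> A" if "0 \<le> s" "s \<le> t" "i \<in> {1..N}" "\<And>k. k \<in> {1..N} \<Longrightarrow> w k s \<le> A" for s t i A
  proof (rule max_comparison[where f = w and s = s and I = "{1..N}"])
    fix i t assume i: "i \<in> {1..N}" and t: "s < t" and *: "\<And>j. j \<in> {1..N} \<Longrightarrow> w j t \<le> w i t"
    have "Hamiltonian V L i (\<lambda>j. (\<xi> j - \<xi> i) + (w j t - w i t)) \<le> Hamiltonian V L i (\<lambda>j. \<xi> j - \<xi> i)"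
      using *[OF Vi[OF i]] by (intro Hamiltonian_mono i) simp
    then show "Hamiltonian V L i (\<lambda>j. (\<xi> j - \<xi> i) + (w j t - w i t)) - \<gamma> \<le> 0"
      using ergodic i by simp
  qed (use that der in \<open>auto intro: continuous_on_subset[OF cont]\<close>)
  have lower: "A \<le> w i t" if "0 \<le> s" "s \<le> t" "i \<in> {1..N}" "\<And>k. k \<in> {1..N} \<Longrightarrow> A \<le> w k s" for s t i A
  proof -
    have "- w i t \<le> - A"
    proof (rule max_comparison[where f = "\<lambda>i t. - w i t" and s = s and I = "{1..N}"])
      fix i t assume i: "i \<in> {1..N}" and t: "s < t" and *: "\<And>j. j \<in> {1..N} \<Longrightarrow> - w j t \<le> - w i t"
      have "Hamiltonian V L i (\<lambda>j. \<xi> j - \<xi> i) \<le> Hamiltonian V L i (\<lambda>j. (\<xi> j - \<xi> i) + (w j t - w i t))"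
        using *[OF Vi[OF i]] by (intro Hamiltonian_mono i) simp
      then show "- (Hamiltonian V L i (\<lambda>j. (\<xi> j - \<xi> i) + (w j t - w i t)) - \<gamma>) \<le> 0"
        using ergodic i by simp
    next
      fix i t assume "i \<in> {1..N}" "s < t"
      then show "((\<lambda>t. - w i t) has_real_derivative
          - (Hamiltonian V L i (\<lambda>j. (\<xi> j - \<xi> i) + (w j t - w i t)) - \<gamma>)) (at t)"
        using der that by (intro DERIV_minus) auto
    qed (use that in \<open>auto intro!: continuous_on_minus intro: continuous_on_subset[OF cont]\<close>)
    then show ?thesis by simp
  qed
  obtain W where W: "\<And>i. i \<in> {1..N} \<Longrightarrow> \<bar>w i 0\<bar> \<le> W" "W \<ge> 0"
    using finite_bound[of "\<lambda>i. w i 0"] by blast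
  have wW: "w i t \<le> W" "- W \<le> w i t" if "i \<in> {1..N}" "t \<ge> 0" for i t
    using upper[of 0 t i W] lower[of 0 t i "- W"] W that by (auto simp: abs_le_iff minus_le_iff)
  obtain Z where Z: "\<And>i. i \<in> {1..N} \<Longrightarrow> \<bar>\<xi> i\<bar> \<le> Z" "Z \<ge> 0"
    using finite_bound[of \<xi>] by blast
  \<comment> \<open>The comparison bounds hold at all times, so one Lipschitz constant serves the
    whole half-line.\<close>
  obtain K where K: "K > 0" "\<And>i p q D. i \<in> {1..N} \<Longrightarrow> (\<And>j. j \<in> V i \<Longrightarrow> \<bar>p j\<bar> \<le> 2 * Z + 2 * W) \<Longrightarrow>
     (\<And>j. j \<in> V i \<Longrightarrow> p j \<le> q j + D) \<Longrightarrow> D \<ge> 0 \<Longrightarrow>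
     Hamiltonian V L i p \<le> Hamiltonian V L i q + K * D"
    using Hamiltonian_Lipschitz[of "2 * Z + 2 * W"] by blast
  have pbound: "\<bar>(\<xi> j - \<xi> i) + (w j t - w i t)\<bar> \<le> 2 * Z + 2 * W"
    if "i \<in> {1..N}" "j \<in> V i" "t \<ge> 0" for i j t
    using Z(1)[OF that(1)] Z(1)[OF Vi[OF that(1,2)]] wW[OF that(1,3)] wW[OF Vi[OF that(1,2)] that(3)]
    by (auto simp: abs_le_iff)
  have gap_der: "((\<lambda>t. A - w i t) has_real_derivative
      - (Hamiltonian V L i (\<lambda>j. (\<xi> j - \<xi> i) + (w j t - w i t)) - \<gamma>)) (at t)"
    if "i \<in> {1..N}" "t > 0" for A i t
    using der[OF that] by (auto intro!: derivative_eq_intros)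
  have gap_cont: "continuous_on {a..b} (\<lambda>t. A - w i t)" if "i \<in> {1..N}" "a \<ge> 0" for A i a b
    using that by (intro continuous_intros continuous_on_subset[OF cont]) auto
  \<comment> \<open>No entry exceeds \<open>A\<close>, so every \<open>w j t - w i t\<close> is at
    most the gap \<open>A - w i t\<close>. The Lipschitz bound with this gap as \<open>D\<close>
    lets the gap shrink at rate at most \<open>K\<close>.\<close>
  have persist: "(A - w i a) * exp (- K * (b - a)) \<le> A - w i b"
    if A: "\<And>k t. k \<in> {1..N} \<Longrightarrow> s \<le> t \<Longrightarrow> w k t \<le> A" and i: "i \<in> {1..N}"
      and "0 \<le> s" "s \<le> a" "a \<le> b" for A s i a b
  proof -
    have "0 / K + ((A - w i a) - 0 / K) * exp (- K * (b - a)) \<le> A - w i b"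
    proof (rule exp_weighted_mono[OF gap_cont K(1) _ gap_der])
      fix t assume t: "a < t" "t < b"
      have "Hamiltonian V L i (\<lambda>j. (\<xi> j - \<xi> i) + (w j t - w i t))
          \<le> Hamiltonian V L i (\<lambda>j. \<xi> j - \<xi> i) + K * (A - w i t)"
      proof (rule K(2)[OF i])
        fix j assume j: "j \<in> V i"
        show "\<bar>(\<xi> j - \<xi> i) + (w j t - w i t)\<bar> \<le> 2 * Z + 2 * W"
          using t that by (intro pbound[OF i j]) simp
        show "(\<xi> j - \<xi> i) + (w j t - w i t) \<le> \<xi> j - \<xi> i + (A - w i t)"
          using A[OF Vi[OF i j], of t] t that(4) by simp
      qed (use A[OF i, of t] t that(4) in simp)
      then show "0 - K * (A - w i t) \<le> - (Hamiltonian V L i (\<lambda>j. (\<xi> j - \<xi> i) + (w j t - w i t)) - \<gamma>)"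
        using ergodic[OF i] by simp
    qed (use that in auto)
    then show ?thesis by simp
  qed
  \<comment> \<open>A gap at the successor \<open>j\<close> opens one at \<open>i\<close> within
    unit time. Its size does not depend on \<open>s\<close>, \<open>a\<close> or \<open>A\<close>,
    which is what allows the step to be chained and repeated.\<close>
  have edge: "\<exists>\<delta>'>0. \<forall>s\<ge>0. \<forall>a\<ge>s. \<forall>A. (\<forall>k\<in>{1..N}. \<forall>t\<ge>s. w k t \<le> A) \<longrightarrow> \<delta> \<le> A - w j a \<longrightarrow> \<delta>' \<le> A - w i (a + 1)"
    if i: "i \<in> {1..N}" and j: "j \<in> V i" and \<delta>: "\<delta> > 0" for i j \<delta>
  proof -
    \<comment> \<open>By \<open>persist\<close>, at least this much of the gap at \<open>j\<close>
      survives throughout the unit interval.\<close>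
    define d where "d = \<delta> * exp (- K)"
    define p where "p = (\<lambda>j. \<xi> j - \<xi> i)"
    \<comment> \<open>Strictness at the single momentum \<open>p\<close> gives
      \<open>\<eta> > 0\<close>; the Lipschitz bound carries it over to all momenta that occur, as a
      source term in the differential inequality for the gap at \<open>i\<close>.\<close>
    define \<eta> where "\<eta> = \<gamma> - Hamiltonian V L i (p(j := p j - d))"
    have d: "d > 0" using \<delta> by (simp add: d_def)
    have "Hamiltonian V L i (p(j := p j - d)) < Hamiltonian V L i p"
      using strict_monoD[OF strict[OF i j, of p], of "p j - d" "p j"] d by simp
    then have \<eta>: "\<eta> > 0" using ergodic[OF i] by (simp add: \<eta>_def flip: p_def)
    show ?thesis
    proof (intro exI[of _ "\<eta> / K * (1 - exp (- K))"] conjI allI impI)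
      show "0 < \<eta> / K * (1 - exp (- K))" using \<eta> K by simp
      fix s a A assume s: "0 \<le> s" "s \<le> a" and A: "\<forall>k\<in>{1..N}. \<forall>t\<ge>s. w k t \<le> A"
        and a: "\<delta> \<le> A - w j a"
      have "\<eta> / K + ((A - w i a) - \<eta> / K) * exp (- K * ((a + 1) - a)) \<le> A - w i (a + 1)"
      proof (rule exp_weighted_mono[OF gap_cont K(1) _ gap_der])
        fix t assume t: "a < t" "t < a + 1"
        have "d \<le> (A - w j a) * exp (- K * (t - a))"
          unfolding d_def using a t K \<delta> by (intro mult_mono) auto
        also have "\<dots> \<le> A - w j t"
          using A s t by (intro persist[of s] Vi[OF i j]) (auto simp del: atLeastAtMost_iff)
        finally have dj: "d \<le> A - w j t" .
        have wA: "w k t \<le> A" if "k \<in> {1..N}" for k using bspec[OF A that] s t by auto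
        have "Hamiltonian V L i (\<lambda>j. (\<xi> j - \<xi> i) + (w j t - w i t))
            \<le> Hamiltonian V L i (p(j := p j - d)) + K * (A - w i t)"
        proof (rule K(2)[OF i])
          fix k assume k: "k \<in> V i"
          show "\<bar>(\<xi> k - \<xi> i) + (w k t - w i t)\<bar> \<le> 2 * Z + 2 * W"
            using t s by (intro pbound[OF i k]) simp
          show "(\<xi> k - \<xi> i) + (w k t - w i t) \<le> (p(j := p j - d)) k + (A - w i t)"
            using wA[OF Vi[OF i k]] dj by (simp add: p_def)
        qed (use wA[OF i] in simp)
        then show "\<eta> - K * (A - w i t) \<le> - (Hamiltonian V L i (\<lambda>j. (\<xi> j - \<xi> i) + (w j t - w i t)) - \<gamma>)"
          by (simp add: \<eta>_def)
      qed (use s i in auto)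
      \<comment> \<open>The gap at \<open>i\<close> may vanish at time \<open>a\<close>; the source
        term alone produces the lower bound.\<close>
      moreover have "(0 - \<eta> / K) * exp (- K) \<le> ((A - w i a) - \<eta> / K) * exp (- K)"
        using A i s by (intro mult_right_mono) auto
      moreover have "- K * ((a + 1) - a) = - K" by simp
      ultimately have "\<eta> / K + (0 - \<eta> / K) * exp (- K) \<le> A - w i (a + 1)"
        by (metis add_left_mono order_trans)
      then show "\<eta> / K * (1 - exp (- K)) \<le> A - w i (a + 1)"
        by (simp add: algebra_simps)
    qed
  qed
  define E where "E = {(k, l). k \<in> {1..N} \<and> l \<in> V k}"
  \<comment> \<open>Induction at the head of the path: prepending an edge costs one more unit of
    time and shrinks the guaranteed gap, again uniformly in \<open>s\<close> and
    \<open>A\<close>.\<close>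
  have path: "\<exists>\<delta>'>0. \<exists>T\<ge>0. \<forall>s\<ge>0. \<forall>A. (\<forall>k\<in>{1..N}. \<forall>t\<ge>s. w k t \<le> A) \<longrightarrow> \<delta> \<le> A - w j s \<longrightarrow> \<delta>' \<le> A - w i (s + T)"
    if "(i, j) \<in> E\<^sup>*" "\<delta> > 0" for i j \<delta>
    using that(1)
  proof (induction rule: converse_rtrancl_induct)
    case base
    show ?case
      by (rule exI[of _ \<delta>], rule conjI[OF that(2)], rule exI[of _ 0]) auto
  next
    case (step i k)
    then obtain \<delta>1 T where 1: "\<delta>1 > 0" "T \<ge> 0" "\<And>s A. s \<ge> 0 \<Longrightarrow> \<forall>k\<in>{1..N}. \<forall>t\<ge>s. w k t \<le> A \<Longrightarrow>
        \<delta> \<le> A - w j s \<Longrightarrow> \<delta>1 \<le> A - w k (s + T)" by blast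
    obtain \<delta>2 where 2: "\<delta>2 > 0" "\<And>s a A. s \<ge> 0 \<Longrightarrow> s \<le> a \<Longrightarrow> \<forall>k\<in>{1..N}. \<forall>t\<ge>s. w k t \<le> A \<Longrightarrow>
        \<delta>1 \<le> A - w k a \<Longrightarrow> \<delta>2 \<le> A - w i (a + 1)"
      using edge[of i k \<delta>1] step(1) 1(1) unfolding E_def by blast
    show ?case
    proof (rule exI[of _ \<delta>2], rule conjI[OF 2(1)], rule exI[of _ "T + 1"], intro conjI allI impI)
      fix s A assume s: "(0::real) \<le> s" "\<forall>k\<in>{1..N}. \<forall>t\<ge>s. w k t \<le> A" "\<delta> \<le> A - w j s"
      have "\<delta>2 \<le> A - w i ((s + T) + 1)" using 1(2) by (intro 2(2)[OF s(1) _ s(2)] 1(3) s) simp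
      then show "\<delta>2 \<le> A - w i (s + (T + 1))" by (simp add: add.assoc)
    qed (use 1 2 in auto)
  qed
  have ne: "{1..N} \<noteq> {}" using N_pos by simp
  have decay: "\<exists>\<delta>'>0. \<exists>T\<ge>0. \<forall>s\<ge>0. \<forall>A. (\<forall>k\<in>{1..N}. \<forall>t\<ge>s. w k t \<le> A) \<longrightarrow> (\<exists>j\<in>{1..N}. \<delta> \<le> A - w j s) \<longrightarrow>
      (\<forall>i\<in>{1..N}. \<delta>' \<le> A - w i (s + T))" if \<delta>: "\<delta> > 0" for \<delta>
  proof -
    have "\<forall>x\<in>{1..N}\<times>{1..N}. \<exists>y. fst y > 0 \<and> snd y \<ge> 0 \<and> (\<forall>s\<ge>0. \<forall>A. (\<forall>k\<in>{1..N}. \<forall>t\<ge>s. w k t \<le> A) \<longrightarrow>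
       \<delta> \<le> A - w (snd x) s \<longrightarrow> fst y \<le> A - w (fst x) (s + snd y))"
    proof
      fix x assume "x \<in> {1..N}\<times>{1..N}"
      then have "(fst x, snd x) \<in> E\<^sup>*" using graph unfolding E_def strongly_connected_digraph_def by auto
      from path[OF this \<delta>] obtain \<delta>' T where "\<delta>' > 0" "T \<ge> 0"
        "\<forall>s\<ge>0. \<forall>A. (\<forall>k\<in>{1..N}. \<forall>t\<ge>s. w k t \<le> A) \<longrightarrow> \<delta> \<le> A - w (snd x) s \<longrightarrow> \<delta>' \<le> A - w (fst x) (s + T)" by blast
      then show "\<exists>y. fst y > 0 \<and> snd y \<ge> 0 \<and> (\<forall>s\<ge>0. \<forall>A. (\<forall>k\<in>{1..N}. \<forall>t\<ge>s. w k t \<le> A) \<longrightarrow>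
       \<delta> \<le> A - w (snd x) s \<longrightarrow> fst y \<le> A - w (fst x) (s + snd y))"
        by (intro exI[of _ "(\<delta>', T)"]) auto
    qed
    then obtain y where y: "\<And>x. x \<in> {1..N}\<times>{1..N} \<Longrightarrow> fst (y x) > 0 \<and> snd (y x) \<ge> 0 \<and>
       (\<forall>s\<ge>0. \<forall>A. (\<forall>k\<in>{1..N}. \<forall>t\<ge>s. w k t \<le> A) \<longrightarrow>
       \<delta> \<le> A - w (snd x) s \<longrightarrow> fst (y x) \<le> A - w (fst x) (s + snd (y x)))" by metis
    \<comment> \<open>A common time for all pairs of nodes, and below it the least gap. A node
      reached before \<open>T\<close> has to wait, which by \<open>persist\<close> costs at most the
      factor \<open>exp (- K * T)\<close>.\<close>
    define T where "T = (\<Sum>x\<in>{1..N}\<times>{1..N}. snd (y x))"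
    define d where "d = Min ((\<lambda>x. fst (y x)) ` ({1..N}\<times>{1..N}))"
    have T: "snd (y x) \<le> T" if "x \<in> {1..N}\<times>{1..N}" for x
      unfolding T_def using that y by (intro member_le_sum) auto
    have d: "d \<le> fst (y x)" if "x \<in> {1..N}\<times>{1..N}" for x
      unfolding d_def using that by (intro Min_le) auto
    have d0: "d > 0" unfolding d_def using ne y by (subst Min_gr_iff) auto
    have T0: "T \<ge> 0" unfolding T_def using y by (intro sum_nonneg) auto
    show ?thesis
    proof (rule exI[of _ "d * exp (- K * T)"], rule conjI, use d0 in simp, rule exI[of _ T],
        intro conjI allI impI ballI)
      fix s A i assume s: "(0::real) \<le> s" and A: "\<forall>k\<in>{1..N}. \<forall>t\<ge>s. w k t \<le> A"
        and "\<exists>j\<in>{1..N}. \<delta> \<le> A - w j s" and i: "i \<in> {1..N}"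
      then obtain j where j: "j \<in> {1..N}" "\<delta> \<le> A - w j s" by blast
      define T' where "T' = snd (y (i, j))"
      have ij: "(i, j) \<in> {1..N}\<times>{1..N}" using i j by simp
      have T': "T' \<le> T" "T' \<ge> 0" using T[OF ij] y[OF ij] by (auto simp: T'_def)
      have dd: "d \<le> A - w i (s + T')" using y[OF ij] s A j d[OF ij] by (fastforce simp: T'_def)
      have "d * exp (- K * T) \<le> (A - w i (s + T')) * exp (- K * ((s + T) - (s + T')))"
        using dd T' d0 K by (intro mult_mono) auto
      also have "\<dots> \<le> A - w i (s + T)" using A s T' i by (intro persist[of s]) auto
      finally show "d * exp (- K * T) \<le> A - w i (s + T)" .
    qed (use d0 T0 in auto)
  qed
  define Mx where "Mx t = Max ((\<lambda>i. w i t) ` {1..N})" for t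
  define mn where "mn t = Min ((\<lambda>i. w i t) ` {1..N})" for t
  have Mx_ge: "w i t \<le> Mx t" and mn_le: "mn t \<le> w i t" if "i \<in> {1..N}" for i t
    unfolding Mx_def mn_def using that by auto
  have "Mx t \<in> (\<lambda>i. w i t) ` {1..N}" "mn t \<in> (\<lambda>i. w i t) ` {1..N}" for t
    unfolding Mx_def mn_def using ne by (intro Max_in Min_in; simp)+
  then have Mx_in: "\<exists>i\<in>{1..N}. Mx t = w i t" and mn_in: "\<exists>i\<in>{1..N}. mn t = w i t" for t
    by blast+
  have wMx: "w i t \<le> Mx s" and wmn: "mn s \<le> w i t" if "0 \<le> s" "s \<le> t" "i \<in> {1..N}" for s t i
    using upper[OF that Mx_ge] lower[OF that mn_le] by auto
  have mnMx: "mn s \<le> Mx t" if "s \<ge> 0" "t \<ge> 0" for s t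
    using order_trans[OF wmn[of s "max s t" 1] wMx[of t "max s t" 1]] that N_pos by simp
  \<comment> \<open>One such time suffices, since \<open>Mx\<close> and \<open>mn\<close> are
    monotone. If the spread stayed above \<open>\<epsilon>\<close>, then \<open>Mx\<close> would
    drop by a fixed \<open>d\<close> in each period \<open>T\<close> and pass below
    \<open>mn 0\<close>.\<close>
  have close: "\<exists>s\<ge>0. Mx s - mn s < \<epsilon>" if \<epsilon>: "\<epsilon> > 0" for \<epsilon>
  proof (rule ccontr)
    assume "\<not> (\<exists>s\<ge>0. Mx s - mn s < \<epsilon>)"
    then have far: "\<epsilon> \<le> Mx s - mn s" if "s \<ge> 0" for s using that by force
    obtain d T where d: "d > 0" "T \<ge> 0" "\<And>s A i. s\<ge>0 \<Longrightarrow> (\<forall>k\<in>{1..N}. \<forall>t\<ge>s. w k t \<le> A) \<Longrightarrow> (\<exists>j\<in>{1..N}. \<epsilon> \<le> A - w j s) \<Longrightarrow>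
      i\<in>{1..N} \<Longrightarrow> d \<le> A - w i (s + T)" using decay[OF \<epsilon>] by blast
    have dec: "Mx (s + T) \<le> Mx s - d" if s: "s \<ge> 0" for s
    proof -
      obtain i where i: "i \<in> {1..N}" "Mx (s + T) = w i (s + T)" using Mx_in by blast
      have "d \<le> Mx s - w i (s + T)"
        using mn_in[of s] far[OF s] by (intro d(3)[OF s _ _ i(1)]) (auto intro: wMx s)
      then show ?thesis using i by simp
    qed
    have "Mx (real n * T) \<le> Mx 0 - real n * d" for n
    proof (induction n)
      case (Suc n)
      then show ?case using dec[of "real n * T"] d by (simp add: algebra_simps)
    qed simp
    moreover have "mn 0 \<le> Mx (real n * T)" for n using d by (intro mnMx) auto
    ultimately have "real n * d \<le> Mx 0 - mn 0" for n by (smt (verit))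
    then show False using reals_Archimedean3[OF d(1)] by (meson not_le)
  qed
  define q where "q = (INF t\<in>{0..}. Mx t)"
  have bdd: "bdd_below (Mx ` {0..})" using mnMx[of 0] by (intro bdd_belowI[of _ "mn 0"]) auto
  have qMx: "q \<le> Mx t" if "t \<ge> 0" for t unfolding q_def using that bdd by (intro cINF_lower) auto
  have mnq: "mn t \<le> q" if "t \<ge> 0" for t unfolding q_def using that mnMx by (intro cINF_greatest) auto
  show ?thesis
  proof (rule that[of q], rule tendstoI)
    fix i \<epsilon> assume i: "i \<in> {1..N}" and "(\<epsilon>::real) > 0"
    then obtain s where s: "s \<ge> 0" "Mx s - mn s < \<epsilon>" using close by blast
    have "dist (w i t) q < \<epsilon>" if "t \<ge> s" for t
      using wMx[OF s(1) that i] wmn[OF s(1) that i] qMx[OF s(1)] mnq[OF s(1)] s by (auto simp: dist_real_def)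
    then show "\<forall>\<^sub>F t in at_top. dist (w i t) q < \<epsilon>" using eventually_at_top_linorder by blast
  qed
qed

end

section \<open>Integration\<close>

lemma ennreal_integral_le_nn_integral:
  fixes f :: "'a \<Rightarrow> real"
  assumes "integrable S f"
  shows "ennreal (\<integral>x. f x \<partial>S) \<le> (\<integral>\<^sup>+x. ennreal (f x) \<partial>S)"
proof -
  have "(\<integral>x. f x \<partial>S) \<le> (\<integral>x. max 0 (f x) \<partial>S)"
    using assms by (intro integral_mono) auto
  then have "ennreal (\<integral>x. f x \<partial>S) \<le> ennreal (\<integral>x. max 0 (f x) \<partial>S)" by (rule ennreal_leI)
  also have "\<dots> = (\<integral>\<^sup>+x. ennreal (max 0 (f x)) \<partial>S)"
    using assms by (intro nn_integral_eq_integral[symmetric]) auto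
  also have "(\<lambda>x. ennreal (max 0 (f x))) = (\<lambda>x. ennreal (f x))"
    by (auto simp: fun_eq_iff max_def ennreal_neg)
  finally show ?thesis .
qed

text \<open>In terms of positive and negative parts, \<open>f^+ + a^- = f^- + a^+ + h\<close>
  pointwise. This identity of nonnegative functions can be integrated whether or not
  \<open>h\<close> has finite integral, and then rearranged because the integrals of
  \<open>a^-\<close>, \<open>a^+\<close> and \<open>f^-\<close> are finite.\<close>

lemma ereal_integral_real_plus_ennreal:
  fixes a :: "'a \<Rightarrow> real" and h :: "'a \<Rightarrow> ennreal"
  assumes a: "integrable S a" and h[measurable]: "h \<in> borel_measurable S"
    and f: "\<And>x. x \<in> space S \<Longrightarrow> f x = ereal (a x) + enn2ereal (h x)"
  shows "ereal_integral S f = ereal (\<integral>x. a x \<partial>S) + enn2ereal (\<integral>\<^sup>+x. h x \<partial>S)"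
    and "(\<integral>\<^sup>+x. e2ennreal (- f x) \<partial>S) < \<infinity>"
proof -
  have am[measurable]: "a \<in> borel_measurable S" using a by simp
  define f' where "f' x = ereal (a x) + enn2ereal (h x)" for x
  have [measurable]: "f' \<in> borel_measurable S" unfolding f'_def by measurable
  have ptw: "e2ennreal (f' x) + ennreal (- a x) = e2ennreal (- f' x) + ennreal (a x) + h x"
    and neg: "e2ennreal (- f' x) \<le> ennreal (- a x)" for x
  proof -
    have pos: "ennreal r = ennreal (max 0 r)" for r by (auto simp: max_def ennreal_neg)
    show "e2ennreal (f' x) + ennreal (- a x) = e2ennreal (- f' x) + ennreal (a x) + h x"
    proof (cases "h x")
      case (real c)
      have "f' x = ereal (a x + c)" unfolding f'_def real using real by simp
      then have "e2ennreal (f' x) + ennreal (- a x) = ennreal (max 0 (a x + c) + max 0 (- a x))"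
        using pos[of "a x + c"] pos[of "- a x"] by simp
      also have "max 0 (a x + c) + max 0 (- a x) = max 0 (- (a x + c)) + max 0 (a x) + c"
        by (simp add: max_def)
      also have "ennreal \<dots> = e2ennreal (- f' x) + ennreal (a x) + h x"
        using pos[of "- (a x + c)"] pos[of "a x"] real \<open>f' x = ereal (a x + c)\<close> by simp
      finally show ?thesis .
    qed (simp add: f'_def)
    have "- f' x \<le> ereal (- a x)" unfolding f'_def
      by (cases "h x") (auto simp: less_imp_le)
    then show "e2ennreal (- f' x) \<le> ennreal (- a x)" using e2ennreal_mono by fastforce
  qed
  have cong: "(\<integral>\<^sup>+x. e2ennreal (f x) \<partial>S) = (\<integral>\<^sup>+x. e2ennreal (f' x) \<partial>S)"
    "(\<integral>\<^sup>+x. e2ennreal (- f x) \<partial>S) = (\<integral>\<^sup>+x. e2ennreal (- f' x) \<partial>S)"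
    using f by (auto intro!: nn_integral_cong simp: f'_def)
  have eq: "(\<integral>\<^sup>+x. e2ennreal (f' x) \<partial>S) + (\<integral>\<^sup>+x. ennreal (- a x) \<partial>S) =
      (\<integral>\<^sup>+x. e2ennreal (- f' x) \<partial>S) + (\<integral>\<^sup>+x. ennreal (a x) \<partial>S) + (\<integral>\<^sup>+x. h x \<partial>S)"
    using nn_integral_cong[of S "\<lambda>x. e2ennreal (f' x) + ennreal (- a x)", OF ptw]
    by (simp add: nn_integral_add)
  have fin: "(\<integral>\<^sup>+x. ennreal (- a x) \<partial>S) \<noteq> \<infinity>" "(\<integral>\<^sup>+x. ennreal (a x) \<partial>S) \<noteq> \<infinity>"
    using a by (simp_all add: real_integrable_def)
  have le: "(\<integral>\<^sup>+x. e2ennreal (- f' x) \<partial>S) \<le> (\<integral>\<^sup>+x. ennreal (- a x) \<partial>S)"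
    by (intro nn_integral_mono neg)
  then show "(\<integral>\<^sup>+x. e2ennreal (- f x) \<partial>S) < \<infinity>"
    unfolding cong using fin by (simp add: top.not_eq_extremum order.strict_trans1)
  show "ereal_integral S f = ereal (\<integral>x. a x \<partial>S) + enn2ereal (\<integral>\<^sup>+x. h x \<partial>S)"
    unfolding ereal_integral_def cong real_lebesgue_integral_def[OF a]
    using eq fin le
    by (cases "(\<integral>\<^sup>+x. e2ennreal (f' x) \<partial>S)"; cases "(\<integral>\<^sup>+x. e2ennreal (- f' x) \<partial>S)";
        cases "(\<integral>\<^sup>+x. ennreal (- a x) \<partial>S)"; cases "(\<integral>\<^sup>+x. ennreal (a x) \<partial>S)";
        cases "(\<integral>\<^sup>+x. h x \<partial>S)")
      (auto simp: top_unique simp flip: ennreal_plus)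
qed

text \<open>Negation commutes with \<open>ereal_integral\<close> only if one of the two parts has
  finite integral; the second claim of the preceding lemma provides this.\<close>

lemma ereal_integral_uminus_real_plus_ennreal:
  fixes a :: "'a \<Rightarrow> real" and h :: "'a \<Rightarrow> ennreal"
  assumes a: "integrable S a" and h: "h \<in> borel_measurable S"
    and f: "\<And>x. x \<in> space S \<Longrightarrow> f x = - (ereal (a x) + enn2ereal (h x))"
  shows "ereal_integral S f = - (ereal (\<integral>x. a x \<partial>S) + enn2ereal (\<integral>\<^sup>+x. h x \<partial>S))"
proof -
  have f': "- f x = ereal (a x) + enn2ereal (h x)" if "x \<in> space S" for x
    using f[OF that] by simp
  note * = ereal_integral_real_plus_ennreal[OF a h f']
  have "ereal_integral S f = - ereal_integral S (\<lambda>x. - f x)"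
    using *(2) unfolding ereal_integral_def
    by (cases "\<integral>\<^sup>+x. e2ennreal (f x) \<partial>S"; cases "\<integral>\<^sup>+x. e2ennreal (- f x) \<partial>S") auto
  then show ?thesis using *(1) by simp
qed

section \<open>Integration over compact intervals\<close>

lemma integrable_lebesgue_on_iff:
  fixes f :: "real \<Rightarrow> real"
  shows "integrable (lebesgue_on {a..b}) f \<longleftrightarrow> f absolutely_integrable_on {a..b}"
  unfolding set_integrable_def by (subst integrable_restrict_space) auto

lemma integral_lebesgue_on_indicator:
  fixes f :: "real \<Rightarrow> real"
  assumes f: "integrable (lebesgue_on {a..b}) f" and sub: "{c..d} \<subseteq> {a..b}"
  shows "(\<integral>x. indicator {c..d} x * f x \<partial>lebesgue_on {a..b}) = integral {c..d} f"
    and "integrable (lebesgue_on {a..b}) (\<lambda>x. indicator {c..d} x * f x)"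
proof -
  show int: "integrable (lebesgue_on {a..b}) (\<lambda>x. indicator {c..d} x * f x)"
    using sub by (subst mult.commute, intro integrable_real_mult_indicator f)
      (auto simp: sets_restrict_space_iff)
  have "(\<integral>x. indicator {c..d} x * f x \<partial>lebesgue_on {a..b}) = integral {a..b} (\<lambda>x. indicator {c..d} x * f x)"
    by (rule lebesgue_integral_eq_integral[OF int]) simp
  also have "\<dots> = integral {a..b} (\<lambda>x. if x \<in> {c..d} then f x else 0)"
    by (intro integral_cong) (simp add: indicator_def)
  also have "\<dots> = integral ({c..d} \<inter> {a..b}) f" by (rule integral_restrict_Int)
  finally show "(\<integral>x. indicator {c..d} x * f x \<partial>lebesgue_on {a..b}) = integral {c..d} f"
    by (simp only: Int_absorb2[OF sub])
qed

text \<open>Fubini on the triangle \<open>\<tau> \<le> s\<close>.\<close>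

lemma integral_product_rule:
  fixes p q W W' :: "real \<Rightarrow> real"
  assumes ab: "a \<le> b"
    and q: "q absolutely_integrable_on {a..b}"
    and p: "\<And>s. s \<in> {a..b} \<Longrightarrow> (q has_integral (p s - p a)) {a..s}"
    and W: "\<And>s. s \<in> {a..b} \<Longrightarrow> (W has_real_derivative W' s) (at s within {a..b})"
    and W': "continuous_on {a..b} W'"
  shows "integrable (lebesgue_on {a..b}) (\<lambda>s. q s * W s + p s * W' s)"
    and "(\<integral>s. q s * W s + p s * W' s \<partial>lebesgue_on {a..b}) = p b * W b - p a * W a"
proof -
  let ?S = "lebesgue_on {a..b}"
  interpret S: finite_measure ?S by (rule finite_measure_lebesgue_on) simp
  interpret SS: pair_sigma_finite ?S ?S ..
  have Wc: "continuous_on {a..b} W"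
    using W by (intro DERIV_continuous_on[of _ _ W']) auto
  have qS: "integrable ?S q" using q by (simp add: integrable_lebesgue_on_iff)
  have W'S: "integrable ?S W'"
    unfolding integrable_lebesgue_on_iff by (rule absolutely_integrable_continuous_real[OF W'])
  have [measurable]: "q \<in> borel_measurable ?S" "W' \<in> borel_measurable ?S" using qS W'S by auto
  have [measurable]: "(\<lambda>x. x) \<in> borel_measurable ?S"
    using id_borel_measurable_lebesgue_on by (simp add: id_def)
  have bdd: "integrable ?S (\<lambda>s. q s * c s)" if c: "continuous_on {a..b} c" for c :: "real \<Rightarrow> real"
    unfolding integrable_lebesgue_on_iff mult.commute[of "q _"]
  proof (rule absolutely_integrable_bounded_measurable_product_real[OF _ _ _ q])
    show "c \<in> borel_measurable (lebesgue_on {a..b})"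
      by (rule continuous_imp_measurable_on_sets_lebesgue[OF c]) simp
    show "bounded (c ` {a..b})" by (intro compact_imp_bounded compact_continuous_image c) simp
  qed simp
  have pc: "continuous_on {a..b} p"
  proof -
    have "continuous_on {a..b} (\<lambda>s. integral {a..s} q + p a)"
      using q by (intro continuous_intros indefinite_integral_continuous_1)
        (simp add: set_lebesgue_integral_eq_integral)
    moreover have "integral {a..s} q + p a = p s" if "s \<in> {a..b}" for s
      using integral_unique[OF p[OF that]] by simp
    ultimately show ?thesis by (rule continuous_on_eq)
  qed
  \<comment> \<open>\<open>p\<close> is only absolutely continuous, so \<open>p * W\<close> is not
    differentiated pointwise. The inner integrals of this kernel, in the two orders, are the
    increments of \<open>p\<close> and of \<open>W\<close>.\<close>
  define f where "f \<tau> s = indicator {a..s} \<tau> * (q \<tau> * W' s)" for \<tau> s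
  have fm[measurable]: "case_prod f \<in> borel_measurable (?S \<Otimes>\<^sub>M ?S)"
  proof -
    have "case_prod f = (\<lambda>x. (if a \<le> fst x \<and> fst x \<le> snd x then 1 else 0) * (q (fst x) * W' (snd x)))"
      by (auto simp: f_def fun_eq_iff indicator_def)
    then show ?thesis by simp
  qed
  have "integrable (?S \<Otimes>\<^sub>M ?S) (\<lambda>x. q (fst x) * W' (snd x))"
    using qS W'S by (intro SS.Fubini_integrable) (auto simp: abs_mult)
  then have "integrable (?S \<Otimes>\<^sub>M ?S) (case_prod f)"
    by (rule Bochner_Integration.integrable_bound) (auto simp: f_def indicator_def)
  from SS.Fubini_integral[OF this]
  have fub: "(\<integral>s. (\<integral>\<tau>. f \<tau> s \<partial>?S) \<partial>?S) = (\<integral>\<tau>. (\<integral>s. f \<tau> s \<partial>?S) \<partial>?S)" .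
  have "(\<integral>\<tau>. f \<tau> s \<partial>?S) = (p s - p a) * W' s" if s: "s \<in> {a..b}" for s
  proof -
    have "(\<integral>\<tau>. f \<tau> s \<partial>?S) = (\<integral>\<tau>. indicator {a..s} \<tau> * q \<tau> \<partial>?S) * W' s"
      unfolding f_def by (simp flip: mult.assoc)
    also have "(\<integral>\<tau>. indicator {a..s} \<tau> * q \<tau> \<partial>?S) = p s - p a"
      using s integral_unique[OF p[OF s]] by (subst integral_lebesgue_on_indicator[OF qS]) auto
    finally show ?thesis .
  qed
  then have 1: "(\<integral>s. (\<integral>\<tau>. f \<tau> s \<partial>?S) \<partial>?S) = (\<integral>s. (p s - p a) * W' s \<partial>?S)"
    by (intro Bochner_Integration.integral_cong) auto
  have "(\<integral>s. f \<tau> s \<partial>?S) = q \<tau> * (W b - W \<tau>)" if \<tau>: "\<tau> \<in> {a..b}" for \<tau>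
  proof -
    have "(\<integral>s. f \<tau> s \<partial>?S) = (\<integral>s. q \<tau> * (indicator {\<tau>..b} s * W' s) \<partial>?S)"
      using \<tau> by (intro Bochner_Integration.integral_cong) (auto simp: f_def indicator_def)
    also have "\<dots> = q \<tau> * (\<integral>s. indicator {\<tau>..b} s * W' s \<partial>?S)" by simp
    also have "(\<integral>s. indicator {\<tau>..b} s * W' s \<partial>?S) = integral {\<tau>..b} W'"
      using \<tau> by (intro integral_lebesgue_on_indicator[OF W'S]) auto
    also have "\<dots> = W b - W \<tau>"
      using \<tau> by (intro integral_unique fundamental_theorem_of_calculus)
        (auto simp flip: has_real_derivative_iff_has_vector_derivative intro!: DERIV_subset[OF W])
    finally show ?thesis .
  qed
  then have 2: "(\<integral>\<tau>. (\<integral>s. f \<tau> s \<partial>?S) \<partial>?S) = (\<integral>\<tau>. q \<tau> * (W b - W \<tau>) \<partial>?S)"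
    by (intro Bochner_Integration.integral_cong) auto
  have qW: "integrable ?S (\<lambda>s. q s * W s)" by (rule bdd[OF Wc])
  have pW': "integrable ?S (\<lambda>s. p s * W' s)"
    unfolding integrable_lebesgue_on_iff
    by (intro absolutely_integrable_continuous_real continuous_intros pc W')
  show "integrable ?S (\<lambda>s. q s * W s + p s * W' s)" using qW pW' by simp
  have iq: "(\<integral>\<tau>. q \<tau> \<partial>?S) = p b - p a"
    using integral_unique[OF p[of b]] ab lebesgue_integral_eq_integral[OF qS] by simp
  have iW: "(\<integral>\<tau>. W' \<tau> \<partial>?S) = W b - W a"
    using lebesgue_integral_eq_integral[OF W'S] ab fundamental_theorem_of_calculus[OF ab, of W W'] W
    by (simp add: integral_unique has_real_derivative_iff_has_vector_derivative)
  have "(\<integral>s. p s * W' s \<partial>?S) - p a * (W b - W a) = (p b - p a) * W b - (\<integral>s. q s * W s \<partial>?S)"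
  proof -
    have "(\<integral>s. (p s - p a) * W' s \<partial>?S) = (\<integral>s. p s * W' s \<partial>?S) - p a * (\<integral>s. W' s \<partial>?S)"
      using pW' W'S by (simp add: left_diff_distrib)
    moreover have "(\<integral>\<tau>. q \<tau> * (W b - W \<tau>) \<partial>?S) = (\<integral>\<tau>. q \<tau> \<partial>?S) * W b - (\<integral>s. q s * W s \<partial>?S)"
      using qS qW by (simp add: right_diff_distrib)
    ultimately show ?thesis using fub 1 2 iq iW by simp
  qed
  moreover have "(\<integral>s. q s * W s + p s * W' s \<partial>?S) = (\<integral>s. q s * W s \<partial>?S) + (\<integral>s. p s * W' s \<partial>?S)"
    using qW pW' by simp
  ultimately show "(\<integral>s. q s * W s + p s * W' s \<partial>?S) = p b * W b - p a * W a"
    by (simp add: algebra_simps)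
qed

section \<open>Law of the controlled chain\<close>

lemma lower_semicontinuous_superlevel_open:
  assumes "lower_semicontinuous_on S f"
  obtains G where "open G" "{x\<in>S. a < f x} = S \<inter> G"
proof -
  have "openin (top_of_set S) {x\<in>S. a < f x}"
  proof (subst openin_subopen, intro ballI)
    fix x assume x: "x \<in> {x\<in>S. a < f x}"
    then have "a < Liminf (at x within S) f"
      using assms unfolding lower_semicontinuous_on_def by (auto intro: less_le_trans)
    then have "\<forall>\<^sub>F y in at x within S. a < f y" by (rule less_LiminfD)
    \<comment> \<open>The filter at \<open>x\<close> omits \<open>x\<close>, hence the clause
      \<open>y \<noteq> x\<close>; at \<open>x\<close> itself the inequality is the
      assumption.\<close>
    then obtain T where T: "open T" "x \<in> T" "\<And>y. y \<in> T \<Longrightarrow> y \<noteq> x \<Longrightarrow> y \<in> S \<Longrightarrow> a < f y"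
      unfolding eventually_at_topological by blast
    then show "\<exists>T. openin (top_of_set S) T \<and> x \<in> T \<and> T \<subseteq> {x\<in>S. a < f x}"
      using x by (intro exI[of _ "S \<inter> T"]) auto
  qed
  then show ?thesis using that unfolding openin_open by blast
qed

lemma borel_measurable_lower_semicontinuous_compose:
  fixes f :: "'a::topological_space \<Rightarrow> ereal"
  assumes f: "lower_semicontinuous_on S f"
    and x: "x \<in> borel_measurable M" "\<And>s. s \<in> space M \<Longrightarrow> x s \<in> S"
  shows "(\<lambda>s. f (x s)) \<in> borel_measurable M"
proof (rule borel_measurable_ereal_iff_Ioi[THEN iffD2], intro allI)
  fix a
  obtain G where G: "open G" "{x\<in>S. a < f x} = S \<inter> G"
    using lower_semicontinuous_superlevel_open[OF f] by blast
  have "(\<lambda>s. f (x s)) -` {a<..} \<inter> space M = x -` G \<inter> space M"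
    using G(2) x(2) by fastforce
  then show "(\<lambda>s. f (x s)) -` {a<..} \<inter> space M \<in> sets M"
    using measurable_sets[OF x(1), of G] G(1) by simp
qed

text \<open>Floor plus 1, rather than the ceiling, gives a grid point strictly to the right of
  \<open>s\<close> even when \<open>s\<close> lies on the grid, as convergence in
  \<open>at_right\<close> demands.\<close>

lemma right_grid_tendsto:
  fixes s :: real
  shows "filterlim (\<lambda>n. (real_of_int \<lfloor>real (Suc n) * s\<rfloor> + 1) / real (Suc n)) (at_right s) sequentially"
    and "s < (real_of_int \<lfloor>real (Suc n) * s\<rfloor> + 1) / real (Suc n)"
proof -
  define d where "d n = (real_of_int \<lfloor>real (Suc n) * s\<rfloor> + 1) / real (Suc n)" for n
  have gt: "s < d n" for n
  proof -
    have "real (Suc n) * s < real_of_int \<lfloor>real (Suc n) * s\<rfloor> + 1" by linarith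
    then show ?thesis unfolding d_def by (simp add: field_simps del: of_nat_Suc)
  qed
  have le: "d n \<le> s + 1 / real (Suc n)" for n
  proof -
    have "real_of_int \<lfloor>real (Suc n) * s\<rfloor> + 1 \<le> real (Suc n) * s + 1" by linarith
    then show ?thesis unfolding d_def by (simp add: field_simps del: of_nat_Suc)
  qed
  have "(\<lambda>n. s + 1 / real (Suc n)) \<longlonglongrightarrow> s + 0"
    by (intro tendsto_intros LIMSEQ_Suc[OF lim_1_over_n])
  then have "d \<longlonglongrightarrow> s"
    using gt le by (intro tendsto_sandwich[of "\<lambda>_. s" d sequentially "\<lambda>n. s + 1 / real (Suc n)"])
      (auto intro!: always_eventually less_imp_le simp del: of_nat_Suc)
  then show "filterlim (\<lambda>n. (real_of_int \<lfloor>real (Suc n) * s\<rfloor> + 1) / real (Suc n)) (at_right s) sequentially"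
    using gt unfolding d_def[symmetric]
    by (simp add: filterlim_at less_imp_neq[THEN not_sym])
  show "s < (real_of_int \<lfloor>real (Suc n) * s\<rfloor> + 1) / real (Suc n)"
    using gt by (simp add: d_def)
qed

section \<open>One controlled chain and its marginal laws\<close>

locale controlled_chain = controlled_graph N V L + prob_space M
  for N :: nat and V :: "nat \<Rightarrow> nat set" and L :: "nat \<Rightarrow> (nat \<Rightarrow> real) \<Rightarrow> ereal" and M :: "'a measure" +
  fixes F :: "real \<Rightarrow> 'a measure" and lam :: "real \<Rightarrow> nat \<Rightarrow> nat \<Rightarrow> real"
    and t T :: real and i :: nat and Y :: "real \<Rightarrow> 'a \<Rightarrow> nat"
  assumes filt: "usual_conditions M F"
    and chain: "markov_chain_with_rates N V M F lam t T i Y"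
    and lam: "lam \<in> controls N V t T"
    and t: "0 \<le> t" "t \<le> T" and i: "i \<in> {1..N}"
begin

abbreviation "S \<equiv> lebesgue_on {t..T}"

definition law where "law s k = prob {\<omega>\<in>space M. Y s \<omega> = k}"

sublocale S: finite_measure S by (rule finite_measure_lebesgue_on) simp

sublocale SM: pair_sigma_finite S M ..

lemma subalg: "0 \<le> s \<Longrightarrow> subalgebra M (F s)"
  using filt by (auto simp: usual_conditions_def)

lemma measurable_Y: "s \<in> {t..T} \<Longrightarrow> Y s \<in> M \<rightarrow>\<^sub>M count_space {1..N}"
  using chain t by (intro measurable_from_subalg[OF subalg[of s]]) (auto simp: markov_chain_with_rates_def)

lemma Y_in: "s \<in> {t..T} \<Longrightarrow> \<omega> \<in> space M \<Longrightarrow> Y s \<omega> \<in> {1..N}"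
  using measurable_space[OF measurable_Y] by simp

lemma Y_event: "s \<in> {t..T} \<Longrightarrow> {\<omega>\<in>space M. Y s \<omega> = k} \<in> sets M"
proof -
  assume s: "s \<in> {t..T}"
  have "{\<omega>\<in>space M. Y s \<omega> = k} = Y s -` ({k} \<inter> {1..N}) \<inter> space M" using Y_in[OF s] by auto
  then show ?thesis using measurable_sets[OF measurable_Y[OF s], of "{k} \<inter> {1..N}"] by simp
qed

lemma law_nonneg: "0 \<le> law s k" by (simp add: law_def)

lemma law_sum: assumes s: "s \<in> {t..T}" shows "(\<Sum>k\<in>{1..N}. law s k) = 1"
proof -
  have "(\<Sum>k\<in>{1..N}. law s k) = prob (\<Union>k\<in>{1..N}. {\<omega>\<in>space M. Y s \<omega> = k})"
    unfolding law_def using Y_event[OF s]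
    by (intro finite_measure_finite_Union[symmetric]) (auto simp: disjoint_family_on_def)
  also have "(\<Union>k\<in>{1..N}. {\<omega>\<in>space M. Y s \<omega> = k}) = space M" using Y_in[OF s] by auto
  finally show ?thesis using prob_space by simp
qed

text \<open>Integrating the conditional probabilities given \<open>F t\<close>, where the chain sits
  at \<open>i\<close> almost surely, identifies the law at each time with row \<open>i\<close> of
  the transition function from \<open>t\<close>.\<close>

lemma forward_equation:
  assumes s: "s \<in> {t..T}" and j: "j \<in> {1..N}"
  shows "((\<lambda>\<tau>. \<Sum>l\<in>{1..N}. law \<tau> l * rate_matrix V (lam \<tau>) l j)
           has_integral (law s j - (if j = i then 1 else 0))) {t..s}"
proof -
  obtain P where P: "transition_function N V lam t T P"
    and cond: "\<And>s s' j. t \<le> s \<Longrightarrow> s \<le> s' \<Longrightarrow> s' \<le> T \<Longrightarrow> j\<in>{1..N} \<Longrightarrow> AE \<omega> in M.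
      real_cond_exp M (F s) (indicator {\<omega>\<in>space M. Y s' \<omega> = j}) \<omega> = P s s' (Y s \<omega>) j"
    using chain unfolding markov_chain_with_rates_def by blast
  have start: "AE \<omega> in M. Y t \<omega> = i" using chain unfolding markov_chain_with_rates_def by blast
  interpret Ft: finite_measure_subalgebra M "F t" using subalg t by unfold_locales auto
  have law: "law s' k = P t s' i k" if "s' \<in> {t..T}" "k \<in> {1..N}" for s' k
  proof -
    let ?A = "{\<omega>\<in>space M. Y s' \<omega> = k}"
    have A: "?A \<in> sets M" by (rule Y_event[OF that(1)])
    have "law s' k = (\<integral>\<omega>. indicator ?A \<omega> \<partial>M)" using A by (simp add: law_def)
    also have "\<dots> = (\<integral>\<omega>. real_cond_exp M (F t) (indicator ?A) \<omega> \<partial>M)"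
      using A by (intro Ft.real_cond_exp_int(2)[symmetric]) (simp add: emeasure_eq_measure)
    also have "\<dots> = (\<integral>\<omega>. P t s' i k \<partial>M)"
      using cond[of t s' k] start that by (intro integral_cong_AE) auto
    also have "\<dots> = P t s' i k" by (simp add: prob_space)
    finally show ?thesis .
  qed
  have "((\<lambda>\<tau>. \<Sum>l\<in>{1..N}. P t \<tau> i l * rate_matrix V (lam \<tau>) l j)
              has_integral (P t s i j - (if j = i then 1 else 0))) {t..s}"
    using P s j i unfolding transition_function_def by auto
  then show ?thesis unfolding law[OF s j]
    by (rule has_integral_eq[rotated]) (use s in \<open>auto intro!: sum.cong simp: law\<close>)
qed

lemma law_initial:
  assumes "j \<in> {1..N}" shows "law t j = (if j = i then 1 else 0)"
proof -
  have "((\<lambda>\<tau>. \<Sum>l\<in>{1..N}. law \<tau> l * rate_matrix V (lam \<tau>) l j)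
           has_integral (law t j - (if j = i then 1 else 0))) {t}"
    using forward_equation[of t j] t assms by simp
  from has_integral_unique[OF this has_integral_refl(2)] show ?thesis by simp
qed

lemma law_continuous:
  assumes j: "j \<in> {1..N}" shows "continuous_on {t..T} (\<lambda>s. law s j)"
proof -
  let ?q = "\<lambda>\<tau>. \<Sum>l\<in>{1..N}. law \<tau> l * rate_matrix V (lam \<tau>) l j"
  have "continuous_on {t..T} (\<lambda>s. integral {t..s} ?q + (if j = i then 1 else 0))"
    using forward_equation[of T j] j t
    by (intro continuous_intros indefinite_integral_continuous_1) (auto simp: has_integral_integrable)
  moreover have "integral {t..s} ?q + (if j = i then 1 else 0) = law s j" if "s \<in> {t..T}" for s
    using integral_unique[OF forward_equation[OF that j]] by simp
  ultimately show ?thesis by (rule continuous_on_eq)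
qed

lemma rate_integrable:
  "k \<in> {1..N} \<Longrightarrow> j \<in> V k \<Longrightarrow> (\<lambda>s. lam s k j) absolutely_integrable_on {t..T}"
  using lam by (simp add: controls_def)

lemma rate_nonneg: "k \<in> {1..N} \<Longrightarrow> j \<in> V k \<Longrightarrow> s \<in> {t..T} \<Longrightarrow> 0 \<le> lam s k j"
  using lam by (simp add: controls_def)

lemma rate_tuple: "k \<in> {1..N} \<Longrightarrow> s \<in> {t..T} \<Longrightarrow> restrict (lam s k) (V k) \<in> nonneg_tuples (V k)"
  using rate_nonneg by (auto simp: nonneg_tuples_def)

lemma rate_cost_measurable:
  assumes k: "k \<in> {1..N}" shows "(\<lambda>s. L k (restrict (lam s k) (V k))) \<in> borel_measurable S"
proof (rule borel_measurable_lower_semicontinuous_compose[where f = "L k" and S = "nonneg_tuples (V k)"])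
  show "lower_semicontinuous_on (nonneg_tuples (V k)) (L k)"
    using cost k by (auto simp: admissible_cost_def)
  show "(\<lambda>s. restrict (lam s k) (V k)) \<in> borel_measurable S"
  proof (rule measurable_coordinatewise_then_product)
    fix j show "(\<lambda>s. restrict (lam s k) (V k) j) \<in> borel_measurable S"
      using absolutely_integrable_imp_borel_measurable[OF rate_integrable[OF k]]
      by (cases "j \<in> V k") auto
  qed
  show "\<And>s. s \<in> space S \<Longrightarrow> restrict (lam s k) (V k) \<in> nonneg_tuples (V k)"
    using rate_tuple[OF k] by simp
qed

text \<open>Joint measurability of the chain: by right-continuity, \<open>Y s\<close> is the limit of the values of
  the chain at the next point of finer and finer grids.\<close>

lemma state_indicator_measurable:
  "(\<lambda>x. indicator {x. Y (fst x) (snd x) = k} x :: real) \<in> borel_measurable (S \<Otimes>\<^sub>M M)"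
proof -
  \<comment> \<open>Grid times are clamped to \<open>{t..T}\<close>, where the chain is known to be
    measurable. They are indexed by integers, so the time-dependent choice of a grid point runs
    through a countable set.\<close>
  define c where "c n m = max t (min T ((real_of_int m + 1) / real (Suc n)))" for n m
  define f where "f n x = (indicator {\<omega>. Y (c n \<lfloor>real (Suc n) * fst x\<rfloor>) \<omega> = k} (snd x) :: real)" for n x
  have c: "c n m \<in> {t..T}" for n m using t by (auto simp: c_def)
  have "f n \<in> borel_measurable (S \<Otimes>\<^sub>M M)" for n
    unfolding f_def
  proof (rule measurable_compose_countable[where f = "\<lambda>m x. indicator {\<omega>. Y (c n m) \<omega> = k} (snd x)"])
    fix m :: int
    have "(indicator {\<omega>. Y (c n m) \<omega> = k} :: 'a \<Rightarrow> real) \<in> borel_measurable M"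
      using Y_event[OF c] by (simp add: borel_measurable_indicator_iff Collect_conj_eq Int_commute)
    then show "(\<lambda>x. indicator {\<omega>. Y (c n m) \<omega> = k} (snd x) :: real) \<in> borel_measurable (S \<Otimes>\<^sub>M M)"
      by (rule measurable_compose[OF measurable_snd])
  next
    have [measurable]: "(\<lambda>x. x) \<in> borel_measurable S"
      using id_borel_measurable_lebesgue_on by (simp add: id_def)
    show "(\<lambda>x. \<lfloor>real (Suc n) * fst x\<rfloor>) \<in> (S \<Otimes>\<^sub>M M) \<rightarrow>\<^sub>M count_space UNIV" by measurable
  qed
  moreover have "(\<lambda>n. f n x) \<longlonglongrightarrow> indicator {x. Y (fst x) (snd x) = k} x" if x: "x \<in> space (S \<Otimes>\<^sub>M M)" for x
  proof -
    obtain s \<omega> where x': "x = (s, \<omega>)" "s \<in> {t..T}" "\<omega> \<in> space M" using x by (cases x) (auto simp: space_pair_measure)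
    define d where "d n = (real_of_int \<lfloor>real (Suc n) * s\<rfloor> + 1) / real (Suc n)" for n
    have ds: "s < d n" for n unfolding d_def by (rule right_grid_tendsto(2))
    have fd: "f n x = indicator {\<omega>. Y (max t (min T (d n))) \<omega> = k} \<omega>" for n
      by (simp add: f_def c_def d_def x')
    have "\<forall>\<^sub>F n in sequentially. Y (max t (min T (d n))) \<omega> = Y s \<omega>"
    proof (cases "s < T")
      case True
      then have "((\<lambda>s. Y s \<omega>) \<longlongrightarrow> Y s \<omega>) (at_right s)"
        using chain x' unfolding markov_chain_with_rates_def continuous_within by auto
      \<comment> \<open>The state space is discrete, so a right-continuous path is constant on a
        short interval to the right.\<close>
      then have "\<forall>\<^sub>F r in at_right s. Y r \<omega> = Y s \<omega>" by (simp add: tendsto_discrete)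
      then have "\<forall>\<^sub>F r in at_right s. Y (max t (min T r)) \<omega> = Y s \<omega>"
        using eventually_at_right_less[of s] eventually_at_right_real[OF True]
        by eventually_elim (use x' in auto)
      moreover have "filterlim d (at_right s) sequentially"
        using right_grid_tendsto(1)[of s] unfolding d_def[abs_def] .
      ultimately show ?thesis by (rule eventually_compose_filterlim)
    next
      case False
      then have "s = T" using x' by simp
      then show ?thesis using ds t by (auto simp: less_imp_le min_absorb1)
    qed
    then have "\<forall>\<^sub>F n in sequentially. f n x = indicator {x. Y (fst x) (snd x) = k} x"
      unfolding fd by eventually_elim (simp add: x' indicator_def)
    then show ?thesis by (rule tendsto_eventually)
  qed
  ultimately show ?thesis by (rule borel_measurable_LIMSEQ_real[rotated])
qed

end

text \<open>Rows of the rate matrix sum to zero: the diagonal entry supplies the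
  \<open>- w l\<close> in every difference.\<close>

lemma (in controlled_graph) sum_rate_matrix:
  assumes l: "l \<in> {1..N}"
  shows "(\<Sum>k\<in>{1..N}. rate_matrix V q l k * w k) = (\<Sum>j\<in>V l. q l j * (w j - w l))"
proof -
  have "(\<Sum>k\<in>{1..N}. rate_matrix V q l k * w k) =
      rate_matrix V q l l * w l + (\<Sum>k\<in>{1..N} - {l}. rate_matrix V q l k * w k)"
    using l by (intro sum.remove) auto
  also have "(\<Sum>k\<in>{1..N} - {l}. rate_matrix V q l k * w k) = (\<Sum>k\<in>V l. q l k * w k)"
    using V_subset[OF l] by (intro sum.mono_neutral_cong_right) (auto simp: rate_matrix_def)
  finally show ?thesis
    by (simp add: rate_matrix_def sum_subtractf right_diff_distrib sum_distrib_right)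
qed

section \<open>Payoffs and Dynkin's formula in terms of the laws\<close>

context controlled_chain
begin

abbreviation disc :: "real \<Rightarrow> real \<Rightarrow> real" where "disc r s \<equiv> exp (- r * (s - t))"

text \<open>Has the shape of \<open>expected_payoff\<close> with the process abstracted to
  \<open>Y\<close>, so that the two agree by unfolding.\<close>

definition payoff :: "real \<Rightarrow> (nat \<Rightarrow> real) \<Rightarrow> ereal" where
  "payoff r g = ereal_integral M (\<lambda>\<omega>. - ereal_integral S
           (\<lambda>s. ereal (disc r s) * L (Y s \<omega>) (restrict (lam s (Y s \<omega>)) (V (Y s \<omega>))))
       + ereal (disc r T * g (Y T \<omega>)))"

lemma disc_integrable: "integrable S (disc r)"
  unfolding integrable_lebesgue_on_iff
  by (intro absolutely_integrable_continuous_real continuous_intros)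

text \<open>After subtracting \<open>C\<close> the cost is nonnegative, so expectation and time
  integral can be exchanged even when the expected cost is infinite. Conditional on the time, the
  expectation is then a sum over nodes weighted by the law.\<close>

lemma payoff_eq:
  assumes C: "\<And>k x. k \<in> {1..N} \<Longrightarrow> x \<in> nonneg_tuples (V k) \<Longrightarrow> ereal C \<le> L k x"
  shows "payoff r g = - (ereal (C * (\<integral>s. disc r s \<partial>S) - disc r T * (\<Sum>k\<in>{1..N}. law T k * g k)) +
     enn2ereal (\<integral>\<^sup>+s. (\<Sum>k\<in>{1..N}. ennreal (disc r s * law s k) *
        e2ennreal (L k (restrict (lam s k) (V k)) - ereal C)) \<partial>S))"
proof -
  define c where "c k s = e2ennreal (L k (restrict (lam s k) (V k)) - ereal C)" for k s
  define ind where "ind k s \<omega> = (indicator {x. Y (fst x) (snd x) = k} (s, \<omega>) :: real)" for k s \<omega>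
  \<comment> \<open>The random index \<open>Y s \<omega>\<close> is spread over the finitely many
    nodes by indicators, which makes the cost jointly measurable.\<close>
  define h where "h s \<omega> = (\<Sum>k\<in>{1..N}. ennreal (ind k s \<omega>) * (ennreal (disc r s) * c k s))" for s \<omega>
  have [measurable]: "c k \<in> borel_measurable S" if "k \<in> {1..N}" for k
    using rate_cost_measurable[OF that] unfolding c_def by measurable
  have [measurable]: "disc r \<in> borel_measurable S" using disc_integrable by auto
  have ind_joint[measurable]: "case_prod (ind k) \<in> borel_measurable (S \<Otimes>\<^sub>M M)" for k
    using state_indicator_measurable[of k] by (simp add: ind_def case_prod_beta')
  have h_joint[measurable]: "case_prod h \<in> borel_measurable (S \<Otimes>\<^sub>M M)"
    unfolding h_def case_prod_beta'
  proof (intro borel_measurable_sum borel_measurable_times_ennreal)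
    fix k assume k: "k \<in> {1..N}"
    show "(\<lambda>x. ennreal (ind k (fst x) (snd x))) \<in> borel_measurable (S \<Otimes>\<^sub>M M)"
      using ind_joint[of k] by (simp add: case_prod_beta')
    show "(\<lambda>x. ennreal (disc r (fst x))) \<in> borel_measurable (S \<Otimes>\<^sub>M M)"
      by (rule measurable_compose[OF measurable_fst]) measurable
    show "(\<lambda>x. c k (fst x)) \<in> borel_measurable (S \<Otimes>\<^sub>M M)"
      by (rule measurable_compose[OF measurable_fst]) (use k in measurable)
  qed
  have h_eq: "h s \<omega> = ennreal (disc r s) * c (Y s \<omega>) s" if "s \<in> {t..T}" "\<omega> \<in> space M" for s \<omega>
  proof -
    have "h s \<omega> = (\<Sum>k\<in>{1..N}. if k = Y s \<omega> then ennreal (disc r s) * c k s else 0)"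
      unfolding h_def by (intro sum.cong) (auto simp: ind_def indicator_def)
    also have "\<dots> = ennreal (disc r s) * c (Y s \<omega>) s" using Y_in[OF that] by simp
    finally show ?thesis .
  qed
  have cost_eq: "ereal (disc r s) * L (Y s \<omega>) (restrict (lam s (Y s \<omega>)) (V (Y s \<omega>))) =
      ereal (disc r s * C) + enn2ereal (h s \<omega>)" if s: "s \<in> {t..T}" and \<omega>: "\<omega> \<in> space M" for s \<omega>
  proof -
    note C[OF Y_in[OF s \<omega>] rate_tuple[OF Y_in[OF s \<omega>] s]]
    then show ?thesis unfolding h_eq[OF s \<omega>] c_def
      by (cases "L (Y s \<omega>) (restrict (lam s (Y s \<omega>)) (V (Y s \<omega>)))")
        (auto simp: ennreal_mult_top algebra_simps simp flip: ennreal_mult)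
  qed
  have hs: "(\<lambda>s. h s \<omega>) \<in> borel_measurable S" if "\<omega> \<in> space M" for \<omega>
    using measurable_compose[OF measurable_Pair2'[OF that] h_joint] by simp
  have inner: "ereal_integral S (\<lambda>s. ereal (disc r s) * L (Y s \<omega>) (restrict (lam s (Y s \<omega>)) (V (Y s \<omega>))))
     = ereal (C * (\<integral>s. disc r s \<partial>S)) + enn2ereal (\<integral>\<^sup>+s. h s \<omega> \<partial>S)" if \<omega>: "\<omega> \<in> space M" for \<omega>
  proof -
    have "integrable S (\<lambda>s. disc r s * C)" using disc_integrable by simp
    from ereal_integral_real_plus_ennreal(1)[OF this hs[OF \<omega>] cost_eq[OF _ \<omega>]]
    show ?thesis by (simp add: mult.commute[of _ C])
  qed
  have YT: "T \<in> {t..T}" using t by simp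
  have gT: "has_bochner_integral M (\<lambda>\<omega>. g (Y T \<omega>)) (\<Sum>k\<in>{1..N}. law T k * g k)"
  proof -
    have "has_bochner_integral M (\<lambda>\<omega>. \<Sum>k\<in>{1..N}. indicator {\<omega>\<in>space M. Y T \<omega> = k} \<omega> * g k)
        (\<Sum>k\<in>{1..N}. law T k * g k)"
      unfolding law_def using Y_event[OF YT]
      by (intro has_bochner_integral_sum has_bochner_integral_mult_left has_bochner_integral_real_indicator)
        (auto simp: emeasure_eq_measure)
    moreover have "(\<Sum>k\<in>{1..N}. indicator {\<omega>\<in>space M. Y T \<omega> = k} \<omega> * g k) = g (Y T \<omega>)" if "\<omega> \<in> space M" for \<omega>
    proof -
      have "(\<Sum>k\<in>{1..N}. indicator {\<omega>\<in>space M. Y T \<omega> = k} \<omega> * g k) = (\<Sum>k\<in>{1..N}. if k = Y T \<omega> then g k else 0)"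
        using that by (intro sum.cong) (auto simp: indicator_def)
      then show ?thesis using Y_in[OF YT that] by simp
    qed
    ultimately show ?thesis by (simp cong: has_bochner_integral_cong)
  qed
  have "payoff r g = - (ereal (\<integral>\<omega>. C * (\<integral>s. disc r s \<partial>S) - disc r T * g (Y T \<omega>) \<partial>M) +
      enn2ereal (\<integral>\<^sup>+\<omega>. (\<integral>\<^sup>+s. h s \<omega> \<partial>S) \<partial>M))"
    unfolding payoff_def
  proof (rule ereal_integral_uminus_real_plus_ennreal)
    show "integrable M (\<lambda>\<omega>. C * (\<integral>s. disc r s \<partial>S) - disc r T * g (Y T \<omega>))"
      using gT by (auto simp: has_bochner_integral_iff)
    show "(\<lambda>\<omega>. \<integral>\<^sup>+s. h s \<omega> \<partial>S) \<in> borel_measurable M" by measurable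
    fix \<omega> assume "\<omega> \<in> space M"
    then show "- ereal_integral S (\<lambda>s. ereal (disc r s) * L (Y s \<omega>) (restrict (lam s (Y s \<omega>)) (V (Y s \<omega>))))
       + ereal (disc r T * g (Y T \<omega>)) =
       - (ereal (C * (\<integral>s. disc r s \<partial>S) - disc r T * g (Y T \<omega>)) + enn2ereal (\<integral>\<^sup>+s. h s \<omega> \<partial>S))"
      unfolding inner[OF \<open>\<omega> \<in> space M\<close>] by (cases "\<integral>\<^sup>+s. h s \<omega> \<partial>S") auto
  qed
  also have "(\<integral>\<omega>. C * (\<integral>s. disc r s \<partial>S) - disc r T * g (Y T \<omega>) \<partial>M) =
      C * (\<integral>s. disc r s \<partial>S) - disc r T * (\<Sum>k\<in>{1..N}. law T k * g k)"
    using gT by (simp add: has_bochner_integral_iff prob_space)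
  also have "(\<integral>\<^sup>+\<omega>. (\<integral>\<^sup>+s. h s \<omega> \<partial>S) \<partial>M) = (\<integral>\<^sup>+s. (\<integral>\<^sup>+\<omega>. h s \<omega> \<partial>M) \<partial>S)"
    by (rule SM.Fubini'[OF h_joint])
  also have "\<dots> = (\<integral>\<^sup>+s. (\<Sum>k\<in>{1..N}. ennreal (disc r s * law s k) * c k s) \<partial>S)"
  proof (rule nn_integral_cong)
    fix s assume "s \<in> space S"
    then have s: "s \<in> {t..T}" by simp
    have "(\<integral>\<^sup>+\<omega>. h s \<omega> \<partial>M) = (\<integral>\<^sup>+\<omega>. (\<Sum>k\<in>{1..N}. (ennreal (disc r s) * c k s) * indicator {\<omega>\<in>space M. Y s \<omega> = k} \<omega>) \<partial>M)"
      unfolding h_def by (intro nn_integral_cong sum.cong) (auto simp: ind_def indicator_def)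
    also have "\<dots> = (\<Sum>k\<in>{1..N}. (\<integral>\<^sup>+\<omega>. (ennreal (disc r s) * c k s) * indicator {\<omega>\<in>space M. Y s \<omega> = k} \<omega> \<partial>M))"
      using Y_event[OF s]
      by (intro nn_integral_sum borel_measurable_times_ennreal borel_measurable_indicator) auto
    also have "\<dots> = (\<Sum>k\<in>{1..N}. ennreal (disc r s * law s k) * c k s)"
    proof (rule sum.cong[OF refl])
      fix k
      have "(\<integral>\<^sup>+\<omega>. (ennreal (disc r s) * c k s) * indicator {\<omega>\<in>space M. Y s \<omega> = k} \<omega> \<partial>M)
          = (ennreal (disc r s) * c k s) * ennreal (law s k)"
        using Y_event[OF s, of k] by (subst nn_integral_cmult_indicator) (simp_all add: emeasure_eq_measure law_def)
      also have "\<dots> = ennreal (disc r s * law s k) * c k s"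
        by (simp add: ennreal_mult law_nonneg mult_ac)
      finally show "(\<integral>\<^sup>+\<omega>. (ennreal (disc r s) * c k s) * indicator {\<omega>\<in>space M. Y s \<omega> = k} \<omega> \<partial>M)
          = ennreal (disc r s * law s k) * c k s" .
    qed
    finally show "(\<integral>\<^sup>+\<omega>. h s \<omega> \<partial>M) = (\<Sum>k\<in>{1..N}. ennreal (disc r s * law s k) * c k s)" .
  qed
  finally show ?thesis unfolding c_def .
qed

lemma rate_matrix_integrable:
  assumes "l \<in> {1..N}" "j \<in> {1..N}"
  shows "(\<lambda>s. rate_matrix V (lam s) l j) absolutely_integrable_on {t..T}"
proof -
  have "integrable S (\<lambda>s. - (\<Sum>k\<in>V l. lam s l k))"
    using rate_integrable[OF assms(1)]
    by (intro integrable_minus Bochner_Integration.integrable_sum) (simp add: integrable_lebesgue_on_iff)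
  moreover have "integrable S (\<lambda>s. lam s l j)" if "j \<in> V l"
    using rate_integrable[OF assms(1) that] by (simp add: integrable_lebesgue_on_iff)
  ultimately show ?thesis
    unfolding rate_matrix_def integrable_lebesgue_on_iff[symmetric] by (cases "j = l"; cases "j \<in> V l") auto
qed

text \<open>Dynkin's formula for \<open>disc r s * w (Y s) s\<close>.\<close>

lemma Dynkin_formula:
  fixes w w' :: "nat \<Rightarrow> real \<Rightarrow> real" and r :: real
  assumes w: "\<And>k s. k \<in> {1..N} \<Longrightarrow> s \<in> {t..T} \<Longrightarrow> (w k has_real_derivative w' k s) (at s within {t..T})"
    and w': "\<And>k. k \<in> {1..N} \<Longrightarrow> continuous_on {t..T} (w' k)"
  defines "h \<equiv> \<lambda>s. \<Sum>k\<in>{1..N}. disc r s * law s k *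
       ((\<Sum>j\<in>V k. lam s k j * (w j s - w k s)) + w' k s - r * w k s)"
  shows "integrable S h" "(\<integral>s. h s \<partial>S) = disc r T * (\<Sum>k\<in>{1..N}. law T k * w k T) - w i t"
proof -
  \<comment> \<open>The discount goes into the smooth factor \<open>W\<close>; \<open>q k\<close> is
    the merely integrable density of the law given by the forward equation.\<close>
  define q where "q k s = (\<Sum>l\<in>{1..N}. law s l * rate_matrix V (lam s) l k)" for k s
  define W where "W k s = disc r s * w k s" for k s
  define W' where "W' k s = disc r s * (w' k s - r * w k s)" for k s
  define z where "z k s = q k s * W k s + law s k * W' k s" for k s
  have wc: "continuous_on {t..T} (w k)" if "k \<in> {1..N}" for k
    using w[OF that] by (intro DERIV_continuous_on) auto
  have q: "q k absolutely_integrable_on {t..T}" if k: "k \<in> {1..N}" for k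
    unfolding q_def
  proof (intro absolutely_integrable_sum)
    fix l assume l: "l \<in> {1..N}"
    show "(\<lambda>s. law s l * rate_matrix V (lam s) l k) absolutely_integrable_on {t..T}"
    proof (rule absolutely_integrable_bounded_measurable_product_real[OF _ _ _ rate_matrix_integrable[OF l k]])
      show "(\<lambda>s. law s l) \<in> borel_measurable (lebesgue_on {t..T})"
        by (rule continuous_imp_measurable_on_sets_lebesgue[OF law_continuous[OF l]]) simp
      show "bounded ((\<lambda>s. law s l) ` {t..T})"
        by (intro compact_imp_bounded compact_continuous_image law_continuous[OF l]) simp
    qed simp
  qed simp
  have z: "integrable S (z k)" "(\<integral>s. z k s \<partial>S) = law T k * W k T - law t k * W k t" if k: "k \<in> {1..N}" for k
  proof -
    have p: "(q k has_integral (law s k - law t k)) {t..s}" if "s \<in> {t..T}" for s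
      using forward_equation[OF that k] law_initial[OF k] unfolding q_def by simp
    have dW: "(W k has_real_derivative W' k s) (at s within {t..T})" if "s \<in> {t..T}" for s
      unfolding W_def W'_def using w[OF k that] by (auto intro!: derivative_eq_intros simp: algebra_simps)
    have cW: "continuous_on {t..T} (W' k)"
      unfolding W'_def using w'[OF k] wc[OF k] by (intro continuous_intros)
    show "integrable S (z k)" "(\<integral>s. z k s \<partial>S) = law T k * W k T - law t k * W k t"
      unfolding z_def by (rule integral_product_rule[OF t(2) q[OF k] p dW cW]; assumption)+
  qed
  \<comment> \<open>The flow into each node is regrouped by the node it leaves, so that the rate
    matrix acts on \<open>w\<close> instead of on the law.\<close>
  have h: "h s = (\<Sum>k\<in>{1..N}. z k s)" for s
  proof -
    have "(\<Sum>k\<in>{1..N}. q k s * W k s) = (\<Sum>k\<in>{1..N}. \<Sum>l\<in>{1..N}. disc r s * (law s l * (rate_matrix V (lam s) l k * w k s)))"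
      unfolding q_def W_def by (simp add: sum_distrib_left sum_distrib_right mult_ac)
    also have "\<dots> = (\<Sum>l\<in>{1..N}. \<Sum>k\<in>{1..N}. disc r s * (law s l * (rate_matrix V (lam s) l k * w k s)))"
      by (rule sum.swap)
    also have "\<dots> = (\<Sum>l\<in>{1..N}. disc r s * law s l * (\<Sum>j\<in>V l. lam s l j * (w j s - w l s)))"
    proof (rule sum.cong[OF refl])
      fix l assume l: "l \<in> {1..N}"
      show "(\<Sum>k\<in>{1..N}. disc r s * (law s l * (rate_matrix V (lam s) l k * w k s))) =
          disc r s * law s l * (\<Sum>j\<in>V l. lam s l j * (w j s - w l s))"
        using sum_rate_matrix[OF l, of "lam s" "\<lambda>k. w k s"]
        by (simp only: mult.assoc flip: sum_distrib_left)
    qed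
    finally have "(\<Sum>k\<in>{1..N}. z k s) =
        (\<Sum>l\<in>{1..N}. disc r s * law s l * (\<Sum>j\<in>V l. lam s l j * (w j s - w l s))) +
        (\<Sum>k\<in>{1..N}. law s k * W' k s)"
      unfolding z_def sum.distrib by simp
    also have "\<dots> = h s"
      unfolding h_def W'_def sum.distrib[symmetric] by (intro sum.cong refl) (simp add: algebra_simps)
    finally show ?thesis by simp
  qed
  show "integrable S h" unfolding h[abs_def] using z(1) by (intro Bochner_Integration.integrable_sum)
  have "(\<integral>s. h s \<partial>S) = (\<Sum>k\<in>{1..N}. law T k * W k T - law t k * W k t)"
    unfolding h using z by (subst Bochner_Integration.integral_sum) auto
  also have "\<dots> = (\<Sum>k\<in>{1..N}. law T k * W k T) - (\<Sum>k\<in>{1..N}. law t k * W k t)" by (rule sum_subtractf)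
  also have "(\<Sum>k\<in>{1..N}. law t k * W k t) = (\<Sum>k\<in>{1..N}. if k = i then W k t else 0)"
    by (intro sum.cong) (auto simp: law_initial)
  also have "\<dots> = w i t" using i by (simp add: W_def)
  also have "(\<Sum>k\<in>{1..N}. law T k * W k T) = disc r T * (\<Sum>k\<in>{1..N}. law T k * w k T)"
    unfolding W_def by (simp add: sum_distrib_left mult_ac)
  finally show "(\<integral>s. h s \<partial>S) = disc r T * (\<Sum>k\<in>{1..N}. law T k * w k T) - w i t" .
qed

end

section \<open>Verification\<close>

context controlled_chain
begin

text \<open>\<open>a k s\<close> is the cost at which the rates in force would be exactly optimal,
  and by the Hamilton-Jacobi equation it is the drift in Dynkin's formula. The shift by
  \<open>C\<close> prepares the comparison with the shifted cost in \<open>payoff_eq\<close>; it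
  integrates explicitly because the laws have total mass 1.\<close>

lemma integral_reward_minus_Hamiltonian:
  fixes w w' :: "nat \<Rightarrow> real \<Rightarrow> real" and r C :: real
  assumes w: "\<And>k s. k \<in> {1..N} \<Longrightarrow> s \<in> {t..T} \<Longrightarrow> (w k has_real_derivative w' k s) (at s within {t..T})"
    and w': "\<And>k. k \<in> {1..N} \<Longrightarrow> continuous_on {t..T} (w' k)"
    and HJ: "\<And>k s. k \<in> {1..N} \<Longrightarrow> s \<in> {t..T} \<Longrightarrow>
        r * w k s - w' k s = Hamiltonian V L k (\<lambda>j. w j s - w k s)"
  defines "a \<equiv> \<lambda>k s. (\<Sum>j\<in>V k. lam s k j * (w j s - w k s)) - Hamiltonian V L k (\<lambda>j. w j s - w k s)"
  shows "integrable S (\<lambda>s. \<Sum>k\<in>{1..N}. disc r s * law s k * (a k s - C))"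
    "(\<integral>s. (\<Sum>k\<in>{1..N}. disc r s * law s k * (a k s - C)) \<partial>S) =
      disc r T * (\<Sum>k\<in>{1..N}. law T k * w k T) - w i t - C * (\<integral>s. disc r s \<partial>S)"
proof -
  define h where "h s = (\<Sum>k\<in>{1..N}. disc r s * law s k *
       ((\<Sum>j\<in>V k. lam s k j * (w j s - w k s)) + w' k s - r * w k s))" for s
  have h: "integrable S h" "(\<integral>s. h s \<partial>S) = disc r T * (\<Sum>k\<in>{1..N}. law T k * w k T) - w i t"
    unfolding h_def by (rule Dynkin_formula[OF w w']; assumption)+
  have eq: "(\<Sum>k\<in>{1..N}. disc r s * law s k * (a k s - C)) = h s - C * disc r s" if s: "s \<in> {t..T}" for s
  proof -
    have "(\<Sum>k\<in>{1..N}. disc r s * law s k * (a k s - C)) =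
        (\<Sum>k\<in>{1..N}. disc r s * law s k * ((\<Sum>j\<in>V k. lam s k j * (w j s - w k s)) + w' k s - r * w k s)
          - C * disc r s * law s k)"
    proof (rule sum.cong[OF refl])
      fix k assume "k \<in> {1..N}"
      from HJ[OF this s] have "a k s = (\<Sum>j\<in>V k. lam s k j * (w j s - w k s)) + w' k s - r * w k s"
        unfolding a_def by linarith
      then show "disc r s * law s k * (a k s - C) =
        disc r s * law s k * ((\<Sum>j\<in>V k. lam s k j * (w j s - w k s)) + w' k s - r * w k s)
          - C * disc r s * law s k" by algebra
    qed
    also have "\<dots> = h s - C * disc r s * (\<Sum>k\<in>{1..N}. law s k)"
      unfolding h_def sum_subtractf by (simp add: sum_distrib_left)
    finally show ?thesis unfolding law_sum[OF s] by simp
  qed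
  have "integrable S (\<lambda>s. h s - C * disc r s)" using h disc_integrable by simp
  then show "integrable S (\<lambda>s. \<Sum>k\<in>{1..N}. disc r s * law s k * (a k s - C))"
    by (rule Bochner_Integration.integrable_cong[OF refl, THEN iffD1, rotated]) (simp only: space_lebesgue_on eq)
  have "(\<integral>s. (\<Sum>k\<in>{1..N}. disc r s * law s k * (a k s - C)) \<partial>S) = (\<integral>s. h s - C * disc r s \<partial>S)"
    by (intro Bochner_Integration.integral_cong refl) (simp only: space_lebesgue_on eq)
  then show "(\<integral>s. (\<Sum>k\<in>{1..N}. disc r s * law s k * (a k s - C)) \<partial>S) =
      disc r T * (\<Sum>k\<in>{1..N}. law T k * w k T) - w i t - C * (\<integral>s. disc r s \<partial>S)"
    using h disc_integrable by simp
qed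

lemma law_average:
  assumes "\<And>k. k \<in> {1..N} \<Longrightarrow> f k \<le> g k + D" and "s \<in> {t..T}"
  shows "(\<Sum>k\<in>{1..N}. law s k * f k) \<le> (\<Sum>k\<in>{1..N}. law s k * g k) + D"
proof -
  have "(\<Sum>k\<in>{1..N}. law s k * f k) \<le> (\<Sum>k\<in>{1..N}. law s k * g k + law s k * D)"
    using assms by (intro sum_mono) (simp add: law_nonneg mult_left_mono flip: distrib_left)
  then show ?thesis by (simp only: sum.distrib law_sum[OF assms(2)] flip: sum_distrib_right)
qed

text \<open>The true cost is never below the break-even cost \<open>a\<close>, by definition of the
  Hamiltonian. \<open>D\<close> allows for a terminal payoff other than the terminal value of
  \<open>w\<close>.\<close>

lemma payoff_le:
  fixes w w' :: "nat \<Rightarrow> real \<Rightarrow> real" and r :: real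
  assumes w: "\<And>k s. k \<in> {1..N} \<Longrightarrow> s \<in> {t..T} \<Longrightarrow> (w k has_real_derivative w' k s) (at s within {t..T})"
    and w': "\<And>k. k \<in> {1..N} \<Longrightarrow> continuous_on {t..T} (w' k)"
    and HJ: "\<And>k s. k \<in> {1..N} \<Longrightarrow> s \<in> {t..T} \<Longrightarrow>
        r * w k s - w' k s = Hamiltonian V L k (\<lambda>j. w j s - w k s)"
    and g: "\<And>k. k \<in> {1..N} \<Longrightarrow> g k \<le> w k T + D"
  shows "payoff r g \<le> ereal (w i t + disc r T * D)"
proof -
  obtain C where C: "\<And>i x. i \<in> {1..N} \<Longrightarrow> x \<in> nonneg_tuples (V i) \<Longrightarrow> ereal C \<le> L i x"
    using cost_bounded_below by blast
  define a where "a k s = (\<Sum>j\<in>V k. lam s k j * (w j s - w k s)) - Hamiltonian V L k (\<lambda>j. w j s - w k s)" for k s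
  define f where "f s = (\<Sum>k\<in>{1..N}. disc r s * law s k * (a k s - C))" for s
  define Z where "Z = (\<integral>\<^sup>+s. (\<Sum>k\<in>{1..N}. ennreal (disc r s * law s k) *
        e2ennreal (L k (restrict (lam s k) (V k)) - ereal C)) \<partial>S)"
  have f: "integrable S f" "(\<integral>s. f s \<partial>S) =
      disc r T * (\<Sum>k\<in>{1..N}. law T k * w k T) - w i t - C * (\<integral>s. disc r s \<partial>S)"
    unfolding f_def a_def by (rule integral_reward_minus_Hamiltonian[OF w w' HJ]; assumption)+
  have "ennreal (\<integral>s. f s \<partial>S) \<le> (\<integral>\<^sup>+s. ennreal (f s) \<partial>S)"
    by (rule ennreal_integral_le_nn_integral[OF f(1)])
  also have "\<dots> \<le> Z"
    unfolding Z_def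
  proof (rule nn_integral_mono)
    fix s assume "s \<in> space S"
    then have s: "s \<in> {t..T}" by simp
    have term_le: "ennreal (disc r s * law s k * (a k s - C)) \<le>
        ennreal (disc r s * law s k) * e2ennreal (L k (restrict (lam s k) (V k)) - ereal C)" if k: "k \<in> {1..N}" for k
    proof -
      have "(\<Sum>j\<in>V k. restrict (lam s k) (V k) j * (w j s - w k s)) = (\<Sum>j\<in>V k. lam s k j * (w j s - w k s))"
        by (intro sum.cong) auto
      then have "ereal (a k s) \<le> L k (restrict (lam s k) (V k))"
        using pre_Hamiltonian_le[OF k rate_tuple[OF k s], of "\<lambda>j. w j s - w k s"]
        unfolding pre_Hamiltonian_def a_def by (cases "L k (restrict (lam s k) (V k))") auto
      then have "ereal (a k s - C) \<le> L k (restrict (lam s k) (V k)) - ereal C"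
        by (cases "L k (restrict (lam s k) (V k))") auto
      then have "ennreal (a k s - C) \<le> e2ennreal (L k (restrict (lam s k) (V k)) - ereal C)"
        using e2ennreal_mono by fastforce
      then show ?thesis by (simp add: ennreal_mult' law_nonneg mult_left_mono)
    qed
    \<comment> \<open>\<open>ennreal\<close> sends negative reals to 0 and is additive only on
      nonnegative ones, hence the detour through positive parts.\<close>
    have "f s \<le> (\<Sum>k\<in>{1..N}. max 0 (disc r s * law s k * (a k s - C)))"
      unfolding f_def by (intro sum_mono) simp
    then have "ennreal (f s) \<le> ennreal (\<Sum>k\<in>{1..N}. max 0 (disc r s * law s k * (a k s - C)))"
      by (rule ennreal_leI)
    also have "\<dots> = (\<Sum>k\<in>{1..N}. ennreal (max 0 (disc r s * law s k * (a k s - C))))"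
      by (rule sum_ennreal[symmetric]) simp
    also have "\<dots> = (\<Sum>k\<in>{1..N}. ennreal (disc r s * law s k * (a k s - C)))"
      by (intro sum.cong refl) (auto simp: max_def ennreal_neg)
    also have "\<dots> \<le> (\<Sum>k\<in>{1..N}. ennreal (disc r s * law s k) * e2ennreal (L k (restrict (lam s k) (V k)) - ereal C))"
      by (intro sum_mono term_le)
    finally show "ennreal (f s) \<le> (\<Sum>k\<in>{1..N}. ennreal (disc r s * law s k) * e2ennreal (L k (restrict (lam s k) (V k)) - ereal C))" .
  qed
  finally have Z: "ennreal (\<integral>s. f s \<partial>S) \<le> Z" .
  have pe: "payoff r g = - (ereal (C * (\<integral>s. disc r s \<partial>S) - disc r T * (\<Sum>k\<in>{1..N}. law T k * g k)) + enn2ereal Z)"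
    unfolding Z_def by (rule payoff_eq[OF C])
  have g': "disc r T * (\<Sum>k\<in>{1..N}. law T k * g k) \<le> disc r T * ((\<Sum>k\<in>{1..N}. law T k * w k T) + D)"
    using g t by (intro mult_left_mono law_average) auto
  show ?thesis
  \<comment> \<open>With infinite \<open>Z\<close> the payoff is -infinity and the bound is
    trivial.\<close>
  proof (cases Z)
    case (real z)
    then have "(\<integral>s. f s \<partial>S) \<le> z" using Z by simp
    then show ?thesis unfolding pe real using real f(2) g' by (simp add: distrib_left)
  qed (simp add: pe)
qed

text \<open>\<open>near\<close> says that the true cost exceeds the break-even cost \<open>a\<close>
  by at most \<open>\<epsilon>\<close>; in particular it is finite, and the comparison of
  \<open>payoff_le\<close> can be reversed.\<close>

lemma payoff_ge:
  fixes w w' :: "nat \<Rightarrow> real \<Rightarrow> real" and r :: real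
  assumes w: "\<And>k s. k \<in> {1..N} \<Longrightarrow> s \<in> {t..T} \<Longrightarrow> (w k has_real_derivative w' k s) (at s within {t..T})"
    and w': "\<And>k. k \<in> {1..N} \<Longrightarrow> continuous_on {t..T} (w' k)"
    and HJ: "\<And>k s. k \<in> {1..N} \<Longrightarrow> s \<in> {t..T} \<Longrightarrow>
        r * w k s - w' k s = Hamiltonian V L k (\<lambda>j. w j s - w k s)"
    and g: "\<And>k. k \<in> {1..N} \<Longrightarrow> w k T \<le> g k + D"
    and r: "0 \<le> r"
    and near: "\<And>k s. k \<in> {1..N} \<Longrightarrow> s \<in> {t..T} \<Longrightarrow>
        ereal (Hamiltonian V L k (\<lambda>j. w j s - w k s) - \<epsilon>) \<le>
        pre_Hamiltonian V L k (\<lambda>j. w j s - w k s) (restrict (lam s k) (V k))"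
    and \<epsilon>: "0 \<le> \<epsilon>"
  shows "ereal (w i t - disc r T * D - \<epsilon> * (T - t)) \<le> payoff r g"
proof -
  obtain C where C: "\<And>i x. i \<in> {1..N} \<Longrightarrow> x \<in> nonneg_tuples (V i) \<Longrightarrow> ereal C \<le> L i x"
    using cost_bounded_below by blast
  define a where "a k s = (\<Sum>j\<in>V k. lam s k j * (w j s - w k s)) - Hamiltonian V L k (\<lambda>j. w j s - w k s)" for k s
  \<comment> \<open>Shifting by \<open>C - \<epsilon>\<close> makes every term nonnegative, because
    \<open>C\<close> is at most the cost and the cost at most
    \<open>a k s + \<epsilon>\<close>.\<close>
  define f where "f s = (\<Sum>k\<in>{1..N}. disc r s * law s k * (a k s - (C - \<epsilon>)))" for s
  define Z where "Z = (\<integral>\<^sup>+s. (\<Sum>k\<in>{1..N}. ennreal (disc r s * law s k) *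
        e2ennreal (L k (restrict (lam s k) (V k)) - ereal C)) \<partial>S)"
  have f: "integrable S f" "(\<integral>s. f s \<partial>S) =
      disc r T * (\<Sum>k\<in>{1..N}. law T k * w k T) - w i t - (C - \<epsilon>) * (\<integral>s. disc r s \<partial>S)"
    unfolding f_def a_def by (rule integral_reward_minus_Hamiltonian[OF w w' HJ]; assumption)+
  have ptw: "0 \<le> a k s + \<epsilon> - C \<and> e2ennreal (L k (restrict (lam s k) (V k)) - ereal C) \<le> ennreal (a k s + \<epsilon> - C)"
    if k: "k \<in> {1..N}" and s: "s \<in> {t..T}" for k s
  proof -
    have "(\<Sum>j\<in>V k. restrict (lam s k) (V k) j * (w j s - w k s)) = (\<Sum>j\<in>V k. lam s k j * (w j s - w k s))"
      by (intro sum.cong) auto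
    then have "L k (restrict (lam s k) (V k)) \<le> ereal (a k s + \<epsilon>)"
      using near[OF k s] C[OF k rate_tuple[OF k s]]
      unfolding pre_Hamiltonian_def a_def by (cases "L k (restrict (lam s k) (V k))") auto
    then show ?thesis using C[OF k rate_tuple[OF k s]]
      by (cases "L k (restrict (lam s k) (V k))") (auto intro!: ennreal_leI)
  qed
  have f0: "0 \<le> f s" if "s \<in> {t..T}" for s
    unfolding f_def using ptw[OF _ that] by (intro sum_nonneg mult_nonneg_nonneg law_nonneg) (auto simp: algebra_simps)
  have "Z \<le> (\<integral>\<^sup>+s. ennreal (f s) \<partial>S)"
    unfolding Z_def
  proof (rule nn_integral_mono)
    fix s assume "s \<in> space S"
    then have s: "s \<in> {t..T}" by simp
    have "(\<Sum>k\<in>{1..N}. ennreal (disc r s * law s k) * e2ennreal (L k (restrict (lam s k) (V k)) - ereal C))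
        \<le> (\<Sum>k\<in>{1..N}. ennreal (disc r s * law s k) * ennreal (a k s + \<epsilon> - C))"
      using ptw[OF _ s] by (intro sum_mono mult_left_mono) auto
    also have "\<dots> = (\<Sum>k\<in>{1..N}. ennreal (disc r s * law s k * (a k s - (C - \<epsilon>))))"
      using ptw[OF _ s] by (intro sum.cong refl) (subst ennreal_mult[symmetric], auto simp: law_nonneg algebra_simps)
    also have "\<dots> = ennreal (f s)"
      unfolding f_def using ptw[OF _ s]
      by (intro sum_ennreal mult_nonneg_nonneg law_nonneg) (auto simp: algebra_simps)
    finally show "(\<Sum>k\<in>{1..N}. ennreal (disc r s * law s k) * e2ennreal (L k (restrict (lam s k) (V k)) - ereal C)) \<le> ennreal (f s)" .
  qed
  also have "\<dots> = ennreal (\<integral>s. f s \<partial>S)"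
    using f0 by (intro nn_integral_eq_integral f AE_I2) auto
  finally have Z: "Z \<le> ennreal (\<integral>s. f s \<partial>S)" .
  have pe: "payoff r g = - (ereal (C * (\<integral>s. disc r s \<partial>S) - disc r T * (\<Sum>k\<in>{1..N}. law T k * g k)) + enn2ereal Z)"
    unfolding Z_def by (rule payoff_eq[OF C])
  have g': "disc r T * (\<Sum>k\<in>{1..N}. law T k * w k T) \<le> disc r T * ((\<Sum>k\<in>{1..N}. law T k * g k) + D)"
    using g t by (intro mult_left_mono law_average) auto
  have "(\<integral>s. disc r s \<partial>S) \<le> (\<integral>s. 1 \<partial>S)"
    using r by (intro integral_mono disc_integrable) auto
  also have "\<dots> = T - t" using t by (simp add: measure_restrict_space)
  finally have E: "\<epsilon> * (\<integral>s. disc r s \<partial>S) \<le> \<epsilon> * (T - t)" using \<epsilon> by (intro mult_left_mono)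
  have fi: "0 \<le> (\<integral>s. f s \<partial>S)" using f0 by (intro integral_nonneg_AE AE_I2) auto
  obtain z where z: "Z = ennreal z" "0 \<le> z" "z \<le> (\<integral>s. f s \<partial>S)"
    using Z fi by (cases Z) (auto simp: top_unique)
  show ?thesis unfolding pe z(1) using z(2,3) f(2) g' E by (simp add: distrib_left left_diff_distrib)
qed

end

text \<open>Choosing near-maximisers separately at each time would raise a measurable selection
  problem. A control that is constant on the cells of a grid factors through the integers, so any
  choice is measurable; uniform continuity of \<open>w\<close> keeps it nearly optimal between grid
  times.\<close>

lemma (in controlled_graph) near_optimal_control:
  fixes w :: "nat \<Rightarrow> real \<Rightarrow> real"
  assumes tT: "t \<le> T" and w: "\<And>k. k \<in> {1..N} \<Longrightarrow> continuous_on {t..T} (w k)" and \<epsilon>: "\<epsilon> > 0"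
  obtains lam where "lam \<in> controls N V t T"
    "\<And>k s. k \<in> {1..N} \<Longrightarrow> s \<in> {t..T} \<Longrightarrow>
        ereal (Hamiltonian V L k (\<lambda>j. w j s - w k s) - \<epsilon>) \<le>
        pre_Hamiltonian V L k (\<lambda>j. w j s - w k s) (restrict (lam s k) (V k))"
proof -
  have Vi: "j \<in> {1..N}" if "i \<in> {1..N}" "j \<in> V i" for i j using V_subset[OF that(1)] that by auto
  have "\<exists>b. \<forall>s\<in>{t..T}. \<bar>w k s\<bar> \<le> b" if "k \<in> {1..N}" for k
    using compact_imp_bounded[OF compact_continuous_image[OF w[OF that] compact_Icc]]
    by (auto simp: bounded_iff)
  then obtain b where b: "\<And>k s. k \<in> {1..N} \<Longrightarrow> s \<in> {t..T} \<Longrightarrow> \<bar>w k s\<bar> \<le> b k" by metis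
  obtain R where R: "\<And>k. k \<in> {1..N} \<Longrightarrow> \<bar>b k\<bar> \<le> R" "R \<ge> 0" using finite_bound[of b] by blast
  have wR: "\<bar>w j s - w k s\<bar> \<le> 2 * R" if "k \<in> {1..N}" "j \<in> V k" "s \<in> {t..T}" for k j s
    using b[OF that(1,3)] b[OF Vi[OF that(1,2)] that(3)] R(1)[OF that(1)] R(1)[OF Vi[OF that(1,2)]] by linarith
  obtain B where B: "B > 0" "\<And>i p \<epsilon>. i \<in> {1..N} \<Longrightarrow> 0 < \<epsilon> \<Longrightarrow> \<epsilon> \<le> 1 \<Longrightarrow>
    (\<And>j. j \<in> V i \<Longrightarrow> \<bar>p j\<bar> \<le> 2 * R) \<Longrightarrow>
    \<exists>x\<in>nonneg_tuples (V i). (\<forall>j\<in>V i. x j \<le> B) \<and>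
      ereal (Hamiltonian V L i p - \<epsilon>) \<le> pre_Hamiltonian V L i p x"
    using near_maximiser[of "2 * R"] by blast
  obtain K where K: "K > 0" "\<And>i p q D. i \<in> {1..N} \<Longrightarrow> (\<And>j. j \<in> V i \<Longrightarrow> \<bar>p j\<bar> \<le> 2 * R) \<Longrightarrow>
     (\<And>j. j \<in> V i \<Longrightarrow> p j \<le> q j + D) \<Longrightarrow> D \<ge> 0 \<Longrightarrow>
     Hamiltonian V L i p \<le> Hamiltonian V L i q + K * D"
    using Hamiltonian_Lipschitz[of "2 * R"] by blast
  \<comment> \<open>Half of \<open>\<epsilon>\<close> is spent on the near-maximiser at the grid
    time. The other half pays for moving the momenta by \<open>d\<close>: \<open>K * d\<close> in
    the Hamiltonian and \<open>N * B * d\<close> in the linear term.\<close>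
  define d where "d = \<epsilon> / (2 * (K + N * B))"
  have KNB: "K + N * B > 0" using K B by (simp add: add_pos_nonneg)
  have d: "d > 0" using \<epsilon> KNB by (simp add: d_def)
  have "K * d + N * B * d = (K + N * B) * d" by (simp add: distrib_right)
  also have "c * (\<epsilon> / (2 * c)) = \<epsilon> / 2" if "c > 0" for c using that by simp
  from this[OF KNB] have "(K + N * B) * d = \<epsilon> / 2" by (simp only: d_def)
  finally have d2: "K * d + N * B * d = \<epsilon> / 2" .
  have "\<exists>\<delta>>0. \<forall>s\<in>{t..T}. \<forall>s'\<in>{t..T}. \<bar>s' - s\<bar> < \<delta> \<longrightarrow> \<bar>w k s' - w k s\<bar> < d / 2" if "k \<in> {1..N}" for k
    using compact_uniformly_continuous[OF w[OF that] compact_Icc] d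
    unfolding uniformly_continuous_on_def dist_real_def by (meson half_gt_zero)
  then obtain \<delta> where \<delta>: "\<And>k. k \<in> {1..N} \<Longrightarrow> \<delta> k > 0"
    "\<And>k s s'. k \<in> {1..N} \<Longrightarrow> s \<in> {t..T} \<Longrightarrow> s' \<in> {t..T} \<Longrightarrow> \<bar>s' - s\<bar> < \<delta> k \<Longrightarrow> \<bar>w k s' - w k s\<bar> < d / 2" by metis
  define \<delta>0 where "\<delta>0 = Min (\<delta> ` {1..N})"
  have \<delta>0: "\<delta>0 > 0" "\<And>k. k \<in> {1..N} \<Longrightarrow> \<delta>0 \<le> \<delta> k"
    unfolding \<delta>0_def using \<delta>(1) N_pos by auto
  obtain n where n: "inverse (real (Suc n)) < \<delta>0" using reals_Archimedean[OF \<delta>0(1)] by blast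
  \<comment> \<open>The left end of the cell containing \<open>s\<close>, which stays in
    \<open>{t..T}\<close> together with \<open>s\<close>.\<close>
  define \<sigma> where "\<sigma> m = t + real_of_int m / real (Suc n)" for m :: int
  define \<mu> where "\<mu> s = \<lfloor>real (Suc n) * (s - t)\<rfloor>" for s
  have \<sigma>: "\<sigma> (\<mu> s) \<in> {t..T}" "\<bar>s - \<sigma> (\<mu> s)\<bar> < \<delta>0" if s: "s \<in> {t..T}" for s
  proof -
    have "0 \<le> real_of_int (\<mu> s)" using s by (simp add: \<mu>_def)
    moreover have "real_of_int (\<mu> s) \<le> real (Suc n) * (s - t)" "real (Suc n) * (s - t) < real_of_int (\<mu> s) + 1"
      unfolding \<mu>_def by linarith+
    ultimately have "0 \<le> real_of_int (\<mu> s) / real (Suc n)" "real_of_int (\<mu> s) / real (Suc n) \<le> s - t"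
      "s - t < real_of_int (\<mu> s) / real (Suc n) + inverse (real (Suc n))"
      by (simp_all add: field_simps del: of_nat_Suc)
    then show "\<sigma> (\<mu> s) \<in> {t..T}" "\<bar>s - \<sigma> (\<mu> s)\<bar> < \<delta>0" using s n unfolding \<sigma>_def by auto
  qed
  define p where "p k s = (\<lambda>j. w j s - w k s)" for k s
  have "\<forall>k m. \<exists>x. k \<in> {1..N} \<longrightarrow> \<sigma> m \<in> {t..T} \<longrightarrow> x\<in>nonneg_tuples (V k) \<and> (\<forall>j\<in>V k. x j \<le> B) \<and>
      ereal (Hamiltonian V L k (p k (\<sigma> m)) - min 1 (\<epsilon> / 2)) \<le> pre_Hamiltonian V L k (p k (\<sigma> m)) x"
  proof (intro allI)
    fix k m
    have "\<exists>x\<in>nonneg_tuples (V k). (\<forall>j\<in>V k. x j \<le> B) \<and>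
      ereal (Hamiltonian V L k (p k (\<sigma> m)) - min 1 (\<epsilon> / 2)) \<le> pre_Hamiltonian V L k (p k (\<sigma> m)) x"
      if "k \<in> {1..N}" "\<sigma> m \<in> {t..T}"
      using wR[OF that(1) _ that(2)] \<epsilon> by (intro B(2) that) (auto simp: p_def)
    then show "\<exists>x. k \<in> {1..N} \<longrightarrow> \<sigma> m \<in> {t..T} \<longrightarrow> x\<in>nonneg_tuples (V k) \<and> (\<forall>j\<in>V k. x j \<le> B) \<and>
      ereal (Hamiltonian V L k (p k (\<sigma> m)) - min 1 (\<epsilon> / 2)) \<le> pre_Hamiltonian V L k (p k (\<sigma> m)) x" by blast
  qed
  then obtain x where x: "\<And>k m. k \<in> {1..N} \<Longrightarrow> \<sigma> m \<in> {t..T} \<Longrightarrow> x k m\<in>nonneg_tuples (V k) \<and> (\<forall>j\<in>V k. x k m j \<le> B) \<and>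
      ereal (Hamiltonian V L k (p k (\<sigma> m)) - min 1 (\<epsilon> / 2)) \<le> pre_Hamiltonian V L k (p k (\<sigma> m)) (x k m)" by metis
  define lam where "lam s k j = x k (\<mu> s) j" for s k j
  have lx: "restrict (lam s k) (V k) = x k (\<mu> s)" if "k \<in> {1..N}" "s \<in> {t..T}" for s k
    using x[OF that(1) \<sigma>(1)[OF that(2)]] unfolding lam_def nonneg_tuples_def
    by (intro extensional_restrict[of "x k (\<mu> s)" "V k", unfolded eta_contract_eq]) (auto simp: PiE_def)
  show ?thesis
  proof (rule that[of lam])
    show "lam \<in> controls N V t T" unfolding controls_def
    proof (intro CollectI ballI conjI)
      fix k j assume k: "k \<in> {1..N}" and j: "j \<in> V k"
      have bd: "0 \<le> lam s k j \<and> lam s k j \<le> B" if "s \<in> {t..T}" for s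
        using x[OF k \<sigma>(1)[OF that]] j by (auto simp: lam_def nonneg_tuples_def)
      then show "0 \<le> lam s k j" if "s \<in> {t..T}" for s using that by blast
      show "(\<lambda>s. lam s k j) absolutely_integrable_on {t..T}"
      proof (rule measurable_bounded_by_integrable_imp_absolutely_integrable)
        have "(\<lambda>s. x k (\<mu> s) j) \<in> borel_measurable borel"
          by (rule measurable_compose[where N = "count_space UNIV" and g = "\<lambda>m. x k m j"])
            (simp_all add: \<mu>_def)
        then show "(\<lambda>s. lam s k j) \<in> borel_measurable (lebesgue_on {t..T})"
          unfolding lam_def by (intro measurable_restrict_space1 measurable_completion) simp
        show "norm (lam s k j) \<le> B" if "s \<in> {t..T}" for s using bd[OF that] by simp
      qed auto
    qed
    fix k s assume k: "k \<in> {1..N}" and s: "s \<in> {t..T}"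
    define s' where "s' = \<sigma> (\<mu> s)"
    have s': "s' \<in> {t..T}" unfolding s'_def using \<sigma>(1)[OF s] .
    have close: "\<bar>w j s - w j s'\<bar> < d / 2" if "j \<in> {1..N}" for j
      using \<sigma>(2)[OF s] \<delta>0(2)[OF that] by (intro \<delta>(2)[OF that s' s]) (simp add: s'_def)
    have pc: "\<bar>p k s j - p k s' j\<bar> \<le> d" if "j \<in> V k" for j
      using close[OF k] close[OF Vi[OF k that]] unfolding p_def by linarith
    have xx: "x k (\<mu> s) \<in> nonneg_tuples (V k)" "\<And>j. j\<in>V k \<Longrightarrow> x k (\<mu> s) j \<le> B"
      "ereal (Hamiltonian V L k (p k s') - min 1 (\<epsilon> / 2)) \<le> pre_Hamiltonian V L k (p k s') (x k (\<mu> s))"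
      using x[OF k \<sigma>(1)[OF s]] by (auto simp: s'_def)
    have "Hamiltonian V L k (p k s) \<le> Hamiltonian V L k (p k s') + K * d"
    proof (rule K(2)[OF k])
      fix j assume j: "j \<in> V k"
      show "\<bar>p k s j\<bar> \<le> 2 * R" unfolding p_def by (rule wR[OF k j s])
      show "p k s j \<le> p k s' j + d" using pc[OF j] by linarith
    qed (use d in simp)
    moreover have "(\<Sum>j\<in>V k. x k (\<mu> s) j * p k s' j) \<le> (\<Sum>j\<in>V k. x k (\<mu> s) j * p k s j) + N * B * d"
    proof (rule tuple_sum_le[OF k xx(1,2)])
      fix j assume j: "j \<in> V k"
      show "p k s' j \<le> p k s j + d" using pc[OF j] by linarith
    qed (use B d in auto)
    moreover have "min 1 (\<epsilon> / 2) \<le> \<epsilon> / 2" by simp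
    ultimately have "ereal (Hamiltonian V L k (p k s) - \<epsilon>) \<le> pre_Hamiltonian V L k (p k s) (x k (\<mu> s))"
      using xx(3) d2 unfolding pre_Hamiltonian_def by (cases "L k (x k (\<mu> s))") auto
    then show "ereal (Hamiltonian V L k (\<lambda>j. w j s - w k s) - \<epsilon>) \<le>
        pre_Hamiltonian V L k (\<lambda>j. w j s - w k s) (restrict (lam s k) (V k))"
      by (simp add: lx[OF k s] p_def)
  qed
qed

lemma (in controlled_graph) value_function_verification:
  fixes M :: "'a measure" and w w' :: "nat \<Rightarrow> real \<Rightarrow> real" and r t T D :: real
  assumes prob: "prob_space M" and filt: "usual_conditions M F"
    and t: "0 \<le> t" "t \<le> T" and r: "0 \<le> r" and i: "i \<in> {1..N}"
    and chain: "\<And>lam. lam \<in> controls N V t T \<Longrightarrow>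
                  markov_chain_with_rates N V M F lam t T i (X T t i lam)"
    and w: "\<And>k s. k \<in> {1..N} \<Longrightarrow> s \<in> {t..T} \<Longrightarrow> (w k has_real_derivative w' k s) (at s within {t..T})"
    and w': "\<And>k. k \<in> {1..N} \<Longrightarrow> continuous_on {t..T} (w' k)"
    and HJ: "\<And>k s. k \<in> {1..N} \<Longrightarrow> s \<in> {t..T} \<Longrightarrow>
        r * w k s - w' k s = Hamiltonian V L k (\<lambda>j. w j s - w k s)"
    and g: "\<And>k. k \<in> {1..N} \<Longrightarrow> \<bar>w k T - g k\<bar> \<le> D"
  shows "\<bar>value_function N V L g M X T r i t - w i t\<bar> \<le> exp (- r * (T - t)) * D"
proof -
  have g': "g k \<le> w k T + D" "w k T \<le> g k + D" if "k \<in> {1..N}" for k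
    using g[OF that] by linarith+
  let ?S = "SUP lam\<in>controls N V t T. expected_payoff V L g M X T r i t lam"
  have cc: "controlled_chain N V L M F lam t T i (X T t i lam)" if "lam \<in> controls N V t T" for lam
    using controlled_graph_axioms prob filt t i chain[OF that] that
    by (auto simp: controlled_chain_def controlled_chain_axioms_def)
  have pay: "expected_payoff V L g M X T r i t lam =
      controlled_chain.payoff V L M lam t T (X T t i lam) r g" if "lam \<in> controls N V t T" for lam
    unfolding controlled_chain.payoff_def[OF cc[OF that]] expected_payoff_def ..
  have "?S \<le> ereal (w i t + exp (- r * (T - t)) * D)"
  proof (rule SUP_least)
    fix lam assume lam: "lam \<in> controls N V t T"
    show "expected_payoff V L g M X T r i t lam \<le> ereal (w i t + exp (- r * (T - t)) * D)"
      unfolding pay[OF lam] by (rule controlled_chain.payoff_le[OF cc[OF lam] w w' HJ g'(1)])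
  qed
  moreover have "ereal (w i t - exp (- r * (T - t)) * D) \<le> ?S"
  proof (rule ereal_le_epsilon2)
    fix \<epsilon> :: real assume \<epsilon>: "0 < \<epsilon>"
    \<comment> \<open>The error accumulates over a time \<open>T - t\<close>; the 1 covers the case
      \<open>T = t\<close>.\<close>
    define \<epsilon>' where "\<epsilon>' = \<epsilon> / (T - t + 1)"
    have \<epsilon>': "\<epsilon>' > 0" "\<epsilon>' * (T - t) \<le> \<epsilon>" using \<epsilon> t by (auto simp: \<epsilon>'_def field_simps)
    have wc: "continuous_on {t..T} (w k)" if "k \<in> {1..N}" for k
      using w[OF that] by (intro DERIV_continuous_on) auto
    obtain lam where lam: "lam \<in> controls N V t T" and
      near: "\<And>k s. k \<in> {1..N} \<Longrightarrow> s \<in> {t..T} \<Longrightarrow>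
        ereal (Hamiltonian V L k (\<lambda>j. w j s - w k s) - \<epsilon>') \<le>
        pre_Hamiltonian V L k (\<lambda>j. w j s - w k s) (restrict (lam s k) (V k))"
      using near_optimal_control[where w = w, OF t(2) wc \<epsilon>'(1)] by blast
    have "ereal (w i t - exp (- r * (T - t)) * D - \<epsilon>' * (T - t)) \<le> expected_payoff V L g M X T r i t lam"
      unfolding pay[OF lam] using \<epsilon>'(1)
      by (intro controlled_chain.payoff_ge[OF cc[OF lam] w w' HJ g'(2) r near]) simp_all
    also have "\<dots> \<le> ?S" using lam by (rule SUP_upper)
    finally have "ereal (w i t - exp (- r * (T - t)) * D - \<epsilon>' * (T - t)) + ereal \<epsilon> \<le> ?S + ereal \<epsilon>"
      by (rule add_right_mono)
    moreover have "ereal (w i t - exp (- r * (T - t)) * D) \<le>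
        ereal (w i t - exp (- r * (T - t)) * D - \<epsilon>' * (T - t)) + ereal \<epsilon>"
      using \<epsilon>' by simp
    ultimately show "ereal (w i t - exp (- r * (T - t)) * D) \<le> ?S + ereal \<epsilon>" by (rule order_trans[rotated])
  qed
  ultimately show ?thesis unfolding value_function_def by (cases ?S) (auto simp: abs_le_iff)
qed

section \<open>Convergence\<close>

text \<open>Optimality of \<open>x n\<close> against a fixed competitor \<open>z\<close> of finite
  cost bounds the cost of \<open>x n\<close> by a convergent sequence. Lower semicontinuity is
  exactly what passes such an upper bound on to the cost of the limit.\<close>

lemma (in controlled_graph) Hamiltonian_argmax_closed:
  assumes i: "i \<in> {1..N}"
    and arg: "\<forall>\<^sub>F n in sequentially. x n \<in> Hamiltonian_argmax V L i (p n)"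
    and x: "\<And>j. j \<in> V i \<Longrightarrow> (\<lambda>n. x n j) \<longlonglongrightarrow> y j" and y: "y \<in> extensional (V i)"
    and p: "\<And>j. j \<in> V i \<Longrightarrow> (\<lambda>n. p n j) \<longlonglongrightarrow> q j"
  shows "y \<in> Hamiltonian_argmax V L i q"
proof -
  have arg': "\<forall>\<^sub>F n in sequentially. x n \<in> nonneg_tuples (V i) \<and>
      (\<forall>z\<in>nonneg_tuples (V i). pre_Hamiltonian V L i (p n) z \<le> pre_Hamiltonian V L i (p n) (x n))"
    using arg by eventually_elim (auto simp: Hamiltonian_argmax_def is_arg_max_linorder)
  then have xn: "\<forall>\<^sub>F n in sequentially. x n \<in> nonneg_tuples (V i)" by eventually_elim simp
  have "0 \<le> y j" if j: "j \<in> V i" for j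
    by (rule tendsto_lowerbound[OF x[OF j]])
      (use xn in \<open>auto elim!: eventually_mono simp: nonneg_tuples_def PiE_iff j\<close>)
  then have yn: "y \<in> nonneg_tuples (V i)" using y by (auto simp: nonneg_tuples_def PiE_iff)
  \<comment> \<open>Outside \<open>V i\<close> extensionality forces one common value, so
    convergence on \<open>V i\<close> is convergence in the product topology, in which the cost is
    semicontinuous.\<close>
  have "(\<lambda>n. x n j) \<longlonglongrightarrow> y j" for j
  proof (cases "j \<in> V i")
    case False
    have "\<forall>\<^sub>F n in sequentially. x n j = y j"
      using xn by eventually_elim (use False y in \<open>auto simp: nonneg_tuples_def PiE_iff extensional_def\<close>)
    then show ?thesis by (rule tendsto_eventually)
  qed (rule x)
  then have "limitin (product_topology (\<lambda>_. euclidean) UNIV) x y sequentially"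
    unfolding limitin_componentwise by simp
  then have xy: "x \<longlonglongrightarrow> y" by (simp add: euclidean_product_topology)
  have lsc: "\<forall>\<^sub>F n in sequentially. a < L i (x n)" if "a < L i y" for a
  proof -
    have "lower_semicontinuous_on (nonneg_tuples (V i)) (L i)"
      using cost i by (auto simp: admissible_cost_def)
    then obtain G where G: "open G" "{x\<in>nonneg_tuples (V i). a < L i x} = nonneg_tuples (V i) \<inter> G"
      using lower_semicontinuous_superlevel_open by blast
    then have "y \<in> G" using yn that by blast
    then have "\<forall>\<^sub>F n in sequentially. x n \<in> G" using topological_tendstoD[OF xy G(1)] by blast
    with xn show ?thesis by eventually_elim (use G(2) in blast)
  qed
  obtain C where C: "\<And>i x. i \<in> {1..N} \<Longrightarrow> x \<in> nonneg_tuples (V i) \<Longrightarrow> ereal C \<le> L i x"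
    using cost_bounded_below by blast
  have "pre_Hamiltonian V L i q z \<le> pre_Hamiltonian V L i q y" if z: "z \<in> nonneg_tuples (V i)" for z
  proof (cases "L i z")
    case (real l)
    define c where "c n = (\<Sum>j\<in>V i. x n j * p n j) - (\<Sum>j\<in>V i. z j * p n j) + l" for n
    define c0 where "c0 = (\<Sum>j\<in>V i. y j * q j) - (\<Sum>j\<in>V i. z j * q j) + l"
    have c: "c \<longlonglongrightarrow> c0"
      unfolding c_def[abs_def] c0_def by (intro tendsto_intros x p)
    have "L i y \<le> ereal c0"
    \<comment> \<open>Any \<open>a\<close> below the cost of \<open>y\<close> is eventually below
      the cost of \<open>x n\<close>, hence below \<open>c n\<close>, hence at most the limit
      \<open>c0\<close>.\<close>
    proof (rule dense_le)
      fix a assume "a < L i y"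
      from lsc[OF this] arg' have "\<forall>\<^sub>F n in sequentially. a \<le> ereal (c n)"
      proof eventually_elim
        case (elim n)
        then have "pre_Hamiltonian V L i (p n) z \<le> pre_Hamiltonian V L i (p n) (x n)" using z by blast
        moreover have "ereal C \<le> L i (x n)" using C[OF i] elim by blast
        ultimately have "L i (x n) \<le> ereal (c n)"
          unfolding pre_Hamiltonian_def real c_def by (cases "L i (x n)") auto
        then show ?case using elim by simp
      qed
      then show "a \<le> ereal c0" using c by (intro tendsto_lowerbound[of "\<lambda>n. ereal (c n)"]) auto
    qed
    then show ?thesis unfolding pre_Hamiltonian_def real c0_def
      using C[OF i yn] by (cases "L i y") auto
  qed (use C[OF i z] in \<open>auto simp: pre_Hamiltonian_def\<close>)
  then show ?thesis using yn by (auto simp: Hamiltonian_argmax_def is_arg_max_linorder)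
qed

theorem corollary1:
  fixes N :: nat
    and V :: "nat \<Rightarrow> nat set"
    and L :: "nat \<Rightarrow> (nat \<Rightarrow> real) \<Rightarrow> ereal"
    and g :: "nat \<Rightarrow> real"
    and M :: "'a measure"
    and F :: "real \<Rightarrow> 'a measure"
    and X :: "real \<Rightarrow> real \<Rightarrow> nat \<Rightarrow> (real \<Rightarrow> nat \<Rightarrow> nat \<Rightarrow> real) \<Rightarrow> real \<Rightarrow> 'a \<Rightarrow> nat"
    and u_inf :: "real \<Rightarrow> nat \<Rightarrow> real"
    and \<gamma> :: real
    and r :: "nat \<Rightarrow> real"
    and \<xi> :: "nat \<Rightarrow> real"
    and U :: "nat \<Rightarrow> real \<Rightarrow> real"
  defines "u \<equiv> value_function N V L g M X"
  assumes graph: "strongly_connected_digraph N V"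
    and cost: "admissible_cost N V L"
    and prob: "prob_space M"
    and filt: "usual_conditions M F"
    and chain: "\<And>t T i lam. 0 \<le> t \<Longrightarrow> t \<le> T \<Longrightarrow> i \<in> {1..N} \<Longrightarrow> lam \<in> controls N V t T \<Longrightarrow>
                  markov_chain_with_rates N V M F lam t T i (X T t i lam)"
    and u_inf: "\<And>\<rho> i t. \<rho> > 0 \<Longrightarrow> i \<in> {1..N} \<Longrightarrow> t \<ge> 0 \<Longrightarrow>
                  ((\<lambda>T. u T \<rho> i t) \<longlongrightarrow> u_inf \<rho> i) at_top"
    and gamma: "\<And>i. i \<in> {1..N} \<Longrightarrow> ((\<lambda>\<rho>. \<rho> * u_inf \<rho> i) \<longlongrightarrow> \<gamma>) (at_right 0)"
    and r_pos: "\<And>n. r n > 0"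
    and r_lim: "r \<longlonglongrightarrow> 0"
    and xi: "\<And>i. i \<in> {1..N} \<Longrightarrow> (\<lambda>n. u_inf (r n) i - u_inf (r n) 1) \<longlonglongrightarrow> \<xi> i"
    and U: "C1_HJ_solution N V L g U"
    and H_mono: "\<And>i j p. i \<in> {1..N} \<Longrightarrow> j \<in> V i \<Longrightarrow>
                  strict_mono (\<lambda>x. Hamiltonian V L i (p(j := x)))"
  shows "(\<exists>q_inf::real.
            ((\<lambda>t. SUP i\<in>{1..N}. U i t - \<gamma> * t - \<xi> i) \<longlongrightarrow> q_inf) at_top \<and>
            (\<forall>i\<in>{1..N}. \<forall>t\<ge>0.
               (\<lambda>T. u T 0 i t - (\<gamma> * (T - t) + \<xi> i + q_inf)) \<in> o[at_top](\<lambda>_. 1))) \<and>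
         (\<forall>lam_opt :: real \<Rightarrow> real \<Rightarrow> nat \<Rightarrow> nat \<Rightarrow> real.
            (\<forall>T>0. lam_opt T \<in> controls N V 0 T \<and>
                   optimal_control N V L g M X T 0 (lam_opt T) \<and>
                   (\<forall>i\<in>{1..N}. \<forall>t\<in>{0..T}.
                      restrict (lam_opt T t i) (V i)
                        \<in> Hamiltonian_argmax V L i (\<lambda>j. u T 0 j t - u T 0 i t))) \<longrightarrow>
            (\<forall>t\<ge>0. \<forall>lam :: nat \<Rightarrow> nat \<Rightarrow> real.
               (\<exists>Tn. filterlim Tn at_top sequentially \<and>
                     (\<forall>i\<in>{1..N}. \<forall>j\<in>V i. (\<lambda>n. lam_opt (Tn n) t i j) \<longlonglongrightarrow> lam i j)) \<longrightarrow>
               (\<forall>i\<in>{1..N}.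
                  restrict (lam i) (V i) \<in> Hamiltonian_argmax V L i (\<lambda>j. \<xi> j - \<xi> i))))"
proof -
  interpret controlled_graph N V L using graph cost by unfold_locales
  have Vi: "j \<in> {1..N}" if "i \<in> {1..N}" "j \<in> V i" for i j using V_subset[OF that(1)] that by auto

  have "\<forall>i\<in>{1..N}. \<exists>U'. continuous_on {0..} U' \<and> (\<forall>t\<ge>0. (U i has_real_derivative U' t) (at t within {0..}) \<and>
      - U' t + Hamiltonian V L i (\<lambda>j. U j t - U i t) = 0)" and U0: "\<And>i. i \<in> {1..N} \<Longrightarrow> U i 0 = g i"
    using U unfolding C1_HJ_solution_def by blast+
  from bchoice[OF this(1)] obtain U' where
    *: "\<And>i. i \<in> {1..N} \<Longrightarrow> continuous_on {0..} (U' i) \<and> (\<forall>t\<ge>0. (U i has_real_derivative U' i t) (at t within {0..}) \<and>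
      - U' i t + Hamiltonian V L i (\<lambda>j. U j t - U i t) = 0)" by blast
  have U': "continuous_on {0..} (U' i)"
    "\<And>t. t \<ge> 0 \<Longrightarrow> (U i has_real_derivative U' i t) (at t within {0..})"
    "\<And>t. t \<ge> 0 \<Longrightarrow> U' i t = Hamiltonian V L i (\<lambda>j. U j t - U i t)" if "i \<in> {1..N}" for i
    using *[OF that] by auto

  have u_eq: "u T 0 i t = U i (T - t)" if tT: "0 \<le> t" "t \<le> T" and i: "i \<in> {1..N}" for T t i
  proof -
    \<comment> \<open>The mismatch is 0 because \<open>U k 0 = g k\<close>.\<close>
    have "\<bar>value_function N V L g M X T 0 i t - U i (T - t)\<bar> \<le> exp (- 0 * (T - t)) * 0"
    proof (rule value_function_verification[where w = "\<lambda>k s. U k (T - s)" and w' = "\<lambda>k s. - U' k (T - s)"])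
      fix k s assume k: "k \<in> {1..N}" and s: "s \<in> {t..T}"
      have "(U k has_real_derivative U' k (T - s)) (at (T - s) within (\<lambda>s. T - s) ` {t..T})"
        using s tT by (intro DERIV_subset[OF U'(2)[OF k]]) auto
      moreover have "((\<lambda>s. T - s) has_real_derivative - 1) (at s within {t..T})"
        by (auto intro!: derivative_eq_intros)
      ultimately show "((\<lambda>s. U k (T - s)) has_real_derivative - U' k (T - s)) (at s within {t..T})"
        using DERIV_image_chain[of "U k" "U' k (T - s)" "\<lambda>s. T - s" s "{t..T}" "- 1"] by (simp add: o_def)
      show "0 * U k (T - s) - - U' k (T - s) = Hamiltonian V L k (\<lambda>j. U j (T - s) - U k (T - s))"
        using U'(3)[OF k, of "T - s"] s by simp
    next
      fix k assume k: "k \<in> {1..N}"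
      show "continuous_on {t..T} (\<lambda>s. - U' k (T - s))"
        using tT by (intro continuous_on_minus continuous_on_compose2[OF U'(1)[OF k]] continuous_intros) auto
      show "\<bar>U k (T - T) - g k\<bar> \<le> 0" using U0[OF k] by simp
    qed (use tT i prob filt chain in auto)
    then show ?thesis by (simp add: u_def)
  qed

  have stationary: "\<rho> * u_inf \<rho> i = Hamiltonian V L i (\<lambda>j. u_inf \<rho> j - u_inf \<rho> i)"
    if \<rho>: "\<rho> > 0" and i: "i \<in> {1..N}" for \<rho> i
  proof -
    obtain v where v: "\<And>i. i \<in> {1..N} \<Longrightarrow> \<rho> * v i = Hamiltonian V L i (\<lambda>j. v j - v i)"
      using discounted_stationary_solution[OF \<rho>] by blast
    obtain D where D: "\<And>k. k \<in> {1..N} \<Longrightarrow> \<bar>v k - g k\<bar> \<le> D"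
      using finite_bound[of "\<lambda>k. v k - g k"] by blast
    have "u_inf \<rho> k = v k" if k: "k \<in> {1..N}" for k
    proof -
      \<comment> \<open>The stationary solution solves the evolution equation for every horizon, but
        with terminal value \<open>v\<close> instead of \<open>g\<close>; the discount makes the
        difference vanish as \<open>T\<close> grows.\<close>
      have "\<bar>u T \<rho> k 0 - v k\<bar> \<le> exp (- \<rho> * (T - 0)) * D" if T: "0 \<le> T" for T
        unfolding u_def
        by (rule value_function_verification[where w = "\<lambda>k s. v k" and w' = "\<lambda>k s. 0"])
          (use T \<rho> k prob filt chain v D in auto)
      then have bound: "\<forall>\<^sub>F T in at_top. norm (u T \<rho> k 0 - v k) \<le> exp (- \<rho> * T) * D"
        by (intro eventually_mono[OF eventually_ge_at_top[of "0::real"]]) simp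
      have "((\<lambda>T. exp (- \<rho> * T) * D) \<longlongrightarrow> 0 * D) at_top"
        using \<rho> by (intro tendsto_mult tendsto_const filterlim_compose[OF exp_at_bot]
            filterlim_tendsto_neg_mult_at_bot[OF tendsto_const]) (auto simp: filterlim_ident)
      then have "((\<lambda>T. u T \<rho> k 0 - v k) \<longlongrightarrow> 0) at_top"
        using Lim_null_comparison[OF bound] by simp
      then have "((\<lambda>T. u T \<rho> k 0) \<longlongrightarrow> v k) at_top" by (simp add: LIM_zero_iff)
      with u_inf[OF \<rho> k, of 0] show ?thesis using tendsto_unique[OF trivial_limit_at_top_linorder] by force
    qed
    then have eqs: "u_inf \<rho> i = v i" "\<And>j. j \<in> V i \<Longrightarrow> u_inf \<rho> j = v j" using i Vi by blast+
    \<comment> \<open>The two momenta agree only on \<open>V i\<close>, not as functions, hence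
      monotonicity in both directions.\<close>
    have "Hamiltonian V L i (\<lambda>j. u_inf \<rho> j - u_inf \<rho> i) = Hamiltonian V L i (\<lambda>j. v j - v i)"
      using eqs by (intro antisym Hamiltonian_mono i) auto
    then show ?thesis using v[OF i] eqs(1) by simp
  qed

  have ergodic: "Hamiltonian V L i (\<lambda>j. \<xi> j - \<xi> i) = \<gamma>" if i: "i \<in> {1..N}" for i
  proof -
    have r: "filterlim r (at_right 0) sequentially"
      using r_lim r_pos by (simp add: filterlim_at less_imp_neq[THEN not_sym])
    have "(\<lambda>n. r n * u_inf (r n) i) \<longlonglongrightarrow> \<gamma>"
      by (rule filterlim_compose[OF gamma[OF i] r])
    moreover have "(\<lambda>n. r n * u_inf (r n) i) \<longlonglongrightarrow> Hamiltonian V L i (\<lambda>j. \<xi> j - \<xi> i)"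
      unfolding stationary[OF r_pos i]
    proof (rule tendsto_Hamiltonian[OF i])
      fix j assume "j \<in> V i"
      from tendsto_diff[OF xi[OF Vi[OF i this]] xi[OF i]]
      show "(\<lambda>n. u_inf (r n) j - u_inf (r n) i) \<longlonglongrightarrow> \<xi> j - \<xi> i" by simp
    qed
    ultimately show ?thesis using LIMSEQ_unique by blast
  qed

  define w where "w i t = U i t - \<gamma> * t - \<xi> i" for i t
  have w_cont: "continuous_on {0..} (w i)" if i: "i \<in> {1..N}" for i
    unfolding w_def[abs_def] using U'(2)[OF i]
    by (intro continuous_intros DERIV_continuous_on[where D = "U' i"]) auto
  have w_deriv: "(w i has_real_derivative Hamiltonian V L i (\<lambda>j. \<xi> j - \<xi> i + (w j t - w i t)) - \<gamma>) (at t)"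
    if i: "i \<in> {1..N}" and t: "t > 0" for i t
  proof -
    have "(U i has_real_derivative U' i t) (at t within {0<..})"
      by (rule DERIV_subset[OF U'(2)[OF i]]) (use t in auto)
    then have "(U i has_real_derivative U' i t) (at t)"
      using at_within_open[OF _ open_greaterThan, of t 0] t by simp
    then have "(w i has_real_derivative U' i t - \<gamma>) (at t)"
      unfolding w_def by (auto intro!: derivative_eq_intros)
    \<comment> \<open>The drift \<open>\<gamma> * t\<close> is common to all nodes and drops out of
      the differences.\<close>
    moreover have "(\<lambda>j. \<xi> j - \<xi> i + (w j t - w i t)) = (\<lambda>j. U j t - U i t)" by (simp add: w_def)
    ultimately show ?thesis using U'(3)[OF i, of t] t by simp
  qed
  obtain q where q: "\<And>i. i \<in> {1..N} \<Longrightarrow> (w i \<longlongrightarrow> q) at_top"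
    by (rule long_time_convergence[OF H_mono ergodic w_cont w_deriv]) (blast intro: that)+

  have "((\<lambda>t. SUP i\<in>{1..N}. U i t - \<gamma> * t - \<xi> i) \<longlongrightarrow> q) at_top"
  proof (rule tendstoI)
    fix e :: real assume e: "e > 0"
    have "\<forall>\<^sub>F t in at_top. \<forall>i\<in>{1..N}. dist (w i t) q < e / 2"
      using tendstoD[OF q, of _ "e / 2"] e by (intro eventually_ball_finite) auto
    then show "\<forall>\<^sub>F t in at_top. dist (SUP i\<in>{1..N}. U i t - \<gamma> * t - \<xi> i) q < e"
    proof eventually_elim
      case (elim t)
      have ne: "{1..N} \<noteq> {}" using N_pos by simp
      have b: "w i t \<le> q + e / 2" "q - e / 2 \<le> w i t" if "i \<in> {1..N}" for i
        using bspec[OF elim that] unfolding dist_real_def by linarith+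
      have "(SUP i\<in>{1..N}. w i t) \<le> q + e / 2" by (rule cSUP_least[OF ne b(1)])
      moreover have "q - e / 2 \<le> (SUP i\<in>{1..N}. w i t)"
        using b(2)[of 1] N_pos cSUP_upper[of 1 "{1..N}" "\<lambda>i. w i t"] by simp
      ultimately show ?case using e unfolding w_def dist_real_def by linarith
    qed
  qed
  moreover have "(\<lambda>T. u T 0 i t - (\<gamma> * (T - t) + \<xi> i + q)) \<in> o[at_top](\<lambda>_. 1)"
    if i: "i \<in> {1..N}" and t: "t \<ge> 0" for i t
  proof (rule smalloI_tendsto)
    have "filterlim (\<lambda>T. T - t) at_top at_top"
      using filterlim_tendsto_add_at_top[OF tendsto_const[of "- t"] filterlim_ident] by simp
    from filterlim_compose[OF q[OF i] this] have "((\<lambda>T. w i (T - t) - q) \<longlongrightarrow> 0) at_top"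
      by (simp add: LIM_zero)
    moreover have "\<forall>\<^sub>F T in at_top. w i (T - t) - q = (u T 0 i t - (\<gamma> * (T - t) + \<xi> i + q)) / 1"
      using eventually_ge_at_top[of t] by eventually_elim (simp add: u_eq[OF t _ i] w_def)
    ultimately show "((\<lambda>T. (u T 0 i t - (\<gamma> * (T - t) + \<xi> i + q)) / 1) \<longlongrightarrow> 0) at_top"
      using tendsto_cong by fast
  qed simp
  moreover have "restrict (lam i) (V i) \<in> Hamiltonian_argmax V L i (\<lambda>j. \<xi> j - \<xi> i)"
    if opt: "\<forall>T>0. lam_opt T \<in> controls N V 0 T \<and>
                   optimal_control N V L g M X T 0 (lam_opt T) \<and>
                   (\<forall>i\<in>{1..N}. \<forall>t\<in>{0..T}.
                      restrict (lam_opt T t i) (V i)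
                        \<in> Hamiltonian_argmax V L i (\<lambda>j. u T 0 j t - u T 0 i t))"
      and t: "t \<ge> 0" and Tn: "filterlim Tn at_top sequentially"
      and lim: "\<forall>i\<in>{1..N}. \<forall>j\<in>V i. (\<lambda>n. lam_opt (Tn n) t i j) \<longlonglongrightarrow> lam i j"
      and i: "i \<in> {1..N}" for lam_opt t lam Tn i
  proof (rule Hamiltonian_argmax_closed[OF i])
    \<comment> \<open>Optimality is assumed for positive horizons and times up to the horizon; 1
      secures the former, \<open>t\<close> the latter.\<close>
    have "\<forall>\<^sub>F n in sequentially. max t 1 \<le> Tn n"
      using Tn unfolding filterlim_at_top by blast
    then show "\<forall>\<^sub>F n in sequentially. restrict (lam_opt (Tn n) t i) (V i)
        \<in> Hamiltonian_argmax V L i (\<lambda>j. u (Tn n) 0 j t - u (Tn n) 0 i t)"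
      by eventually_elim (use opt t i in auto)
    show "(\<lambda>n. restrict (lam_opt (Tn n) t i) (V i) j) \<longlonglongrightarrow> restrict (lam i) (V i) j" if "j \<in> V i" for j
      using lim i that by simp
    show "(\<lambda>n. u (Tn n) 0 j t - u (Tn n) 0 i t) \<longlonglongrightarrow> \<xi> j - \<xi> i" if j: "j \<in> V i" for j
    proof -
      have Tnt: "filterlim (\<lambda>n. Tn n - t) at_top sequentially"
        using filterlim_tendsto_add_at_top[OF tendsto_const[of "- t"] Tn] by simp
      \<comment> \<open>The limit \<open>q\<close> is the same at all nodes, so only the difference
        of the \<open>\<xi>\<close> survives.\<close>
      have "(\<lambda>n. (w j (Tn n - t) - w i (Tn n - t)) + (\<xi> j - \<xi> i)) \<longlonglongrightarrow> (q - q) + (\<xi> j - \<xi> i)"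
        by (intro tendsto_intros filterlim_compose[OF q Tnt] i Vi[OF i j])
      moreover have "\<forall>\<^sub>F n in sequentially. t \<le> Tn n" using Tn by (simp add: filterlim_at_top)
      then have "\<forall>\<^sub>F n in sequentially. (w j (Tn n - t) - w i (Tn n - t)) + (\<xi> j - \<xi> i) =
          u (Tn n) 0 j t - u (Tn n) 0 i t"
        by eventually_elim (simp add: u_eq[OF t _ i] u_eq[OF t _ Vi[OF i j]] w_def)
      ultimately show ?thesis using tendsto_cong by fastforce
    qed
  qed simp
  ultimately show ?thesis by blast
qed

end
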